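(* For each of the following five functions $u$, the 5-web $\mathcal T[u]$ (at any point of $\mathbb C^2$ where $u$ is holomorphic and satisfies the transversality condition (T)) is exceptional, and the five webs so obtained are pairwise non-equivalent: (A) $u(x,y)=\tanh x\,\tanh y$; (B) $u(x,y)=\sin x\,\sin y$; (C) $u(x,y)=e^x+e^y$; (D) $u(x,y)=x^2-y^2$; (E) $u(x,y)=x^2+y^2$.
   Context: Everything is local and complex-analytic: function means germ of holomorphic function at a base point $(x_0,y_0)\in\mathbb C^2$; local diffeomorphism means germ of biholomorphism. If $du(x_0,y_0)\ne0$, $\mathcal F(u)$ is the germ of foliation whose leaves are the level curves of $u$. For $d\ge 3$, a $d$-web $\mathcal T(u_1,\dots,u_d)$ at $(x_0,y_0)$ is an unordered family of $d$ foliations $\mathcal F(u_1),\dots,\mathcal F(u_d)$ with $du_j\wedge du_k\neq0$ at $(x_0,y_0)$ for $j\ne k$. Two germs of $d$-webs (at possibly different points) are equivalent if a local diffeomorphism sends one onto the other. The rank of the web is the dimension of the complex vector space of tuples of one-variable germs $(\phi_1,\dots,\phi_d)$ ($\phi_j$ at $u_j(x_0,y_0)$) with $\sum_j\phi_j(u_j)\,du_j=0$; it is at most $(d-1)(d-2)/2$, and the web has maximal rank if equality holds. Algebraic webs: let $C$ be a reduced algebraic curve of degree $d$ in the dual projective plane $\check{\mathbb P}\mathbb C^2$; a point $p\in\check{\mathbb P}\mathbb C^2$ represents a line $l(p)\subset\mathbb P\mathbb C^2$, and a point $z\in \mathbb P\mathbb C^2$ gives the line $l_z\subset\check{\mathbb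 P}\mathbb C^2$ of lines through $z$. If $l_{z_0}$ meets $C$ in $d$ distinct points, then for $z$ near $z_0$ the points $p_1(z),\dots,p_d(z)$ of $l_z\cap C$ give $d$ lines $l(p_j(z))$ through $z$, defining a germ of $d$-web at $z_0$ (leaves are pieces of lines). A web is algebraic if obtained in this way, algebraizable if equivalent to an algebraic web, and exceptional if it has maximal rank and is not algebraizable. $\mathcal T[u]=\mathcal T(x,y,x+y,x-y,u(x,y))$. Transversality condition (T) at $(x_0,y_0)$: $u_xu_y(u_x^2-u_y^2)\neq0$ at $(x_0,y_0)$. Non-equivalence of two of the webs means: no germ of one (at a point where its $u$ is holomorphic and satisfies (T)) is equivalent to a germ of the other. *)

theory Defs
  imports
    "HOL-Complex_Analysis.Complex_Analysis"
    "HOL-Computational_Algebra.Squarefree"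
    "HOL-Library.Function_Algebras"
begin

type_synonym plane = "complex \<times> complex"

definition holo2_on :: "(plane \<Rightarrow> complex) \<Rightarrow> plane set \<Rightarrow> bool" where
  "holo2_on f U \<longleftrightarrow> open U \<and>
     (\<forall>q\<in>U. \<exists>a b. (f has_derivative (\<lambda>(h, k). a * h + b * k)) (at q))"

definition holo2_at :: "(plane \<Rightarrow> complex) \<Rightarrow> plane \<Rightarrow> bool" where
  "holo2_at f p \<longleftrightarrow> (\<exists>U. p \<in> U \<and> holo2_on f U)"

definition pdx :: "(plane \<Rightarrow> complex) \<Rightarrow> plane \<Rightarrow> complex" where
  "pdx f p = deriv (\<lambda>t. f (t, snd p)) (fst p)"

definition pdy :: "(plane \<Rightarrow> complex) \<Rightarrow> plane \<Rightarrow> complex" where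
  "pdy f p = deriv (\<lambda>t. f (fst p, t)) (snd p)"

text \<open>The coefficient of \<open>du \<and> dv\<close> with respect to \<open>dx \<and> dy\<close>.\<close>

definition wedge :: "(plane \<Rightarrow> complex) \<Rightarrow> (plane \<Rightarrow> complex) \<Rightarrow> plane \<Rightarrow> complex" where
  "wedge u v p = pdx u p * pdy v p - pdy u p * pdx v p"

definition local_diffeo :: "(plane \<Rightarrow> plane) \<Rightarrow> plane \<Rightarrow> plane \<Rightarrow> bool" where
  "local_diffeo \<Phi> p q \<longleftrightarrow> \<Phi> p = q \<and>
     (\<exists>U V \<Psi>. p \<in> U \<and> q \<in> V \<and> homeomorphism U V \<Phi> \<Psi> \<and>
        holo2_on (fst \<circ> \<Phi>) U \<and> holo2_on (snd \<circ> \<Phi>) U \<and>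
        holo2_on (fst \<circ> \<Psi>) V \<and> holo2_on (snd \<circ> \<Psi>) V)"

text \<open>
  The germ at \<open>p\<close> of the foliation \<open>\<F>(u)\<close> is encoded as the set of all its local first
  integrals: the submersions having the same level curves as \<open>u\<close> near \<open>p\<close>.  Two submersions
  thus define the same foliation germ iff these sets coincide.
\<close>

definition submersion_at :: "(plane \<Rightarrow> complex) \<Rightarrow> plane \<Rightarrow> bool" where
  "submersion_at u p \<longleftrightarrow> holo2_at u p \<and> (pdx u p \<noteq> 0 \<or> pdy u p \<noteq> 0)"

definition foliation :: "plane \<Rightarrow> (plane \<Rightarrow> complex) \<Rightarrow> (plane \<Rightarrow> complex) set" where
  "foliation p u = {v. submersion_at v p \<and>
     (\<exists>U. open U \<and> p \<in> U \<and> (\<forall>a\<in>U. \<forall>b\<in>U. v a = v b \<longleftrightarrow> u a = u b))}"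

text \<open>
  A list \<open>us\<close> of defining functions presents the germ at \<open>p\<close> of the web
  \<open>\<T>(us ! 0, us ! 1, \<dots>)\<close>; the web itself is the unordered family \<open>foliation p ` set us\<close>.
\<close>

definition is_web :: "plane \<Rightarrow> (plane \<Rightarrow> complex) list \<Rightarrow> bool" where
  "is_web p us \<longleftrightarrow> length us \<ge> 3 \<and> (\<forall>u\<in>set us. holo2_at u p) \<and>
     (\<forall>j<length us. \<forall>k<length us. j \<noteq> k \<longrightarrow> wedge (us ! j) (us ! k) p \<noteq> 0)"

text \<open>A local diffeomorphism \<open>\<Phi>\<close> sends \<open>\<F>(v \<circ> \<Phi>)\<close> at \<open>p\<close> onto \<open>\<F>(v)\<close> at \<open>\<Phi> p\<close>.\<close>

definition web_equivalent ::
  "plane \<Rightarrow> (plane \<Rightarrow> complex) list \<Rightarrow> plane \<Rightarrow> (plane \<Rightarrow> complex) list \<Rightarrow> bool" where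
  "web_equivalent p us q vs \<longleftrightarrow>
     (\<exists>\<Phi>. local_diffeo \<Phi> p q \<and>
        (\<lambda>u. foliation p u) ` set us = (\<lambda>v. foliation p (v \<circ> \<Phi>)) ` set vs)"

definition abelian_relation ::
  "plane \<Rightarrow> (plane \<Rightarrow> complex) list \<Rightarrow> (nat \<Rightarrow> complex \<Rightarrow> complex) \<Rightarrow> bool" where
  "abelian_relation p us \<phi> \<longleftrightarrow>
     (\<forall>j<length us. \<phi> j analytic_on {(us ! j) p}) \<and>
     (\<forall>\<^sub>F q in nhds p.
        (\<Sum>j<length us. \<phi> j ((us ! j) q) * pdx (us ! j) q) = 0 \<and>
        (\<Sum>j<length us. \<phi> j ((us ! j) q) * pdy (us ! j) q) = 0)"

text \<open>
  The germ of \<open>\<phi> j\<close> at \<open>(us ! j) p\<close> is represented by its Taylor series there, so that functions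
  with the same germ are identified; components beyond the length of the web are set to zero.
\<close>

definition germ_tuple ::
  "plane \<Rightarrow> (plane \<Rightarrow> complex) list \<Rightarrow> (nat \<Rightarrow> complex \<Rightarrow> complex) \<Rightarrow> nat \<Rightarrow> complex fps" where
  "germ_tuple p us \<phi> = (\<lambda>j. if j < length us then fps_expansion (\<phi> j) ((us ! j) p) else 0)"

definition scale_tuple :: "complex \<Rightarrow> (nat \<Rightarrow> complex fps) \<Rightarrow> nat \<Rightarrow> complex fps" where
  "scale_tuple c \<Theta> = (\<lambda>j. fps_const c * \<Theta> j)"

lemma vector_space_scale_tuple: "vector_space scale_tuple"
  by unfold_locales
     (auto simp: scale_tuple_def fun_eq_iff algebra_simps simp flip: fps_const_add fps_const_mult)

definition web_rank :: "plane \<Rightarrow> (plane \<Rightarrow> complex) list \<Rightarrow> nat" where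
  "web_rank p us =
     vector_space.dim scale_tuple (germ_tuple p us ` {\<phi>. abelian_relation p us \<phi>})"

definition maximal_rank :: "plane \<Rightarrow> (plane \<Rightarrow> complex) list \<Rightarrow> bool" where
  "maximal_rank p us \<longleftrightarrow> web_rank p us = (length us - 1) * (length us - 2) div 2"

type_synonym coords = "complex \<times> complex \<times> complex"

text \<open>
  Points of the projective plane and of its dual are both given by homogeneous coordinates; a
  point is the set of its nonzero coordinate vectors.  The line \<open>incident P\<close> is \<open>l(P)\<close> if \<open>P\<close> is a
  point of the dual plane, and the pencil of lines through \<open>P\<close> if \<open>P\<close> is a point of the plane.
\<close>

definition proj :: "coords \<Rightarrow> coords set" where
  "proj v = (case v of (a, b, c) \<Rightarrow> {(t * a, t * b, t * c) | t. t \<noteq> 0})"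

definition pairing :: "coords \<Rightarrow> coords \<Rightarrow> complex" where
  "pairing v w = (case (v, w) of ((a, b, c), (x, y, z)) \<Rightarrow> a * x + b * y + c * z)"

definition incident :: "coords set \<Rightarrow> coords set set" where
  "incident P = {proj v | v. v \<noteq> 0 \<and> (\<forall>w\<in>P. pairing v w = 0)}"

text \<open>
  A ternary form is a nested polynomial: \<open>coeff (coeff (coeff F k) j) i\<close> is the coefficient of
  \<open>X\<^sup>i Y\<^sup>j Z\<^sup>k\<close>.  A reduced curve of degree \<open>d\<close> is the zero locus of a squarefree form of degree \<open>d\<close>
  (in particular \<open>F \<noteq> 0\<close>, as \<open>0\<close> is not squarefree).
\<close>

definition eval3 :: "complex poly poly poly \<Rightarrow> coords \<Rightarrow> complex" where
  "eval3 F v = (case v of (a, b, c) \<Rightarrow> poly (poly (poly F [:[:c:]:]) [:b:]) a)"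

definition reduced_form :: "nat \<Rightarrow> complex poly poly poly \<Rightarrow> bool" where
  "reduced_form d F \<longleftrightarrow> squarefree F \<and>
     (\<forall>i j k. coeff (coeff (coeff F k) j) i \<noteq> 0 \<longrightarrow> i + j + k = d)"

definition curve :: "complex poly poly poly \<Rightarrow> coords set set" where
  "curve F = {proj v | v. v \<noteq> 0 \<and> eval3 F v = 0}"

text \<open>The standard affine charts, covering the projective plane.\<close>

definition charts :: "(plane \<Rightarrow> coords) set" where
  "charts = {\<lambda>(x, y). (1, x, y), \<lambda>(x, y). (x, 1, y), \<lambda>(x, y). (x, y, 1)}"

text \<open>
  Read in a chart \<open>e\<close>, the points of the intersection of the curve with the pencil through \<open>z\<close> are
  \<open>P 0 z, \<dots>, P (d - 1) z\<close>, pairwise distinct, and the leaf through \<open>z\<close> of the \<open>j\<close>-th foliation is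
  a piece of the line \<open>l(P j z)\<close>.
\<close>

definition algebraic_web :: "plane \<Rightarrow> (plane \<Rightarrow> complex) list \<Rightarrow> bool" where
  "algebraic_web p us \<longleftrightarrow> is_web p us \<and>
     (\<exists>F e U P. reduced_form (length us) F \<and> e \<in> charts \<and> open U \<and> p \<in> U \<and>
        (\<forall>z\<in>U.
           bij_betw (\<lambda>j. P j z) {..<length us} (curve F \<inter> incident (proj (e z))) \<and>
           (\<forall>j<length us. \<forall>w\<in>U.
              (us ! j) w = (us ! j) z \<longleftrightarrow> proj (e w) \<in> incident (P j z))))"

definition algebraizable :: "plane \<Rightarrow> (plane \<Rightarrow> complex) list \<Rightarrow> bool" where
  "algebraizable p us \<longleftrightarrow> (\<exists>q vs. algebraic_web q vs \<and> web_equivalent p us q vs)"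

definition exceptional :: "plane \<Rightarrow> (plane \<Rightarrow> complex) list \<Rightarrow> bool" where
  "exceptional p us \<longleftrightarrow> is_web p us \<and> maximal_rank p us \<and> \<not> algebraizable p us"

definition web5 :: "(plane \<Rightarrow> complex) \<Rightarrow> (plane \<Rightarrow> complex) list" where
  "web5 u = [\<lambda>(x, y). x, \<lambda>(x, y). y, \<lambda>(x, y). x + y, \<lambda>(x, y). x - y, u]"

definition cond_T :: "(plane \<Rightarrow> complex) \<Rightarrow> plane \<Rightarrow> bool" where
  "cond_T u p \<longleftrightarrow> pdx u p * pdy u p * ((pdx u p)\<^sup>2 - (pdy u p)\<^sup>2) \<noteq> 0"

end

theory Submission
  imports Defs
begin

text \<open>
  The 4-web of \<open>x, y, x + y, x - y\<close> is rigid in two ways.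

  First, if a map \<open>\<Phi>\<close> sends the four pencils of parallels to families of straight lines, then
  \<open>\<Phi>\<^sub>v \<times> \<Phi>\<^sub>v\<^sub>v\<close>, a binary cubic in the direction \<open>v\<close>, vanishes in four directions and hence identically;
  so \<open>\<Phi>\<close> can straighten the leaves of \<open>u\<close> only if they are straight already.  This excludes
  algebraizability, of which only the straightness of the leaves is used.

  Secondly, an equivalence of \<open>\<T>[u]\<close> and \<open>\<T>[v]\<close> maps at least three of the four pencils to pencils of
  the same kind; so its differential is everywhere a multiple of a fixed matrix, and it is affine.
  All five foliations \<open>\<F>(u)\<close> are given by entire covector fields, so the affine map matches these
  globally, and they are told apart by their zeros: \<open>e\<^sup>x dx + e\<^sup>y dy\<close> has none, the quadratic ones
  have one, and the trigonometric and hyperbolic ones have infinitely many, those of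
  \<open>tanh x tanh y\<close> including zeros with linear part \<open>y dx - x dy\<close>.

  The rank is at most 6 because a relation is determined by six of its Taylor coefficients, and
  besides the three relations of the 4-web there are three more for each \<open>u\<close>.
\<close>

text \<open>The hypotheses on \<open>u\<close> hold only near the base point, and the base points of
  an equivalence are arbitrary. Hence each \<open>du\<close> is replaced by an entire covector field
  proportional to it: an identity proved for germs then spreads to the whole plane, where it can be
  tested at one convenient point. As \<open>holo2_on\<close> asks only for a complex derivative at
  each point, the holomorphy of partial derivatives, on which the second-order arguments rest, comes
  from Osgood's lemma. At most one pencil can be carried to the leaves of \<open>v\<close>, and a
  quadratic form vanishing in three directions is zero; this is why three pencils suffice for
  rigidity. Counting zeros does not separate \<open>x^2 - y^2\<close> from \<open>x^2 + y^2\<close>;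
  these differ in whether the null directions of the form are directions of the pencils. The bound 6
  is 3 + 2 + 1: the numbers of linear relations between the first, second and third powers of five
  pairwise independent binary linear forms. There are none between higher powers.\<close>

lemma holo2_on_open: "holo2_on f U \<Longrightarrow> open U"
  by (simp add: holo2_on_def)

section \<open>Partial derivatives of functions of two complex variables\<close>

lemma has_derivative_partials:
  assumes d: "(f has_derivative (\<lambda>h. a * fst h + b * snd h)) (at q)"
  shows "pdx f q = a" "pdy f q = b"
    "((\<lambda>t. f (t, snd q)) has_field_derivative a) (at (fst q))"
    "((\<lambda>t. f (fst q, t)) has_field_derivative b) (at (snd q))"
proof -
  have 1: "((\<lambda>t. (t, snd q)) has_derivative (\<lambda>h. (h, 0))) (at (fst q))"
    by (auto intro!: derivative_eq_intros)
  have d': "(f has_derivative (\<lambda>h. a * fst h + b * snd h)) (at (fst q, snd q))"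
    using d by simp
  have "((\<lambda>t. f (t, snd q)) has_derivative (\<lambda>h. a * fst (h, 0::complex) + b * snd (h, 0::complex))) (at (fst q))"
    by (rule has_derivative_compose[OF 1 d'])
  then show *: "((\<lambda>t. f (t, snd q)) has_field_derivative a) (at (fst q))"
    by (simp add: has_field_derivative_def)
  have 2: "((\<lambda>t. (fst q, t)) has_derivative (\<lambda>h. (0, h))) (at (snd q))"
    by (auto intro!: derivative_eq_intros)
  have "((\<lambda>t. f (fst q, t)) has_derivative (\<lambda>h. a * fst (0::complex, h) + b * snd (0::complex, h))) (at (snd q))"
    by (rule has_derivative_compose[OF 2 d'])
  then show **: "((\<lambda>t. f (fst q, t)) has_field_derivative b) (at (snd q))"
    by (simp add: has_field_derivative_def)
  show "pdx f q = a" "pdy f q = b"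
    using * ** by (auto simp: pdx_def pdy_def intro: DERIV_imp_deriv)
qed

lemma holo2_on_has_derivative:
  assumes "holo2_on f U" "q \<in> U"
  shows "(f has_derivative (\<lambda>h. pdx f q * fst h + pdy f q * snd h)) (at q)"
proof -
  obtain a b where "(f has_derivative (\<lambda>(h, k). a * h + b * k)) (at q)"
    using assms unfolding holo2_on_def by blast
  then have d: "(f has_derivative (\<lambda>h. a * fst h + b * snd h)) (at q)"
    by (simp add: case_prod_beta')
  with has_derivative_partials(1,2)[OF d] show ?thesis by simp
qed

lemma holo2_onI:
  assumes "open U" "\<And>q. q \<in> U \<Longrightarrow> (f has_derivative (\<lambda>h. a q * fst h + b q * snd h)) (at q)"
  shows "holo2_on f U"
  unfolding holo2_on_def case_prod_beta' using assms by blast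

lemma holo2_on_DERIV:
  assumes "holo2_on f U" "(x, y) \<in> U"
  shows "((\<lambda>t. f (t, y)) has_field_derivative pdx f (x, y)) (at x)"
    "((\<lambda>t. f (x, t)) has_field_derivative pdy f (x, y)) (at y)"
  using has_derivative_partials(3,4)[OF holo2_on_has_derivative[OF assms]] by simp_all

lemma holo2_on_continuous_on: "holo2_on f U \<Longrightarrow> continuous_on U f"
  by (meson continuous_at_imp_continuous_on has_derivative_continuous holo2_on_has_derivative)

lemma holo2_on_subset: "holo2_on f U \<Longrightarrow> open V \<Longrightarrow> V \<subseteq> U \<Longrightarrow> holo2_on f V"
  unfolding holo2_on_def by blast

lemma has_field_derivative_along_curve:
  assumes f: "holo2_on f U" "(X t, Y t) \<in> U"
    and X: "(X has_field_derivative X') (at t)" and Y: "(Y has_field_derivative Y') (at t)"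
  shows "((\<lambda>s. f (X s, Y s)) has_field_derivative
           pdx f (X t, Y t) * X' + pdy f (X t, Y t) * Y') (at t)"
proof -
  have "((\<lambda>s. (X s, Y s)) has_derivative (\<lambda>h. (X' * h, Y' * h))) (at t)"
    using X Y by (auto simp: has_field_derivative_def intro!: has_derivative_Pair)
  from has_derivative_compose[OF this holo2_on_has_derivative[OF f]]
  show ?thesis
    unfolding has_field_derivative_def
    by (rule has_derivative_eq_rhs) (auto simp: fun_eq_iff algebra_simps)
qed

lemma pdx_cong:
  assumes "open U" "z \<in> U" "\<And>z. z \<in> U \<Longrightarrow> f z = g z"
  shows "pdx f z = pdx g z" "pdy f z = pdy g z"
proof -
  obtain A B where AB: "open A" "open B" "z \<in> A \<times> B" "A \<times> B \<subseteq> U"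
    using assms(1,2) open_prod_elim by blast
  have "\<forall>\<^sub>F t in nhds (fst z). t \<in> A" "\<forall>\<^sub>F t in nhds (snd z). t \<in> B"
    using AB by (auto simp: eventually_nhds_in_open mem_Times_iff)
  then have "\<forall>\<^sub>F t in nhds (fst z). f (t, snd z) = g (t, snd z)"
    "\<forall>\<^sub>F t in nhds (snd z). f (fst z, t) = g (fst z, t)"
    using AB assms(3) by (auto elim!: eventually_mono simp: mem_Times_iff subset_iff)
  then show "pdx f z = pdx g z" "pdy f z = pdy g z"
    by (auto simp: pdx_def pdy_def intro: deriv_cong_ev)
qed

subsection \<open>Osgood's lemma\<close>

text \<open>The hypothesis of Osgood's lemma. It can be checked for \<open>pdx f\<close> one
  variable at a time, and below it turns out to be equivalent to \<open>holo2_on\<close>.\<close>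

definition sep_holo :: "(plane \<Rightarrow> complex) \<Rightarrow> plane set \<Rightarrow> bool" where
  "sep_holo f U \<longleftrightarrow> open U \<and> continuous_on U f \<and>
     (\<forall>x y. (x, y) \<in> U \<longrightarrow> (\<lambda>t. f (t, y)) field_differentiable (at x) \<and>
        (\<lambda>t. f (x, t)) field_differentiable (at y))"

lemma sep_holo_swap:
  assumes "sep_holo f U"
  shows "sep_holo (\<lambda>(x, y). f (y, x)) {(x, y). (y, x) \<in> U}"
proof -
  let ?V = "{(x, y). (y, x) \<in> U}"
  have V: "?V = (\<lambda>z. (snd z, fst z)) -` U" by auto
  have sw: "continuous_on T (\<lambda>z::plane. (snd z, fst z))" for T
    by (intro continuous_intros)
  have "open ?V"
    unfolding V using assms sw unfolding sep_holo_def by (blast intro: open_vimage)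
  moreover have "continuous_on ?V (\<lambda>z. f (snd z, fst z))"
    by (rule continuous_on_compose2[OF _ sw, of U]) (use assms in \<open>auto simp: sep_holo_def\<close>)
  ultimately show ?thesis
    using assms by (simp add: sep_holo_def case_prod_beta')
qed

lemma pdy_swap: "pdy f z = pdx (\<lambda>(x, y). f (y, x)) (snd z, fst z)"
  by (simp add: pdx_def pdy_def)

lemma sep_holo_box:
  assumes "open U" "(x0, y0) \<in> U"
  obtains r where "r > 0" "cball x0 r \<times> cball y0 r \<subseteq> U"
proof -
  obtain e where e: "e > 0" "cball (x0, y0) e \<subseteq> U"
    using assms open_contains_cball by blast
  have "cball x0 (e/2) \<times> cball y0 (e/2) \<subseteq> cball (x0, y0) e"
  proof clarify
    fix x y assume "x \<in> cball x0 (e/2)" "y \<in> cball y0 (e/2)"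
    then have "dist x0 x + dist y0 y \<le> e" by simp
    moreover have "dist (x0, y0) (x, y) \<le> dist x0 x + dist y0 y"
      unfolding dist_Pair_Pair by (rule sqrt_sum_squares_le_sum) auto
    ultimately show "(x, y) \<in> cball (x0, y0) e" by simp
  qed
  with e show ?thesis by (intro that[of "e/2"]) auto
qed

lemma sep_holo_holomorphic:
  assumes "sep_holo f U" "A \<times> {y} \<subseteq> U"
  shows "(\<lambda>t. f (t, y)) holomorphic_on A"
  using assms unfolding sep_holo_def holomorphic_on_def
  by (auto intro: field_differentiable_at_within)

text \<open>By Cauchy's inequality the derivative in \<open>x\<close> is bounded by the size of the
  function on a circle. Uniform continuity of \<open>f\<close> on a compact box makes
  \<open>f (t, y) - f (t, y0)\<close> small on the whole circle, hence also its derivative; along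
  \<open>y = y0\<close> the derivative is holomorphic.\<close>

lemma sep_holo_continuous_pdx:
  assumes f: "sep_holo f U"
  shows "continuous_on U (pdx f)"
proof (rule continuous_at_imp_continuous_on, clarify)
  fix x0 y0 assume U: "(x0, y0) \<in> U"
  have opU: "open U" using f by (simp add: sep_holo_def)
  obtain r where r: "r > 0" "cball x0 r \<times> cball y0 r \<subseteq> U"
    using sep_holo_box[OF opU U] by blast
  define K where "K = cball x0 r \<times> cball y0 r"
  have "compact K" unfolding K_def by (intro compact_Times) auto
  moreover have "continuous_on K f"
    using f r unfolding sep_holo_def K_def by (blast intro: continuous_on_subset)
  ultimately have uc: "uniformly_continuous_on K f"
    by (intro compact_uniformly_continuous)
  have hol: "(\<lambda>t. f (t, y)) holomorphic_on ball x0 r" if "y \<in> cball y0 r" for y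
    by (rule sep_holo_holomorphic[OF f]) (use r that in auto)
  have "isCont (\<lambda>x. deriv (\<lambda>t. f (t, y0)) x) x0"
    using holomorphic_deriv[OF hol[of y0]] r
    by (auto intro!: holomorphic_on_imp_continuous_on continuous_on_interior[of "ball x0 r"])
  then have c1: "isCont (\<lambda>x. pdx f (x, y0)) x0" by (simp add: pdx_def)
  show "isCont (pdx f) (x0, y0)"
    unfolding continuous_at_eps_delta
  proof (intro allI impI)
    fix e :: real assume e: "e > 0"
    obtain d1 where d1: "d1 > 0" "\<And>x. dist x x0 < d1 \<Longrightarrow> dist (pdx f (x, y0)) (pdx f (x0, y0)) < e / 2"
      using c1 e unfolding continuous_at_eps_delta by (meson half_gt_zero)
    \<comment> \<open>The bound \<open>e * r / 8\<close> suits a circle of radius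
      \<open>r/2\<close>: Cauchy's inequality turns it into \<open>e / 4\<close>, which leaves room
      for the \<open>e / 2\<close> from \<open>d1\<close>.\<close>
    obtain d2 where d2: "d2 > 0" "\<And>z w. z \<in> K \<Longrightarrow> w \<in> K \<Longrightarrow> dist w z < d2 \<Longrightarrow> dist (f w) (f z) < e * r / 8"
      using uc e r unfolding uniformly_continuous_on_def
      by (metis divide_pos_pos mult_pos_pos zero_less_numeral)
    define d where "d = min (min d1 d2) (r/2)"
    have d: "d > 0" using d1 d2 r by (simp add: d_def)
    have "dist (pdx f z) (pdx f (x0, y0)) < e" if z: "dist z (x0, y0) < d" for z
    proof -
      obtain x y where xy: "z = (x, y)" by force
      have dx: "dist x x0 < d" "dist y y0 < d"
        using z dist_fst_le[of z "(x0,y0)"] dist_snd_le[of z "(x0,y0)"] xy by auto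
      have sub: "cball x (r/2) \<subseteq> cball x0 r"
      proof
        fix w assume "w \<in> cball x (r/2)"
        moreover have "dist x0 w \<le> dist x x0 + dist x w" by (metis dist_commute dist_triangle)
        ultimately show "w \<in> cball x0 r" using dx unfolding d_def by simp
      qed
      have yK: "y \<in> cball y0 r" "y0 \<in> cball y0 r"
        using dx r by (auto simp: d_def dist_commute)
      have holx: "(\<lambda>t. f (t, y')) holomorphic_on cball x (r/2)" if "y' \<in> cball y0 r" for y'
        by (rule sep_holo_holomorphic[OF f]) (use r that sub in auto)
      let ?g = "\<lambda>t. f (t, y) - f (t, y0)"
      have "norm ((deriv ^^ 1) ?g x) \<le> fact 1 * (e * r / 8) / (r/2) ^ 1"
      proof (rule Cauchy_inequality)
        have "?g holomorphic_on cball x (r/2)"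
          by (intro holomorphic_intros holx yK)
        then show "?g holomorphic_on ball x (r/2)" "continuous_on (cball x (r/2)) ?g"
          by (auto intro: holomorphic_on_imp_continuous_on holomorphic_on_subset)
        fix w assume "norm (x - w) = r / 2"
        then have "w \<in> cball x0 r" using sub by (auto simp: dist_norm)
        then have "dist (f (w, y)) (f (w, y0)) < e * r / 8"
          using yK dx by (intro d2) (auto simp: K_def dist_Pair_Pair d_def)
        then show "norm (?g w) \<le> e * r / 8" by (simp add: dist_norm)
      qed (use r in auto)
      moreover have "deriv ?g x = pdx f (x, y) - pdx f (x, y0)"
        unfolding pdx_def using holx[OF yK(1)] holx[OF yK(2)] r
        by (simp add: deriv_diff holomorphic_on_imp_differentiable_at[of _ "ball x (r/2)"]
              holomorphic_on_subset[OF _ ball_subset_cball])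
      ultimately have "dist (pdx f (x, y)) (pdx f (x, y0)) \<le> e / 4"
        using r by (simp add: dist_norm)
      moreover have "dist (pdx f (x, y0)) (pdx f (x0, y0)) < e / 2"
        using dx by (intro d1) (simp add: d_def)
      ultimately show ?thesis
        unfolding xy using dist_triangle[of "pdx f (x, y)" "pdx f (x0, y0)" "pdx f (x, y0)"] e by linarith
    qed
    with d show "\<exists>d>0. \<forall>z. dist z (x0, y0) < d \<longrightarrow> dist (pdx f z) (pdx f (x0, y0)) < e"
      by blast
  qed
qed

lemma sep_holo_continuous_pdy:
  assumes f: "sep_holo f U"
  shows "continuous_on U (pdy f)"
proof -
  have "continuous_on U (\<lambda>z. pdx (\<lambda>(x, y). f (y, x)) (snd z, fst z))"
    by (rule continuous_on_compose2[OF sep_holo_continuous_pdx[OF sep_holo_swap[OF f]]])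
       (auto intro!: continuous_intros)
  then show ?thesis by (simp add: pdy_swap[abs_def])
qed

text \<open>Existence of one partial derivative at the point and continuity of the other around it
  give total differentiability.\<close>

lemma sep_holo_imp_holo2_on:
  assumes f: "sep_holo f U"
  shows "holo2_on f U"
proof (rule holo2_onI)
  show opU: "open U" using f by (simp add: sep_holo_def)
  fix q assume q: "q \<in> U"
  obtain x0 y0 where q': "q = (x0, y0)" by force
  obtain r where r: "r > 0" "cball x0 r \<times> cball y0 r \<subseteq> U"
    using sep_holo_box[OF opU] q q' by blast
  have sub: "ball x0 r \<times> ball y0 r \<subseteq> U" using r(2) by auto
  have dx: "((\<lambda>t. f (t, y)) has_field_derivative pdx f (x, y)) (at x)"
   and dy: "((\<lambda>t. f (x, t)) has_field_derivative pdy f (x, y)) (at y)" if "(x, y) \<in> U" for x y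
    using f that unfolding sep_holo_def pdx_def pdy_def by (auto simp: DERIV_deriv_iff_field_differentiable)
  have "((\<lambda>(x, y). f (x, y)) has_derivative
      (\<lambda>(tx, ty). pdx f (x0, y0) * tx + blinfun_apply (blinfun_mult_right (pdy f (x0, y0))) ty))
      (at (x0, y0) within ball x0 r \<times> ball y0 r)"
  proof (rule has_derivative_partialsI)
    show "((\<lambda>x. f (x, y0)) has_derivative (*) (pdx f (x0, y0))) (at x0 within ball x0 r)"
      using dx[of x0 y0] q q' by (auto simp: has_field_derivative_def intro: has_derivative_at_withinI)
    show "((\<lambda>y. f (x, y)) has_derivative blinfun_apply (blinfun_mult_right (pdy f (x, y)))) (at y within ball y0 r)"
      if "x \<in> ball x0 r" "y \<in> ball y0 r" for x y
      using dy[of x y] subsetD[OF sub, of "(x, y)"] that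
      by (auto simp: has_field_derivative_def intro: has_derivative_at_withinI)
    have "isCont (pdy f) (x0, y0)"
      using sep_holo_continuous_pdy[OF f] opU q q' by (simp add: continuous_on_eq_continuous_at)
    then have "isCont (\<lambda>z. blinfun_mult_right (pdy f z)) (x0, y0)"
      by (rule isCont_o2[OF _ linear_continuous_at[OF bounded_linear_blinfun_mult_right]])
    then show "continuous (at (x0, y0) within ball x0 r \<times> ball y0 r)
        (\<lambda>(x, y). blinfun_mult_right (pdy f (x, y)))"
      by (simp add: case_prod_beta' continuous_at_imp_continuous_at_within)
  qed (use r in auto)
  moreover have "at (x0, y0) within ball x0 r \<times> ball y0 r = at (x0, y0)"
    using r by (intro at_within_open) (auto intro: open_Times)
  ultimately show "(f has_derivative (\<lambda>h. pdx f q * fst h + pdy f q * snd h)) (at q)"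
    by (simp add: q' case_prod_beta')
qed

lemma holo2_on_imp_sep_holo: "holo2_on f U \<Longrightarrow> sep_holo f U"
  unfolding sep_holo_def
  unfolding field_differentiable_def
  using holo2_on_DERIV[of f U] holo2_on_continuous_on[of f U] holo2_on_open[of f U]
  by blast

text \<open>Differentiability in \<open>x\<close> is one-variable theory. For the dependence on
  \<open>y\<close>, Cauchy's formula expresses \<open>pdx f (x0, y)\<close> as an integral of
  \<open>f\<close> over a fixed circle in the \<open>x\<close>-plane, and one differentiates under
  the integral sign.\<close>

lemma holo2_on_pdx:
  assumes f: "holo2_on f U"
  shows "holo2_on (pdx f) U"
proof (rule sep_holo_imp_holo2_on)
  have sf: "sep_holo f U" by (rule holo2_on_imp_sep_holo[OF f])
  have opU: "open U" using f by (rule holo2_on_open)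
  show "sep_holo (pdx f) U"
    unfolding sep_holo_def
  proof (intro conjI allI impI)
    show "open U" by fact
    show "continuous_on U (pdx f)" by (rule sep_holo_continuous_pdx[OF sf])
    fix x0 y0 assume U: "(x0, y0) \<in> U"
    obtain r where r: "r > 0" "cball x0 r \<times> cball y0 r \<subseteq> U"
      using sep_holo_box[OF opU U] by blast
    have hol: "(\<lambda>t. f (t, y)) holomorphic_on cball x0 r" if "y \<in> cball y0 r" for y
      by (rule sep_holo_holomorphic[OF sf]) (use r that in auto)
    have "deriv (\<lambda>t. f (t, y0)) holomorphic_on ball x0 r"
      using hol[of y0] r by (auto intro!: holomorphic_deriv holomorphic_on_subset[OF hol])
    then show "(\<lambda>t. pdx f (t, y0)) field_differentiable at x0"
      using r by (auto simp: pdx_def intro: holomorphic_on_imp_differentiable_at[of _ "ball x0 r"])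
    let ?c = "circlepath x0 r"
    \<comment> \<open>Kernel of Cauchy's formula for the first derivative, pulled back to the
      parameter interval of the circle; \<open>H\<close> is the resulting integral without the
      factor \<open>1 / (2 * pi * \<i>)\<close>.\<close>
    define k where "k t = vector_derivative ?c (at t) / (?c t - x0)\<^sup>2" for t
    define H where "H y = integral (cbox 0 1) (\<lambda>t. f (?c t, y) * k t)" for y
    have c: "?c t \<in> cball x0 r" "?c t \<noteq> x0" for t
      using r by (auto simp: circlepath dist_norm norm_mult)
    have kc: "continuous_on T k" for T
    proof -
      have "continuous_on T ?c" by (auto simp: circlepath intro!: continuous_intros)
      then show ?thesis
        unfolding k_def vector_derivative_circlepath using c(2)
        by (auto intro!: continuous_intros)
    qed
    have conty: "continuous_on (ball y0 r \<times> cbox 0 1) (\<lambda>(y, t). pdy f (?c t, y) * k t)"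
    proof -
      have "continuous_on (ball y0 r \<times> cbox 0 1) (\<lambda>z. pdy f (?c (snd z), fst z))"
        by (rule continuous_on_compose2[OF sep_holo_continuous_pdy[OF sf]])
           (use c r in \<open>auto simp: circlepath intro!: continuous_intros\<close>)
      moreover have "continuous_on (ball y0 r \<times> cbox 0 1) (\<lambda>z::complex \<times> real. k (snd z))"
        by (rule continuous_on_compose2[OF kc[of UNIV]]) (auto intro!: continuous_intros)
      ultimately show ?thesis
        by (auto simp: case_prod_beta' intro!: continuous_intros)
    qed
    have "H holomorphic_on ball y0 r"
      unfolding H_def
    proof (rule leibniz_rule_holomorphic[OF _ _ conty])
      fix y and t :: real assume y: "y \<in> ball y0 r"
      have "(?c t, y) \<in> U" using c r y by auto
      from holo2_on_DERIV(2)[OF f this]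
      show "((\<lambda>y. f (?c t, y) * k t) has_field_derivative pdy f (?c t, y) * k t) (at y within ball y0 r)"
        by (auto intro!: derivative_eq_intros intro: has_field_derivative_at_within)
    next
      fix y assume y: "y \<in> ball y0 r"
      have "continuous_on (cbox 0 1) (\<lambda>t. f (?c t, y))"
        by (rule continuous_on_compose2[OF holo2_on_continuous_on[OF f]])
           (use c r y in \<open>auto simp: circlepath intro!: continuous_intros\<close>)
      then have "continuous_on (cbox 0 1) (\<lambda>t. f (?c t, y) * k t)"
        by (intro continuous_intros kc)
      then show "(\<lambda>t. f (?c t, y) * k t) integrable_on cbox 0 1"
        by (rule integrable_continuous)
    qed auto
    moreover have "pdx f (x0, y) = H y / (2 * pi * \<i>)" if y: "y \<in> ball y0 r" for y
    proof -
      have "((\<lambda>u. f (u, y) / (u - x0) ^ Suc 1) has_contour_integral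
              (2 * pi) * \<i> / fact 1 * (deriv ^^ 1) (\<lambda>t. f (t, y)) x0) ?c"
        using hol[of y] y r
        by (intro Cauchy_has_contour_integral_higher_derivative_circlepath)
           (auto intro: holomorphic_on_imp_continuous_on holomorphic_on_subset)
      then have "contour_integral ?c (\<lambda>u. f (u, y) / (u - x0)\<^sup>2) = 2 * pi * \<i> * pdx f (x0, y)"
        by (simp add: contour_integral_unique pdx_def power2_eq_square)
      moreover have "contour_integral ?c (\<lambda>u. f (u, y) / (u - x0)\<^sup>2) = H y"
        unfolding H_def contour_integral_integral k_def by simp
      ultimately show ?thesis by (simp add: field_simps)
    qed
    moreover have "(\<lambda>y. H y / (2 * pi * \<i>)) holomorphic_on ball y0 r"
      using calculation(1) by (intro holomorphic_intros) auto
    ultimately have "(\<lambda>y. pdx f (x0, y)) holomorphic_on ball y0 r"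
      by (metis (no_types, lifting) holomorphic_transform)
    then show "(\<lambda>y. pdx f (x0, y)) field_differentiable at y0"
      using r by (auto intro: holomorphic_on_imp_differentiable_at[of _ "ball y0 r"])
  qed
qed

lemma holo2_on_pdy:
  assumes f: "holo2_on f U"
  shows "holo2_on (pdy f) U"
proof -
  define g where "g = (\<lambda>(x, y). f (y, x))"
  define V where "V = {(x, y). (y, x) \<in> U}"
  have "holo2_on g V"
    unfolding g_def V_def by (rule sep_holo_imp_holo2_on[OF sep_holo_swap[OF holo2_on_imp_sep_holo[OF f]]])
  then have "sep_holo (pdx g) V"
    by (rule holo2_on_imp_sep_holo[OF holo2_on_pdx])
  then have "sep_holo (\<lambda>(x, y). pdx g (y, x)) {(x, y). (y, x) \<in> V}"
    by (rule sep_holo_swap)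
  moreover have "(\<lambda>(x, y). pdx g (y, x)) = pdy f"
    by (rule ext) (auto simp: g_def pdx_def pdy_def split: prod.split)
  moreover have "{(x, y). (y, x) \<in> V} = U"
    by (auto simp: V_def)
  ultimately show ?thesis by (simp add: sep_holo_imp_holo2_on)
qed

section \<open>Closure rules, chain rules and the identity theorem\<close>

lemma holo2_on_const: "holo2_on (\<lambda>_. c) UNIV"
  by (rule holo2_onI[where a="\<lambda>_. 0" and b="\<lambda>_. 0"]) (auto intro!: derivative_eq_intros)

lemma holo2_on_fst: "holo2_on fst UNIV"
  by (rule holo2_onI[where a="\<lambda>_. 1" and b="\<lambda>_. 0"]) (auto intro!: derivative_eq_intros)

lemma holo2_on_snd: "holo2_on snd UNIV"
  by (rule holo2_onI[where a="\<lambda>_. 0" and b="\<lambda>_. 1"]) (auto intro!: derivative_eq_intros)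

lemma holo2_on_add: "holo2_on f U \<Longrightarrow> holo2_on g U \<Longrightarrow> holo2_on (\<lambda>z. f z + g z) U"
  by (rule holo2_onI[where a="\<lambda>z. pdx f z + pdx g z" and b="\<lambda>z. pdy f z + pdy g z"])
     (auto dest: holo2_on_open simp: distrib_right
        intro!: has_derivative_eq_rhs[OF has_derivative_add[OF holo2_on_has_derivative holo2_on_has_derivative]])

lemma holo2_on_mult: "holo2_on f U \<Longrightarrow> holo2_on g U \<Longrightarrow> holo2_on (\<lambda>z. f z * g z) U"
  by (rule holo2_onI[where a="\<lambda>z. f z * pdx g z + pdx f z * g z" and b="\<lambda>z. f z * pdy g z + pdy f z * g z"])
     (auto dest: holo2_on_open simp: algebra_simps
        intro!: has_derivative_eq_rhs[OF has_derivative_mult[OF holo2_on_has_derivative holo2_on_has_derivative]])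

lemma holo2_on_UNIV_const: "open U \<Longrightarrow> holo2_on (\<lambda>_. c) U"
  using holo2_on_subset[OF holo2_on_const] by blast

lemma holo2_on_uminus: "holo2_on f U \<Longrightarrow> holo2_on (\<lambda>z. - f z) U"
  using holo2_on_mult[OF holo2_on_UNIV_const[of U "-1"]] by (auto dest: holo2_on_open)

lemma holo2_on_diff: "holo2_on f U \<Longrightarrow> holo2_on g U \<Longrightarrow> holo2_on (\<lambda>z. f z - g z) U"
  using holo2_on_add[OF _ holo2_on_uminus, of f U g] by simp

lemma holo2_on_compose_has_derivative:
  assumes f: "holo2_on f V" and X: "holo2_on X U" and Y: "holo2_on Y U"
    and V: "\<And>z. z \<in> U \<Longrightarrow> (X z, Y z) \<in> V" and z: "z \<in> U"
  shows "((\<lambda>z. f (X z, Y z)) has_derivative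
     (\<lambda>h. (pdx f (X z, Y z) * pdx X z + pdy f (X z, Y z) * pdx Y z) * fst h +
          (pdx f (X z, Y z) * pdy X z + pdy f (X z, Y z) * pdy Y z) * snd h)) (at z)"
proof -
  have "((\<lambda>z. (X z, Y z)) has_derivative
      (\<lambda>h. (pdx X z * fst h + pdy X z * snd h, pdx Y z * fst h + pdy Y z * snd h))) (at z)"
    by (intro has_derivative_Pair holo2_on_has_derivative[OF X z] holo2_on_has_derivative[OF Y z])
  from has_derivative_compose[OF this holo2_on_has_derivative[OF f V[OF z]]]
  show ?thesis by (rule has_derivative_eq_rhs) (auto simp: fun_eq_iff algebra_simps)
qed

lemma holo2_on_compose:
  assumes "holo2_on f V" "holo2_on X U" "holo2_on Y U" "\<And>z. z \<in> U \<Longrightarrow> (X z, Y z) \<in> V"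
  shows "holo2_on (\<lambda>z. f (X z, Y z)) U"
  by (rule holo2_onI[OF holo2_on_open[OF assms(2)] holo2_on_compose_has_derivative[OF assms]])

lemma pd_compose:
  assumes "holo2_on f V" "holo2_on X U" "holo2_on Y U" "\<And>z. z \<in> U \<Longrightarrow> (X z, Y z) \<in> V" "z \<in> U"
  shows "pdx (\<lambda>z. f (X z, Y z)) z = pdx f (X z, Y z) * pdx X z + pdy f (X z, Y z) * pdx Y z"
    "pdy (\<lambda>z. f (X z, Y z)) z = pdx f (X z, Y z) * pdy X z + pdy f (X z, Y z) * pdy Y z"
  using has_derivative_partials(1,2)[OF holo2_on_compose_has_derivative[OF assms]] by simp_all

lemma holo2_on_compose1:
  assumes g: "g holomorphic_on S" "open S" and X: "holo2_on X U" and S: "\<And>z. z \<in> U \<Longrightarrow> X z \<in> S"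
  shows "holo2_on (\<lambda>z. g (X z)) U"
proof (rule holo2_onI)
  show "open U" using X by (rule holo2_on_open)
  fix z assume z: "z \<in> U"
  have "(g has_derivative (*) (deriv g (X z))) (at (X z))"
    using holomorphic_derivI[OF g S[OF z]] by (simp add: has_field_derivative_def)
  from has_derivative_compose[OF holo2_on_has_derivative[OF X z] this]
  show "((\<lambda>z. g (X z)) has_derivative
     (\<lambda>h. (deriv g (X z) * pdx X z) * fst h + (deriv g (X z) * pdy X z) * snd h)) (at z)"
    by (rule has_derivative_eq_rhs) (auto simp: fun_eq_iff algebra_simps)
qed

lemmas holo2_intros = holo2_on_const holo2_on_fst holo2_on_snd holo2_on_add holo2_on_mult
  holo2_on_uminus holo2_on_diff

text \<open>Restriction to the complex line through \<open>p\<close> and \<open>z\<close> reduces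
  this to the identity theorem in one variable. It is the passage from germs to the whole
  plane.\<close>

lemma holo2_on_UNIV_eq_0:
  assumes F: "holo2_on F UNIV" and ev: "\<forall>\<^sub>F z in nhds p. F z = 0"
  shows "F z = 0"
proof -
  let ?L = "\<lambda>t. (fst p + t * (fst z - fst p), snd p + t * (snd z - snd p))"
  have "(\<lambda>t. F (?L t)) field_differentiable at t" for t
    unfolding field_differentiable_def
    by (rule exI, rule has_field_derivative_along_curve[OF F]) (auto intro!: derivative_eq_intros)
  then have hol: "(\<lambda>t. F (?L t)) holomorphic_on UNIV"
    by (simp add: holomorphic_on_def)
  have "((\<lambda>t. ?L t) \<longlongrightarrow> ?L 0) (nhds 0)"
    by (intro tendsto_intros) (auto simp: filterlim_ident)
  then have "\<forall>\<^sub>F t in nhds 0. F (?L t) = 0"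
    using ev by (auto simp: filterlim_iff)
  then obtain S where S: "open S" "0 \<in> S" "\<And>t. t \<in> S \<Longrightarrow> F (?L t) = 0"
    unfolding eventually_nhds by blast
  have "F (?L 1) = 0"
    by (rule analytic_continuation_open[OF S(1) open_UNIV _ connected_UNIV _ hol, of "\<lambda>_. 0"])
       (use S in auto)
  then show ?thesis by simp
qed

text \<open>The implicit function theorem, obtained by inverting
  \<open>(x, y) \<mapsto> (x, u)\<close>. It supplies the curves along which first and second
  derivatives are taken later.\<close>

lemma leaf_curve:
  assumes u: "holo2_on u U" and p: "(x0, y0) \<in> U" and uy: "pdy u (x0, y0) \<noteq> 0"
  obtains Y r where "r > 0" "Y x0 = y0"
    "\<And>t. t \<in> ball x0 r \<Longrightarrow> (t, Y t) \<in> U" "\<And>t. t \<in> ball x0 r \<Longrightarrow> u (t, Y t) = u (x0, y0)"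
    "\<And>t. t \<in> ball x0 r \<Longrightarrow>
       (Y has_field_derivative - pdx u (t, Y t) / pdy u (t, Y t)) (at t)"
proof -
  define W where "W = {z \<in> U. pdy u z \<noteq> 0}"
  have opU: "open U" using u by (rule holo2_on_open)
  have "open (U \<inter> (pdy u -` (- {0})))"
    by (intro continuous_open_preimage holo2_on_continuous_on[OF holo2_on_pdy[OF u]] opU) auto
  also have "U \<inter> (pdy u -` (- {0})) = W" by (auto simp: W_def)
  finally have opW: "open W" .
  \<comment> \<open>In the coordinates \<open>(x, u)\<close> the leaves are horizontal lines;
    \<open>G\<close> below is the inverse of the derivative of \<open>F\<close> at the base
    point.\<close>
  define F where "F z = (fst z, u z)" for z
  define F' where "F' z = Blinfun (\<lambda>h::plane. (fst h, pdx u z * fst h + pdy u z * snd h))" for z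
  have bl: "bounded_linear (\<lambda>h::plane. (fst h, a * fst h + b * snd h))" for a b :: complex
    by (intro bounded_linear_intros)
  have F': "blinfun_apply (F' z) = (\<lambda>h. (fst h, pdx u z * fst h + pdy u z * snd h))" for z
    unfolding F'_def by (rule bounded_linear_Blinfun_apply[OF bl])
  define G where "G = Blinfun (\<lambda>h::plane. (fst h, (- pdx u (x0, y0) / pdy u (x0, y0)) * fst h + (1 / pdy u (x0, y0)) * snd h))"
  have G: "blinfun_apply G = (\<lambda>h. (fst h, (- pdx u (x0, y0) / pdy u (x0, y0)) * fst h + (1 / pdy u (x0, y0)) * snd h))"
    unfolding G_def by (rule bounded_linear_Blinfun_apply[OF bl])
  have 1: "(F has_derivative blinfun_apply (F' z)) (at z)" if "z \<in> W" for z
    unfolding F_def F' using that holo2_on_has_derivative[OF u, of z]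
    by (auto simp: W_def intro!: derivative_eq_intros)
  have 2: "continuous_on W F'"
  proof (rule continuous_on_blinfun_componentwise)
    fix i :: plane
    have "continuous_on W (pdx u)" "continuous_on W (pdy u)"
      using holo2_on_continuous_on[OF holo2_on_pdy[OF u]] holo2_on_continuous_on[OF holo2_on_pdx[OF u]]
      by (auto intro: continuous_on_subset simp: W_def)
    then show "continuous_on W (\<lambda>z. blinfun_apply (F' z) i)"
      unfolding F' by (intro continuous_intros)
  qed
  have 3: "(x0, y0) \<in> W" using p uy by (simp add: W_def)
  have 4: "G o\<^sub>L F' (x0, y0) = id_blinfun"
    by (rule blinfun_eqI) (use uy in \<open>auto simp: G F' field_simps\<close>)
  obtain U' V g g' where g: "open U'" "U' \<subseteq> W" "(x0, y0) \<in> U'" "open V" "F (x0, y0) \<in> V"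
      "homeomorphism U' V F g" "\<And>v. v \<in> V \<Longrightarrow> (g has_derivative g' v) (at v)"
    using inverse_function_theorem[OF opW 1 2 3 4] by metis
  have "continuous_on UNIV (\<lambda>t. (t, u (x0, y0)))"
    by (intro continuous_intros)
  from open_vimage[OF \<open>open V\<close> this] have "open {t. (t, u (x0, y0)) \<in> V}"
    by (simp add: vimage_def)
  moreover have "x0 \<in> {t. (t, u (x0, y0)) \<in> V}" using g by (simp add: F_def)
  ultimately obtain r where r: "r > 0" "ball x0 r \<subseteq> {t. (t, u (x0, y0)) \<in> V}"
    using open_contains_ball by blast
  define Y where "Y t = snd (g (t, u (x0, y0)))" for t
  have gv: "g v \<in> U'" "F (g v) = v" if "v \<in> V" for v
    using g(6) that by (auto simp: homeomorphism_def)
  have Y: "(t, Y t) \<in> W" "u (t, Y t) = u (x0, y0)" if "t \<in> ball x0 r" for t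
  proof -
    have "(t, u (x0, y0)) \<in> V" using r that by auto
    note * = gv[OF this]
    have "g (t, u (x0, y0)) = (t, Y t)"
      using *(2) by (simp add: F_def Y_def prod_eq_iff)
    with * show "(t, Y t) \<in> W" "u (t, Y t) = u (x0, y0)"
      using g(2) by (auto simp: F_def)
  qed
  show ?thesis
  proof (rule that[of r Y])
    have "g (F (x0, y0)) = (x0, y0)" using g by (auto simp: homeomorphism_def)
    then show "Y x0 = y0" by (simp add: Y_def F_def)
    fix t assume t: "t \<in> ball x0 r"
    show "(t, Y t) \<in> U" "u (t, Y t) = u (x0, y0)" using Y[OF t] by (auto simp: W_def)
    have uy: "pdy u (t, Y t) \<noteq> 0" using Y[OF t] by (simp add: W_def)
    have tV: "(t, u (x0, y0)) \<in> V" using r t by auto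
    \<comment> \<open>The inverse function theorem provides only some derivative of
      \<open>Y\<close>; differentiating \<open>u (t, Y t) = u (x0, y0)\<close> identifies
      it.\<close>
    define D where "D h = snd (g' (t, u (x0, y0)) (h, 0))" for h
    have dp: "((\<lambda>t. (t, u (x0, y0))) has_derivative (\<lambda>h. (h, 0))) (at t)"
      by (auto intro!: derivative_eq_intros)
    have Yd: "(Y has_derivative D) (at t)"
      unfolding Y_def D_def by (rule has_derivative_snd[OF has_derivative_compose[OF dp g(7)[OF tV]]])
    have pd: "((\<lambda>t. (t, Y t)) has_derivative (\<lambda>h. (h, D h))) (at t)"
      by (intro has_derivative_Pair Yd has_derivative_ident)
    have tU: "(t, Y t) \<in> U" by fact
    have "((\<lambda>t. u (t, Y t)) has_derivative (\<lambda>h. pdx u (t, Y t) * h + pdy u (t, Y t) * D h)) (at t)"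
      using has_derivative_compose[OF pd holo2_on_has_derivative[OF u tU]] by simp
    moreover have "((\<lambda>t. u (t, Y t)) has_derivative (\<lambda>h. 0)) (at t)"
      by (rule has_derivative_transform_within_open[of "\<lambda>_. u (x0, y0)" _ _ _ "ball x0 r"])
         (use t Y in auto)
    ultimately have "pdx u (t, Y t) * h + pdy u (t, Y t) * D h = 0" for h
      using has_derivative_unique by metis
    then have "D = (*) (- pdx u (t, Y t) / pdy u (t, Y t))"
      using uy by (auto simp: fun_eq_iff field_simps add_eq_0_iff)
    with Yd show "(Y has_field_derivative - pdx u (t, Y t) / pdy u (t, Y t)) (at t)"
      by (simp add: has_field_derivative_def)
  qed (use r in auto)
qed

subsection \<open>Local diffeomorphisms and matching leaves\<close>

text \<open>A relation between level sets alone. An equivalence of webs is exploited in this form,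
  and differentiation along leaves then recovers the proportionality of the differentials.\<close>

definition same_leaves :: "plane \<Rightarrow> (plane \<Rightarrow> complex) \<Rightarrow> (plane \<Rightarrow> complex) \<Rightarrow> bool" where
  "same_leaves p u v \<longleftrightarrow> (\<exists>N. open N \<and> p \<in> N \<and> (\<forall>a\<in>N. \<forall>b\<in>N. u a = u b \<longleftrightarrow> v a = v b))"

lemma foliation_self: "submersion_at u p \<Longrightarrow> u \<in> foliation p u"
  unfolding foliation_def by (auto intro: exI[of _ UNIV])

lemma foliation_eq_imp_same_leaves:
  assumes "submersion_at u p" "foliation p u = foliation p v"
  shows "same_leaves p u v"
proof -
  have "u \<in> foliation p v" using foliation_self[OF assms(1)] assms(2) by simp
  then show ?thesis unfolding foliation_def same_leaves_def by blast
qed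

lemma web_equivalent_same_leaves:
  assumes eq: "web_equivalent p us q vs" and sub: "\<And>u. u \<in> set us \<Longrightarrow> submersion_at u p"
  obtains \<Phi> where "local_diffeo \<Phi> p q"
    "\<And>u. u \<in> set us \<Longrightarrow> \<exists>v\<in>set vs. same_leaves p u (v \<circ> \<Phi>)"
    "\<And>v. v \<in> set vs \<Longrightarrow> \<exists>u\<in>set us. same_leaves p u (v \<circ> \<Phi>)"
proof -
  obtain \<Phi> where \<Phi>: "local_diffeo \<Phi> p q"
    "(\<lambda>u. foliation p u) ` set us = (\<lambda>v. foliation p (v \<circ> \<Phi>)) ` set vs"
    using eq unfolding web_equivalent_def by blast
  show ?thesis
  proof (rule that[OF \<Phi>(1)])
    fix u assume u: "u \<in> set us"
    then have "foliation p u \<in> (\<lambda>v. foliation p (v \<circ> \<Phi>)) ` set vs" using \<Phi>(2) by blast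
    then show "\<exists>v\<in>set vs. same_leaves p u (v \<circ> \<Phi>)"
      using foliation_eq_imp_same_leaves[OF sub[OF u]] by blast
  next
    fix v assume v: "v \<in> set vs"
    then have "foliation p (v \<circ> \<Phi>) \<in> (\<lambda>u. foliation p u) ` set us" using \<Phi>(2) by blast
    then obtain u where "u \<in> set us" "foliation p u = foliation p (v \<circ> \<Phi>)"
      by (metis (no_types) imageE)
    then show "\<exists>u\<in>set us. same_leaves p u (v \<circ> \<Phi>)"
      using foliation_eq_imp_same_leaves[OF sub] by blast
  qed
qed

text \<open>The chain rule for the composition of \<Phi> with its inverse gives the nonvanishing
  Jacobian. The last two facts move properties valid near \<open>q\<close> to properties valid near
  \<open>p\<close> and back.\<close>

lemma local_diffeoE:
  assumes "local_diffeo \<Phi> p q"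
  obtains f g U where "holo2_on f U" "holo2_on g U" "p \<in> U"
    "\<And>z. \<Phi> z = (f z, g z)" "\<And>z. z \<in> U \<Longrightarrow> pdx f z * pdy g z - pdy f z * pdx g z \<noteq> 0"
    "\<And>P. \<forall>\<^sub>F z in nhds p. P (\<Phi> z) \<Longrightarrow> \<forall>\<^sub>F w in nhds q. P w"
    "\<And>P. \<forall>\<^sub>F w in nhds q. P w \<Longrightarrow> \<forall>\<^sub>F z in nhds p. P (\<Phi> z)"
proof -
  obtain U V \<Psi> where pq: "\<Phi> p = q" "p \<in> U" "q \<in> V" and hom: "homeomorphism U V \<Phi> \<Psi>"
    and h: "holo2_on (fst \<circ> \<Phi>) U" "holo2_on (snd \<circ> \<Phi>) U" "holo2_on (fst \<circ> \<Psi>) V" "holo2_on (snd \<circ> \<Psi>) V"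
    using assms unfolding local_diffeo_def by blast
  define f g where "f = fst \<circ> \<Phi>" and "g = snd \<circ> \<Phi>"
  have \<Phi>: "\<Phi> z = (f z, g z)" for z by (simp add: f_def g_def)
  have opU: "open U" and opV: "open V" using h holo2_on_open by blast+
  have fg: "holo2_on f U" "holo2_on g U" using h by (simp_all add: f_def g_def)
  have VV: "(f z, g z) \<in> V" if "z \<in> U" for z
    using hom that unfolding \<Phi>[symmetric] by (auto simp: homeomorphism_def)
  have inv: "\<Psi> (\<Phi> z) = z" if "z \<in> U" for z using hom that by (auto simp: homeomorphism_def)
  have det: "pdx f z * pdy g z - pdy f z * pdx g z \<noteq> 0" if z: "z \<in> U" for z
  proof -
    have 1: "(fst \<circ> \<Psi>) (f z, g z) = fst z" "(snd \<circ> \<Psi>) (f z, g z) = snd z" if "z \<in> U" for z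
      using inv[OF that] by (simp_all add: \<Phi>)
    note pc = pd_compose[OF h(3) fg VV z] pd_compose[OF h(4) fg VV z]
    note cg = pdx_cong[OF opU z 1(1)] pdx_cong[OF opU z 1(2)]
    have "pdx fst z = 1" "pdy fst z = 0" "pdx snd z = 0" "pdy snd z = 1"
      by (auto simp: pdx_def pdy_def)
    with pc cg have
      "pdx (fst \<circ> \<Psi>) (f z, g z) * pdx f z + pdy (fst \<circ> \<Psi>) (f z, g z) * pdx g z = 1"
      "pdx (fst \<circ> \<Psi>) (f z, g z) * pdy f z + pdy (fst \<circ> \<Psi>) (f z, g z) * pdy g z = 0"
      "pdx (snd \<circ> \<Psi>) (f z, g z) * pdx f z + pdy (snd \<circ> \<Psi>) (f z, g z) * pdx g z = 0"
      "pdx (snd \<circ> \<Psi>) (f z, g z) * pdy f z + pdy (snd \<circ> \<Psi>) (f z, g z) * pdy g z = 1"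
      by simp_all
    \<comment> \<open>Multiplicativity of 2 by 2 determinants: the two Jacobians have product
      1.\<close>
    moreover have "(a * A + b * B = 1 \<Longrightarrow> a * C + b * D = 0 \<Longrightarrow> c * A + d * B = 0 \<Longrightarrow> c * C + d * D = 1 \<Longrightarrow>
       (a * d - b * c) * (A * D - C * B) = (1::complex))" for a b c d A B C D
      by algebra
    ultimately show ?thesis by force
  qed
  show ?thesis
  proof (rule that[OF fg pq(2) \<Phi> det])
    fix P assume "\<forall>\<^sub>F z in nhds p. P (\<Phi> z)"
    then obtain S where S: "open S" "p \<in> S" "\<And>z. z \<in> S \<Longrightarrow> P (\<Phi> z)"
      unfolding eventually_nhds by blast
    have "continuous_on V \<Psi>" using hom by (simp add: homeomorphism_def)
    then have "open (V \<inter> \<Psi> -` S)" by (rule continuous_open_preimage[OF _ opV S(1)])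
    moreover have "q \<in> V \<inter> \<Psi> -` S" using pq inv[OF pq(2)] S by auto
    moreover have "P w" if "w \<in> V \<inter> \<Psi> -` S" for w
      using S(3)[of "\<Psi> w"] that hom by (auto simp: homeomorphism_def)
    ultimately show "\<forall>\<^sub>F w in nhds q. P w" unfolding eventually_nhds by blast
  next
    fix P assume "\<forall>\<^sub>F w in nhds q. P w"
    then obtain S where S: "open S" "q \<in> S" "\<And>z. z \<in> S \<Longrightarrow> P z"
      unfolding eventually_nhds by blast
    have "continuous_on U \<Phi>" using hom by (simp add: homeomorphism_def)
    then have "open (U \<inter> \<Phi> -` S)" by (rule continuous_open_preimage[OF _ opU S(1)])
    moreover have "p \<in> U \<inter> \<Phi> -` S" using pq S by auto
    ultimately show "\<forall>\<^sub>F z in nhds p. P (\<Phi> z)" 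
      unfolding eventually_nhds using S(3) by (intro exI[of _ "U \<inter> \<Phi> -` S"]) auto
  qed
qed

subsection \<open>Second derivatives along curves\<close>

text \<open>The second differential of \<open>f\<close> at \<open>z\<close>, evaluated on the vector
  \<open>(a, b)\<close>.\<close>

definition hess :: "(plane \<Rightarrow> complex) \<Rightarrow> plane \<Rightarrow> complex \<Rightarrow> complex \<Rightarrow> complex" where
  "hess f z a b = pdx (pdx f) z * a\<^sup>2 + (pdy (pdx f) z + pdx (pdy f) z) * (a * b) + pdy (pdy f) z * b\<^sup>2"

lemma second_derivative_along_curve:
  assumes f: "holo2_on f U" "(X t, Y t) \<in> U"
    and X: "(X has_field_derivative X' t) (at t)" "(X' has_field_derivative X'') (at t)"
    and Y: "(Y has_field_derivative Y' t) (at t)" "(Y' has_field_derivative Y'') (at t)"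
  shows "((\<lambda>s. pdx f (X s, Y s) * X' s + pdy f (X s, Y s) * Y' s) has_field_derivative
     (hess f (X t, Y t) (X' t) (Y' t) + pdx f (X t, Y t) * X'' + pdy f (X t, Y t) * Y'')) (at t)"
  by (rule derivative_eq_intros refl X(2) Y(2)
        has_field_derivative_along_curve[OF holo2_on_pdx[OF f(1)] f(2) X(1) Y(1)]
        has_field_derivative_along_curve[OF holo2_on_pdy[OF f(1)] f(2) X(1) Y(1)])+
     (simp add: hess_def algebra_simps power2_eq_square)

text \<open>Differentiating the equation of the line once and twice shows that
  \<open>(F', G')\<close> and \<open>(F'', G'')\<close> are annihilated by the same nonzero covector
  \<open>(\<alpha>, \<beta>)\<close>, hence parallel.\<close>

lemma collinear_imp_wronskian_zero:
  fixes F G F' G' :: "complex \<Rightarrow> complex"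
  assumes r: "r > 0" and ab: "\<alpha> \<noteq> 0 \<or> \<beta> \<noteq> 0"
    and z: "\<And>t. t \<in> ball t0 r \<Longrightarrow> \<alpha> * F t + \<beta> * G t + \<gamma> = 0"
    and d1: "\<And>t. t \<in> ball t0 r \<Longrightarrow> (F has_field_derivative F' t) (at t)"
       "\<And>t. t \<in> ball t0 r \<Longrightarrow> (G has_field_derivative G' t) (at t)"
    and d2: "(F' has_field_derivative F'') (at t0)" "(G' has_field_derivative G'') (at t0)"
  shows "F' t0 * G'' = G' t0 * F''"
proof -
  have 1: "\<alpha> * F' t + \<beta> * G' t = 0" if t: "t \<in> ball t0 r" for t
  proof (rule DERIV_unique)
    show "((\<lambda>t. \<alpha> * F t + \<beta> * G t + \<gamma>) has_field_derivative \<alpha> * F' t + \<beta> * G' t) (at t)"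
      by (auto intro!: derivative_eq_intros d1 t)
    show "((\<lambda>t. \<alpha> * F t + \<beta> * G t + \<gamma>) has_field_derivative 0) (at t)"
      by (rule has_field_derivative_transform_within_open[of "\<lambda>_. 0" _ _ "ball t0 r"]) (use t z in auto)
  qed
  have 2: "\<alpha> * F'' + \<beta> * G'' = 0"
  proof (rule DERIV_unique)
    show "((\<lambda>t. \<alpha> * F' t + \<beta> * G' t) has_field_derivative \<alpha> * F'' + \<beta> * G'') (at t0)"
      by (auto intro!: derivative_eq_intros d2)
    show "((\<lambda>t. \<alpha> * F' t + \<beta> * G' t) has_field_derivative 0) (at t0)"
      by (rule has_field_derivative_transform_within_open[of "\<lambda>_. 0" _ _ "ball t0 r"]) (use r 1 in auto)
  qed
  have "\<alpha> * (F' t0 * G'' - G' t0 * F'') = 0" "\<beta> * (F' t0 * G'' - G' t0 * F'') = 0"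
    using 1[of t0] 2 r by (auto, algebra+)
  with ab show ?thesis by auto
qed

text \<open>For \<open>f = fst\<close> and \<open>g = snd\<close> this is straightness of the leaves
  of \<open>u\<close>. The general form is that property of the image web, pulled back by
  \<open>(f, g)\<close>, so that everything is computed in the source coordinates.\<close>

definition lines_on :: "(plane \<Rightarrow> complex) \<Rightarrow> (plane \<Rightarrow> complex) \<Rightarrow> (plane \<Rightarrow> complex) \<Rightarrow> plane set \<Rightarrow> bool" where
  "lines_on f g u N \<longleftrightarrow> (\<forall>a\<in>N. \<exists>\<alpha> \<beta> \<gamma>. (\<alpha> \<noteq> 0 \<or> \<beta> \<noteq> 0) \<and>
     (\<forall>b\<in>N. u b = u a \<longrightarrow> \<alpha> * f b + \<beta> * g b + \<gamma> = 0))"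

lemma lines_on_curve:
  assumes l: "lines_on f g u N" and f: "holo2_on f N" and g: "holo2_on g N" and r: "r > 0"
    and c: "\<And>t. t \<in> ball t0 r \<Longrightarrow> (X t, Y t) \<in> N" "\<And>t. t \<in> ball t0 r \<Longrightarrow> u (X t, Y t) = u (X t0, Y t0)"
    and X: "\<And>t. t \<in> ball t0 r \<Longrightarrow> (X has_field_derivative X' t) (at t)" "(X' has_field_derivative X'') (at t0)"
    and Y: "\<And>t. t \<in> ball t0 r \<Longrightarrow> (Y has_field_derivative Y' t) (at t)" "(Y' has_field_derivative Y'') (at t0)"
    and z: "z = (X t0, Y t0)" and ab: "a = X' t0" "b = Y' t0"
  shows "(pdx f z * a + pdy f z * b) * (hess g z a b + pdx g z * X'' + pdy g z * Y'') =
         (pdx g z * a + pdy g z * b) * (hess f z a b + pdx f z * X'' + pdy f z * Y'')"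
proof -
  have t0: "t0 \<in> ball t0 r" using r by simp
  obtain \<alpha> \<beta> \<gamma> where abc: "\<alpha> \<noteq> 0 \<or> \<beta> \<noteq> 0" "\<And>b. b \<in> N \<Longrightarrow> u b = u z \<Longrightarrow> \<alpha> * f b + \<beta> * g b + \<gamma> = 0"
    using l c(1)[OF t0] unfolding lines_on_def z by metis
  show ?thesis
    unfolding z ab
  proof (rule collinear_imp_wronskian_zero[OF r abc(1), of t0 "\<lambda>t. f (X t, Y t)" "\<lambda>t. g (X t, Y t)" \<gamma>
        "\<lambda>t. pdx f (X t, Y t) * X' t + pdy f (X t, Y t) * Y' t"
        "\<lambda>t. pdx g (X t, Y t) * X' t + pdy g (X t, Y t) * Y' t"])
    fix t assume t: "t \<in> ball t0 r"
    show "\<alpha> * f (X t, Y t) + \<beta> * g (X t, Y t) + \<gamma> = 0"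
      using abc(2)[of "(X t, Y t)"] c[OF t] by (simp add: z)
    show "((\<lambda>s. f (X s, Y s)) has_field_derivative pdx f (X t, Y t) * X' t + pdy f (X t, Y t) * Y' t) (at t)"
      "((\<lambda>s. g (X s, Y s)) has_field_derivative pdx g (X t, Y t) * X' t + pdy g (X t, Y t) * Y' t) (at t)"
      using has_field_derivative_along_curve[OF f c(1)[OF t] X(1)[OF t] Y(1)[OF t]]
        has_field_derivative_along_curve[OF g c(1)[OF t] X(1)[OF t] Y(1)[OF t]] .
  qed (rule second_derivative_along_curve[OF f c(1)[OF t0] X(1)[OF t0] X(2) Y(1)[OF t0] Y(2)]
        second_derivative_along_curve[OF g c(1)[OF t0] X(1)[OF t0] X(2) Y(1)[OF t0] Y(2)])+
qed

text \<open>A leaf that is a straight line, traversed at constant speed, has no acceleration, so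
  only the second differential remains. Each of the four linear foliations thus yields one zero of a
  binary cubic.\<close>

lemma lines_on_direction:
  assumes l: "lines_on f g u N" and f: "holo2_on f N" and g: "holo2_on g N" and z: "z \<in> N"
    and u: "\<And>t. u (fst z + t * a, snd z + t * b) = u z"
  shows "(pdx f z * a + pdy f z * b) * hess g z a b = (pdx g z * a + pdy g z * b) * hess f z a b"
proof -
  have c: "continuous_on UNIV (\<lambda>t. (fst z + t * a, snd z + t * b))"
    by (intro continuous_intros)
  have "open ((\<lambda>t. (fst z + t * a, snd z + t * b)) -` N)"
    by (rule open_vimage[OF holo2_on_open[OF f] c])
  moreover have "0 \<in> (\<lambda>t. (fst z + t * a, snd z + t * b)) -` N" using z by simp
  ultimately obtain r where r: "r > 0" "ball 0 r \<subseteq> (\<lambda>t. (fst z + t * a, snd z + t * b)) -` N"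
    using open_contains_ball by blast
  have "(pdx f z * a + pdy f z * b) * (hess g z a b + pdx g z * 0 + pdy g z * 0) =
         (pdx g z * a + pdy g z * b) * (hess f z a b + pdx f z * 0 + pdy f z * 0)"
  proof (rule lines_on_curve[OF l f g r(1), of 0 "\<lambda>t. fst z + t * a" "\<lambda>t. snd z + t * b" "\<lambda>_. a" 0 "\<lambda>_. b" 0])
    show "(fst z + t * a, snd z + t * b) \<in> N" if "t \<in> ball 0 r" for t using r that by auto
  qed (auto simp: u intro!: derivative_eq_intros)
  then show ?thesis by simp
qed

text \<open>The hypotheses are the values at \<open>(1, 0)\<close>, \<open>(0, 1)\<close>,
  \<open>(1, 1)\<close> and \<open>(1, - 1)\<close>; a nonzero binary cubic vanishes in at most
  three directions.\<close>

lemma cubic_eq_zero: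
  fixes c0 c1 c2 c3 :: complex
  assumes "c0 = 0" "c3 = 0" "c0 + c1 + c2 + c3 = 0" "c0 - c1 + c2 - c3 = 0"
  shows "c0 * a^3 + c1 * (a\<^sup>2 * b) + c2 * (a * b\<^sup>2) + c3 * b^3 = 0"
proof -
  have "2 * c2 = (c0 + c1 + c2 + c3) + (c0 - c1 + c2 - c3) - 2 * c0" by simp
  then have "c2 = 0" using assms by simp
  then show ?thesis using assms by simp
qed

text \<open>Parametrise the leaf of \<open>u\<close> by \<open>x\<close>, with slope
  \<open>s\<close>. Collinearity of its image makes the sum of the cubic at \<open>(1, s)\<close>
  and the Jacobian times \<open>s'\<close> vanish. The cubic is zero, so \<open>s' = 0\<close>; the
  conclusion is this equation for \<open>s = - w1 / w2\<close>, cleared of denominators.\<close>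

lemma lines_on_leaf_curvature:
  assumes lin: "lines_on f g (\<lambda>(x, y). x) N" "lines_on f g (\<lambda>(x, y). y) N"
      "lines_on f g (\<lambda>(x, y). x + y) N" "lines_on f g (\<lambda>(x, y). x - y) N" "lines_on f g u N"
    and f: "holo2_on f N" and g: "holo2_on g N" and u: "holo2_on u N"
    and w: "holo2_on w1 N" "holo2_on w2 N"
    and uw: "\<And>z. z \<in> N \<Longrightarrow> pdx u z * w2 z = pdy u z * w1 z" "\<And>z. z \<in> N \<Longrightarrow> pdy u z \<noteq> 0"
       "\<And>z. z \<in> N \<Longrightarrow> w2 z \<noteq> 0"
    and det: "pdx f z * pdy g z - pdy f z * pdx g z \<noteq> 0" and z: "z \<in> N"
  shows "(w1 z * pdy w1 z - w2 z * pdx w1 z) * w2 z + (w2 z * pdx w2 z - w1 z * pdy w2 z) * w1 z = 0"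
proof -
  have cubic: "(pdx f z * a + pdy f z * b) * hess g z a b = (pdx g z * a + pdy g z * b) * hess f z a b" for a b
  proof -
    note d = lines_on_direction[OF lin(1) f g z, of 0 1] lines_on_direction[OF lin(2) f g z, of 1 0]
      lines_on_direction[OF lin(3) f g z, of 1 "-1"] lines_on_direction[OF lin(4) f g z, of 1 1]
    \<comment> \<open>\<open>c0\<close>, ..., \<open>c3\<close> are the coefficients of the cubic
      which expresses that the first and second differentials of \<open>(f, g)\<close> in direction
      \<open>(a, b)\<close> are parallel.\<close>
    define c0 where "c0 = pdx f z * pdx (pdx g) z - pdx g z * pdx (pdx f) z"
    define c3 where "c3 = pdy f z * pdy (pdy g) z - pdy g z * pdy (pdy f) z"
    define c1 where "c1 = pdx f z * (pdy (pdx g) z + pdx (pdy g) z) + pdy f z * pdx (pdx g) z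
        - (pdx g z * (pdy (pdx f) z + pdx (pdy f) z) + pdy g z * pdx (pdx f) z)"
    define c2 where "c2 = pdy f z * (pdy (pdx g) z + pdx (pdy g) z) + pdx f z * pdy (pdy g) z
        - (pdy g z * (pdy (pdx f) z + pdx (pdy f) z) + pdx g z * pdy (pdy f) z)"
    have eq: "(pdx f z * a + pdy f z * b) * hess g z a b - (pdx g z * a + pdy g z * b) * hess f z a b
      = c0 * a^3 + c1 * (a\<^sup>2 * b) + c2 * (a * b\<^sup>2) + c3 * b^3" for a b
      unfolding hess_def c0_def c1_def c2_def c3_def by algebra
    have "c0 * a^3 + c1 * (a\<^sup>2 * b) + c2 * (a * b\<^sup>2) + c3 * b^3 = 0"
      using eq[of 0 1] eq[of 1 0] eq[of 1 "-1"] eq[of 1 1] d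
      by (intro cubic_eq_zero) (simp_all add: case_prod_beta)
    with eq[of a b] show ?thesis by simp
  qed
  obtain x0 y0 where z0: "z = (x0, y0)" by force
  obtain Y r where r: "r > 0" and Y: "Y x0 = y0"
    "\<And>t. t \<in> ball x0 r \<Longrightarrow> (t, Y t) \<in> N" "\<And>t. t \<in> ball x0 r \<Longrightarrow> u (t, Y t) = u (x0, y0)"
    and Yd: "\<And>t. t \<in> ball x0 r \<Longrightarrow>
       (Y has_field_derivative - pdx u (t, Y t) / pdy u (t, Y t)) (at t)"
    using leaf_curve[OF u] z uw(2)[OF z] unfolding z0 by metis
  define s where "s t = - w1 (t, Y t) / w2 (t, Y t)" for t
  have s: "- pdx u (t, Y t) / pdy u (t, Y t) = s t" if "t \<in> ball x0 r" for t
    using uw[OF Y(2)[OF that]] by (simp add: s_def field_simps)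
  have x0: "x0 \<in> ball x0 r" using r by simp
  have Y1: "(Y has_field_derivative s t) (at t)" if "t \<in> ball x0 r" for t
    using Yd[OF that] s[OF that] by simp
  define s' where "s' = (- (pdx w1 z * 1 + pdy w1 z * s x0) * w2 z - (- w1 z) * (pdx w2 z * 1 + pdy w2 z * s x0)) / (w2 z * w2 z)"
  have w1': "((\<lambda>t. w1 (t, Y t)) has_field_derivative pdx w1 z * 1 + pdy w1 z * s x0) (at x0)"
    using has_field_derivative_along_curve[OF w(1) Y(2)[OF x0] DERIV_ident Y1[OF x0]] by (simp add: z0 Y)
  have w2': "((\<lambda>t. w2 (t, Y t)) has_field_derivative pdx w2 z * 1 + pdy w2 z * s x0) (at x0)"
    using has_field_derivative_along_curve[OF w(2) Y(2)[OF x0] DERIV_ident Y1[OF x0]] by (simp add: z0 Y)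
  have "((\<lambda>t. - w1 (t, Y t) / w2 (t, Y t)) has_field_derivative s') (at x0)"
    unfolding s'_def using DERIV_divide[OF DERIV_minus[OF w1'] w2'] uw(3)[OF z] by (simp add: z0 Y)
  then have s': "(s has_field_derivative s') (at x0)"
    by (simp add: s_def[abs_def])
  have "(pdx f z * 1 + pdy f z * s x0) * (hess g z 1 (s x0) + pdx g z * 0 + pdy g z * s') =
         (pdx g z * 1 + pdy g z * s x0) * (hess f z 1 (s x0) + pdx f z * 0 + pdy f z * s')"
    by (rule lines_on_curve[OF lin(5) f g r, of x0 "\<lambda>t. t" Y "\<lambda>_. 1" 0 s])
       (auto simp: z0 Y intro!: derivative_eq_intros Y1 s')
  \<comment> \<open>Subtracting the cubic cancels all second derivatives of \<open>f\<close> and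
    \<open>g\<close>.\<close>
  with cubic[of 1 "s x0"] have "(pdx f z * pdy g z - pdy f z * pdx g z) * s' = 0"
    by algebra
  with det have "s' = 0" by simp
  then have "- (pdx w1 z + pdy w1 z * s x0) * w2 z + w1 z * (pdx w2 z + pdy w2 z * s x0) = 0"
    using uw(3)[OF z] by (simp add: s'_def)
  moreover have "s x0 * w2 z = - w1 z" using uw(3)[OF z] by (simp add: s_def z0 Y)
  ultimately show ?thesis by algebra
qed

subsection \<open>Algebraic webs have straight leaves\<close>

text \<open>Incidence is tested on all representatives of one point and on some representative of
  the other; homogeneity carries it to the given coordinate vectors.\<close>

lemma proj_incident_pairing:
  assumes "proj w \<in> incident (proj v)"
  shows "pairing w v = 0"
proof -
  obtain x where x: "proj w = proj x" "\<forall>y\<in>proj v. pairing x y = 0"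
    using assms unfolding incident_def by blast
  have self: "y \<in> proj y" for y
    by (cases y) (auto simp: proj_def intro!: exI[of _ 1])
  have "x \<in> proj w" using self x(1) by simp
  moreover have "pairing x v = 0" using x(2) self by blast
  ultimately show ?thesis
    by (cases w; cases v) (auto simp: proj_def pairing_def mult.assoc simp flip: distrib_left)
qed

text \<open>The homogeneous coordinates of \<open>P j z\<close> are the coefficients of the line,
  read in the chart \<open>e\<close>. The two nonconstant ones cannot both vanish: the line passes
  through \<open>z\<close>, so the constant coefficient would vanish too.\<close>

lemma algebraic_web_lines_on:
  assumes alg: "algebraic_web q vs" and w: "w \<in> set vs"
  shows "\<exists>V. open V \<and> q \<in> V \<and> lines_on fst snd w V"
proof -
  obtain F e U P where e: "e \<in> charts" and U: "open U" "q \<in> U"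
    and b: "\<And>z. z \<in> U \<Longrightarrow> bij_betw (\<lambda>j. P j z) {..<length vs} (curve F \<inter> incident (proj (e z)))"
    and l: "\<And>z j w. z \<in> U \<Longrightarrow> j < length vs \<Longrightarrow> w \<in> U \<Longrightarrow>
        (vs ! j) w = (vs ! j) z \<longleftrightarrow> proj (e w) \<in> incident (P j z)"
    using alg unfolding algebraic_web_def by blast
  obtain j where j: "j < length vs" "w = vs ! j" using w by (metis in_set_conv_nth)
  have "\<exists>\<alpha> \<beta> \<gamma>. (\<alpha> \<noteq> 0 \<or> \<beta> \<noteq> 0) \<and> (\<forall>b\<in>U. w b = w z \<longrightarrow> \<alpha> * fst b + \<beta> * snd b + \<gamma> = 0)"
    if z: "z \<in> U" for z
  proof -
    have "P j z \<in> curve F" using b[OF z] j by (auto simp: bij_betw_def)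
    then obtain v where v: "P j z = proj v" "v \<noteq> 0" unfolding curve_def by blast
    obtain v1 v2 v3 where v': "v = (v1, v2, v3)" by (cases v)
    have eq: "pairing (e b) v = 0" if "b \<in> U" "w b = w z" for b
      using l[OF z j(1) that(1)] that(2) j v(1) by (auto intro: proj_incident_pairing)
    obtain z1 z2 where z': "z = (z1, z2)" by force
    from e consider "e = (\<lambda>(x, y). (1, x, y))" | "e = (\<lambda>(x, y). (x, 1, y))" | "e = (\<lambda>(x, y). (x, y, 1))"
      unfolding charts_def by blast
    then show ?thesis
    proof cases
      case 1
      then show ?thesis
        using eq eq[OF z refl] v(2) v'
        by (intro exI[of _ v2] exI[of _ v3] exI[of _ v1]) (auto simp: pairing_def z' zero_prod_def algebra_simps)
    next
      case 2
      then show ?thesis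
        using eq eq[OF z refl] v(2) v'
        by (intro exI[of _ v1] exI[of _ v3] exI[of _ v2]) (auto simp: pairing_def z' zero_prod_def algebra_simps)
    next
      case 3
      then show ?thesis
        using eq eq[OF z refl] v(2) v'
        by (intro exI[of _ v1] exI[of _ v2] exI[of _ v3]) (auto simp: pairing_def z' zero_prod_def algebra_simps)
    qed
  qed
  with U show ?thesis unfolding lines_on_def by blast
qed

subsection \<open>Foliations given by entire covector fields\<close>

text \<open>The factor \<open>h\<close> absorbs the poles and common factors of \<open>du\<close>,
  so that a field defined on the whole plane represents a foliation known only near the points where
  (T) holds.\<close>

definition slope_form :: "(plane \<Rightarrow> complex) \<Rightarrow> (plane \<Rightarrow> complex) \<Rightarrow> (plane \<Rightarrow> complex) \<Rightarrow> bool" where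
  "slope_form u w1 w2 \<longleftrightarrow> holo2_on w1 UNIV \<and> holo2_on w2 UNIV \<and>
     (\<forall>p. holo2_at u p \<and> cond_T u p \<longrightarrow>
        (\<forall>\<^sub>F z in nhds p. \<exists>h. h \<noteq> 0 \<and> pdx u z = h * w1 z \<and> pdy u z = h * w2 z))"

lemma pd_linear [simp]:
  "pdx (\<lambda>(x, y). x) z = 1" "pdy (\<lambda>(x, y). x) z = 0"
  "pdx (\<lambda>(x, y). y) z = 0" "pdy (\<lambda>(x, y). y) z = 1"
  "pdx (\<lambda>(x, y). x + y) z = 1" "pdy (\<lambda>(x, y). x + y) z = 1"
  "pdx (\<lambda>(x, y). x - y) z = 1" "pdy (\<lambda>(x, y). x - y) z = - 1"
  by (auto simp: pdx_def pdy_def deriv_add deriv_diff)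

lemma holo2_on_linear:
  "holo2_on (\<lambda>(x, y). x) UNIV" "holo2_on (\<lambda>(x, y). y) UNIV"
  "holo2_on (\<lambda>(x, y). x + y) UNIV" "holo2_on (\<lambda>(x, y). x - y) UNIV"
  using holo2_on_fst holo2_on_snd holo2_on_add[OF holo2_on_fst holo2_on_snd]
    holo2_on_diff[OF holo2_on_fst holo2_on_snd]
  by (simp_all add: case_prod_beta')

lemma set_web5: "set (web5 u) = {\<lambda>(x, y). x, \<lambda>(x, y). y, \<lambda>(x, y). x + y, \<lambda>(x, y). x - y, u}"
  by (simp add: web5_def)

lemma cond_T_D:
  assumes "cond_T u p"
  shows "pdx u p \<noteq> 0" "pdy u p \<noteq> 0" "(pdx u p)\<^sup>2 - (pdy u p)\<^sup>2 \<noteq> 0"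
  using assms by (auto simp: cond_T_def)

lemma submersion_at_web5:
  assumes "holo2_at u p" "cond_T u p" "u' \<in> set (web5 u)"
  shows "submersion_at u' p"
proof -
  have "holo2_at u' p" using assms(1,3) holo2_on_linear unfolding set_web5 holo2_at_def by blast
  moreover have "pdx u' p \<noteq> 0 \<or> pdy u' p \<noteq> 0"
    using assms(3) cond_T_D(1)[OF assms(2)] unfolding set_web5 by auto
  ultimately show ?thesis by (simp add: submersion_at_def)
qed

lemma eventually_slope:
  assumes "slope_form u w1 w2" "holo2_at u p" "cond_T u p"
  obtains N where "open N" "p \<in> N" "holo2_on u N"
    "\<And>z. z \<in> N \<Longrightarrow> pdy u z \<noteq> 0" "\<And>z. z \<in> N \<Longrightarrow> w2 z \<noteq> 0"
    "\<And>z. z \<in> N \<Longrightarrow> pdx u z * w2 z = pdy u z * w1 z"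
    "\<And>z. z \<in> N \<Longrightarrow> \<exists>h. h \<noteq> 0 \<and> pdx u z = h * w1 z \<and> pdy u z = h * w2 z"
proof -
  obtain S where S: "open S" "p \<in> S"
    "\<And>z. z \<in> S \<Longrightarrow> \<exists>h. h \<noteq> 0 \<and> pdx u z = h * w1 z \<and> pdy u z = h * w2 z"
    using assms unfolding slope_form_def eventually_nhds by metis
  obtain U where U: "p \<in> U" "holo2_on u U" using assms(2) unfolding holo2_at_def by blast
  have opU: "open U" using U(2) by (rule holo2_on_open)
  let ?N = "S \<inter> (U \<inter> pdy u -` (- {0}))"
  show ?thesis
  proof (rule that[of ?N])
    have "open (U \<inter> pdy u -` (- {0}))"
      by (intro continuous_open_preimage holo2_on_continuous_on[OF holo2_on_pdy[OF U(2)]] opU) auto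
    then show op: "open ?N" using S(1) by blast
    show "p \<in> ?N" using S(2) U cond_T_D[OF assms(3)] by simp
    show "holo2_on u ?N" by (rule holo2_on_subset[OF U(2) op]) auto
    fix z assume z: "z \<in> ?N"
    then obtain h where h: "h \<noteq> 0" "pdx u z = h * w1 z" "pdy u z = h * w2 z" using S(3) by blast
    then show "pdx u z * w2 z = pdy u z * w1 z" "\<exists>h. h \<noteq> 0 \<and> pdx u z = h * w1 z \<and> pdy u z = h * w2 z"
      by auto
    show "pdy u z \<noteq> 0" "w2 z \<noteq> 0" using z h by auto
  qed
qed

lemma lines_on_subset: "lines_on f g u N \<Longrightarrow> M \<subseteq> N \<Longrightarrow> lines_on f g u M"
  unfolding lines_on_def
proof
  fix a assume *: "\<forall>a\<in>N. \<exists>\<alpha> \<beta> \<gamma>. (\<alpha> \<noteq> 0 \<or> \<beta> \<noteq> 0) \<and> (\<forall>b\<in>N. u b = u a \<longrightarrow> \<alpha> * f b + \<beta> * g b + \<gamma> = 0)"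
    "M \<subseteq> N" "a \<in> M"
  then obtain \<alpha> \<beta> \<gamma> where "\<alpha> \<noteq> 0 \<or> \<beta> \<noteq> 0" "\<And>b. b \<in> N \<Longrightarrow> u b = u a \<Longrightarrow> \<alpha> * f b + \<beta> * g b + \<gamma> = 0"
    by (metis subsetD)
  with *(2) show "\<exists>\<alpha> \<beta> \<gamma>. (\<alpha> \<noteq> 0 \<or> \<beta> \<noteq> 0) \<and> (\<forall>b\<in>M. u b = u a \<longrightarrow> \<alpha> * f b + \<beta> * g b + \<gamma> = 0)"
    by (intro exI[of _ \<alpha>] exI[of _ \<beta>] exI[of _ \<gamma>]) auto
qed

lemma lines_on_pullback:
  assumes sl: "same_leaves p u (w \<circ> \<Phi>)" and \<Phi>: "\<And>z. \<Phi> z = (f z, g z)"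
    and V: "open V" "q \<in> V" "lines_on fst snd w V"
    and ev: "\<And>P. \<forall>\<^sub>F w in nhds q. P w \<Longrightarrow> \<forall>\<^sub>F z in nhds p. P (\<Phi> z)"
  shows "\<exists>N. open N \<and> p \<in> N \<and> lines_on f g u N"
proof -
  obtain M where M: "open M" "p \<in> M" "\<And>a b. a \<in> M \<Longrightarrow> b \<in> M \<Longrightarrow> u a = u b \<longleftrightarrow> w (\<Phi> a) = w (\<Phi> b)"
    using sl unfolding same_leaves_def by auto
  have "\<forall>\<^sub>F w in nhds q. w \<in> V" using V by (simp add: eventually_nhds_in_open)
  from ev[OF this] obtain L where L: "open L" "p \<in> L" "\<And>z. z \<in> L \<Longrightarrow> \<Phi> z \<in> V"
    unfolding eventually_nhds by blast
  have "lines_on f g u (M \<inter> L)"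
    unfolding lines_on_def
  proof
    fix a assume a: "a \<in> M \<inter> L"
    then obtain \<alpha> \<beta> \<gamma> where *: "\<alpha> \<noteq> 0 \<or> \<beta> \<noteq> 0"
      "\<And>b. b \<in> V \<Longrightarrow> w b = w (\<Phi> a) \<Longrightarrow> \<alpha> * fst b + \<beta> * snd b + \<gamma> = 0"
      using V(3) L(3) unfolding lines_on_def by (meson IntE)
    have "\<alpha> * f b + \<beta> * g b + \<gamma> = 0" if "b \<in> M \<inter> L" "u b = u a" for b
      using *(2)[of "\<Phi> b"] L(3)[of b] M(3)[of b a] that a by (simp add: \<Phi>)
    with *(1) show "\<exists>\<alpha> \<beta> \<gamma>. (\<alpha> \<noteq> 0 \<or> \<beta> \<noteq> 0) \<and> (\<forall>b\<in>M \<inter> L. u b = u a \<longrightarrow> \<alpha> * f b + \<beta> * g b + \<gamma> = 0)"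
      by blast
  qed
  with M L show ?thesis by (intro exI[of _ "M \<inter> L"]) auto
qed

text \<open>The derivative of the slope \<open>- w1 / w2\<close> along a leaf parametrised by
  \<open>x\<close>, multiplied by \<open>w2 ^ 3\<close>. In this polynomial form it is entire
  together with \<open>w1\<close> and \<open>w2\<close>.\<close>

definition leaf_curvature :: "(plane \<Rightarrow> complex) \<Rightarrow> (plane \<Rightarrow> complex) \<Rightarrow> plane \<Rightarrow> complex" where
  "leaf_curvature w1 w2 z =
     (w1 z * pdy w1 z - w2 z * pdx w1 z) * w2 z + (w2 z * pdx w2 z - w1 z * pdy w2 z) * w1 z"

text \<open>The point \<open>z0\<close> is unrelated to \<open>p\<close>: straight leaves near
  \<open>p\<close> make the entire function \<open>leaf_curvature w1 w2\<close> vanish near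
  \<open>p\<close>, hence everywhere.\<close>

theorem not_algebraizable_web5:
  assumes sf: "slope_form u w1 w2" and u: "holo2_at u p" and T: "cond_T u p"
    and curv: "leaf_curvature w1 w2 z0 \<noteq> 0"
  shows "\<not> algebraizable p (web5 u)"
proof
  assume "algebraizable p (web5 u)"
  then obtain q vs where alg: "algebraic_web q vs" and eq: "web_equivalent p (web5 u) q vs"
    unfolding algebraizable_def by blast
  obtain \<Phi> where \<Phi>: "local_diffeo \<Phi> p q"
    and m: "\<And>u'. u' \<in> set (web5 u) \<Longrightarrow> \<exists>v\<in>set vs. same_leaves p u' (v \<circ> \<Phi>)"
    using web_equivalent_same_leaves[OF eq submersion_at_web5[OF u T]] by metis
  obtain f g U where fg: "holo2_on f U" "holo2_on g U" "p \<in> U" and fgP: "\<And>z. \<Phi> z = (f z, g z)"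
    and det: "\<And>z. z \<in> U \<Longrightarrow> pdx f z * pdy g z - pdy f z * pdx g z \<noteq> 0"
    and ev: "\<And>P. \<forall>\<^sub>F w in nhds q. P w \<Longrightarrow> \<forall>\<^sub>F z in nhds p. P (\<Phi> z)"
    using local_diffeoE[OF \<Phi>] by metis
  obtain N0 where N0: "open N0" "p \<in> N0" "holo2_on u N0"
    "\<And>z. z \<in> N0 \<Longrightarrow> pdy u z \<noteq> 0" "\<And>z. z \<in> N0 \<Longrightarrow> w2 z \<noteq> 0"
    "\<And>z. z \<in> N0 \<Longrightarrow> pdx u z * w2 z = pdy u z * w1 z"
    using eventually_slope[OF sf u T] by metis
  have ex: "\<exists>N. open N \<and> p \<in> N \<and> lines_on f g u' N" if u': "u' \<in> set (web5 u)" for u'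
  proof -
    obtain w where w: "w \<in> set vs" "same_leaves p u' (w \<circ> \<Phi>)" using m[OF u'] by blast
    obtain V where "open V" "q \<in> V" "lines_on fst snd w V"
      using algebraic_web_lines_on[OF alg w(1)] by blast
    from lines_on_pullback[OF w(2) fgP this ev] show ?thesis .
  qed
  obtain N1 N2 N3 N4 N5 where N:
    "open N1" "p \<in> N1" "lines_on f g (\<lambda>(x, y). x) N1" "open N2" "p \<in> N2" "lines_on f g (\<lambda>(x, y). y) N2"
    "open N3" "p \<in> N3" "lines_on f g (\<lambda>(x, y). x + y) N3" "open N4" "p \<in> N4" "lines_on f g (\<lambda>(x, y). x - y) N4"
    "open N5" "p \<in> N5" "lines_on f g u N5"
    using ex[of "\<lambda>(x, y). x"] ex[of "\<lambda>(x, y). y"] ex[of "\<lambda>(x, y). x + y"] ex[of "\<lambda>(x, y). x - y"] ex[of u]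
    unfolding set_web5 by auto
  define N where "N = N0 \<inter> U \<inter> (N1 \<inter> N2 \<inter> N3 \<inter> N4 \<inter> N5)"
  have opN: "open N" unfolding N_def using N N0 holo2_on_open[OF fg(1)] by blast
  have "leaf_curvature w1 w2 z = 0" if "z \<in> N" for z
    unfolding leaf_curvature_def
  proof (rule lines_on_leaf_curvature[of f g N u])
    show "holo2_on f N" "holo2_on g N" "holo2_on u N" "holo2_on w1 N" "holo2_on w2 N"
      using holo2_on_subset[OF _ opN] fg N0(3) sf unfolding N_def slope_form_def by blast+
  qed (use that N N0 det in \<open>auto simp: N_def intro: lines_on_subset\<close>)
  moreover have "p \<in> N" using N N0 fg by (simp add: N_def)
  ultimately have "\<forall>\<^sub>F z in nhds p. leaf_curvature w1 w2 z = 0"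
    using opN unfolding eventually_nhds by blast
  moreover have "holo2_on (leaf_curvature w1 w2) UNIV"
    unfolding leaf_curvature_def[abs_def] using sf unfolding slope_form_def
    by (intro holo2_intros holo2_on_pdx holo2_on_pdy) auto
  ultimately have "leaf_curvature w1 w2 z0 = 0" by (rule holo2_on_UNIV_eq_0[rotated])
  with curv show False by simp
qed

subsection \<open>Rigidity of equivalences\<close>

text \<open>Tangent vectors of the leaves of \<open>x\<close>, \<open>y\<close>,
  \<open>x + y\<close>, \<open>x - y\<close>, in this order; they are not the covectors of these
  functions.\<close>

definition dirs :: "plane set" where
  "dirs = {(0, 1), (1, 0), (1, - 1), (1, 1)}"

text \<open>The pullback of \<open>w1' dx + w2' dy\<close> by the affine map with linear part \<open>(A, B; C, D)\<close> is
  proportional to \<open>w1 dx + w2 dy\<close>.\<close>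

definition affine_match ::
  "(plane \<Rightarrow> complex) \<Rightarrow> (plane \<Rightarrow> complex) \<Rightarrow> (plane \<Rightarrow> complex) \<Rightarrow> (plane \<Rightarrow> complex) \<Rightarrow>
    complex \<Rightarrow> complex \<Rightarrow> complex \<Rightarrow> complex \<Rightarrow> complex \<Rightarrow> complex \<Rightarrow> bool" where
  "affine_match w1 w2 w1' w2' A B C D c d \<longleftrightarrow> (\<forall>x y.
     let q = (A * x + B * y + c, C * x + D * y + d)
     in w1 (x, y) * (B * w1' q + D * w2' q) = w2 (x, y) * (A * w1' q + C * w2' q))"

text \<open>What an equivalence of webs amounts to once it is known to be affine. An equality of
  cross terms expresses that two vectors are parallel, so the last two conditions say that the
  linear part permutes the four directions; stated both ways, they pass to the inverse map.\<close>

definition affine_equiv ::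
  "(plane \<Rightarrow> complex) \<Rightarrow> (plane \<Rightarrow> complex) \<Rightarrow> (plane \<Rightarrow> complex) \<Rightarrow> (plane \<Rightarrow> complex) \<Rightarrow> bool" where
  "affine_equiv w1 w2 w1' w2' \<longleftrightarrow> (\<exists>A B C D c d. A * D - B * C \<noteq> 0 \<and>
     affine_match w1 w2 w1' w2' A B C D c d \<and>
     (\<forall>(a, b)\<in>dirs. \<exists>(a', b')\<in>dirs. (A * a + B * b) * b' = (C * a + D * b) * a') \<and>
     (\<forall>(a', b')\<in>dirs. \<exists>(a, b)\<in>dirs. (A * a + B * b) * b' = (C * a + D * b) * a'))"

lemma same_leaves_direction:
  assumes W: "holo2_on W N" "p \<in> N" and sl: "same_leaves p l W"
    and l: "\<And>z t. l (fst z + t * a, snd z + t * b) = l z"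
  shows "\<forall>\<^sub>F z in nhds p. pdx W z * a + pdy W z * b = 0"
proof -
  obtain M where M: "open M" "p \<in> M" "\<And>a b. a \<in> M \<Longrightarrow> b \<in> M \<Longrightarrow> l a = l b \<longleftrightarrow> W a = W b"
    using sl unfolding same_leaves_def by auto
  have "pdx W z * a + pdy W z * b = 0" if z: "z \<in> M \<inter> N" for z
  proof (rule DERIV_unique)
    let ?c = "\<lambda>t. (fst z + t * a, snd z + t * b)"
    have "((\<lambda>t. W (fst z + t * a, snd z + t * b)) has_field_derivative
        pdx W (fst z + 0 * a, snd z + 0 * b) * a + pdy W (fst z + 0 * a, snd z + 0 * b) * b) (at 0)"
      by (rule has_field_derivative_along_curve[OF W(1)]) (use z in \<open>auto intro!: derivative_eq_intros\<close>)
    then show "((\<lambda>t. W (?c t)) has_field_derivative pdx W z * a + pdy W z * b) (at 0)" by simp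
    have cc: "continuous_on UNIV ?c" by (intro continuous_intros)
    show "((\<lambda>t. W (?c t)) has_field_derivative 0) (at 0)"
    proof (rule has_field_derivative_transform_within_open[of "\<lambda>_. W z" _ _ "?c -` M"])
      fix t assume "t \<in> ?c -` M"
      then show "W z = W (?c t)" using M(3)[of "?c t" z] l[of z t] z by auto
    qed (use z open_vimage[OF M(1) cc] in auto)
  qed
  moreover have "open (M \<inter> N)" "p \<in> M \<inter> N" using M W holo2_on_open[OF W(1)] by auto
  ultimately show ?thesis unfolding eventually_nhds by blast
qed

text \<open>\<open>W\<close> is constant on the graph of a leaf of \<open>u\<close>, whose slope is
  \<open>- pdx u / pdy u\<close>; up to the factor \<open>pdy u\<close>, the derivative of
  \<open>W\<close> along this graph is the wedge product.\<close>

lemma same_leaves_wedge: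
  assumes W: "holo2_on W N" "p \<in> N" and sl: "same_leaves p u W"
    and u: "holo2_on u N" "\<And>z. z \<in> N \<Longrightarrow> pdy u z \<noteq> 0"
  shows "\<forall>\<^sub>F z in nhds p. pdx W z * pdy u z = pdy W z * pdx u z"
proof -
  obtain M where M: "open M" "p \<in> M" "\<And>a b. a \<in> M \<Longrightarrow> b \<in> M \<Longrightarrow> u a = u b \<longleftrightarrow> W a = W b"
    using sl unfolding same_leaves_def by auto
  have opN: "open (M \<inter> N)" using M W holo2_on_open[OF W(1)] by auto
  have "pdx W z * pdy u z = pdy W z * pdx u z" if z: "z \<in> M \<inter> N" for z
  proof -
    have u': "holo2_on u (M \<inter> N)" by (rule holo2_on_subset[OF u(1) opN]) auto
    obtain x0 y0 where z0: "z = (x0, y0)" by force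
    obtain Y r where r: "r > 0" and Y: "Y x0 = y0"
      "\<And>t. t \<in> ball x0 r \<Longrightarrow> (t, Y t) \<in> M \<inter> N" "\<And>t. t \<in> ball x0 r \<Longrightarrow> u (t, Y t) = u (x0, y0)"
      and Yd: "\<And>t. t \<in> ball x0 r \<Longrightarrow>
         (Y has_field_derivative - pdx u (t, Y t) / pdy u (t, Y t)) (at t)"
      using leaf_curve[OF u'] z u(2)[of z] unfolding z0 by (metis IntD2)
    have x0: "x0 \<in> ball x0 r" using r by simp
    have "pdx W z * 1 + pdy W z * (- pdx u z / pdy u z) = 0"
    proof (rule DERIV_unique)
      show "((\<lambda>t. W (t, Y t)) has_field_derivative pdx W z * 1 + pdy W z * (- pdx u z / pdy u z)) (at x0)"
        using has_field_derivative_along_curve[OF W(1) _ DERIV_ident Yd[OF x0]] Y(1,2) x0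
        by (auto simp: z0)
      show "((\<lambda>t. W (t, Y t)) has_field_derivative 0) (at x0)"
      proof (rule has_field_derivative_transform_within_open[of "\<lambda>_. W z" _ _ "ball x0 r"])
        fix t assume t: "t \<in> ball x0 r"
        show "W z = W (t, Y t)" using M(3)[of "(t, Y t)" z] Y(2,3)[OF t] z by (simp add: z0)
      qed (use x0 in auto)
    qed
    then show ?thesis using u(2)[of z] z by (simp add: field_simps)
  qed
  moreover have "p \<in> M \<inter> N" using M W by auto
  ultimately show ?thesis using opN unfolding eventually_nhds by blast
qed

text \<open>If the differential of \<open>(f, g)\<close> is everywhere a multiple of its value at \<open>p\<close>, then, up to a
  linear map, \<open>f\<close> depends only on \<open>x\<close>, \<open>g\<close> only on \<open>y\<close>, and the multiplier, depending on neither
  variable, is constant.\<close>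

lemma conformal_imp_affine:
  assumes f: "holo2_on f U" and g: "holo2_on g U" and p: "p \<in> U"
    and F: "A = pdx f p" "B = pdy f p" "C = pdx g p" "D = pdy g p" "A * D - B * C \<noteq> 0"
    and E: "\<And>z. z \<in> U \<Longrightarrow> pdx f z * C = pdx g z * A" "\<And>z. z \<in> U \<Longrightarrow> pdy f z * D = pdy g z * B"
       "\<And>z. z \<in> U \<Longrightarrow> pdx f z * D + pdy f z * C = pdx g z * B + pdy g z * A"
  shows "\<exists>c d. \<forall>\<^sub>F z in nhds p. f z = A * fst z + B * snd z + c \<and> g z = C * fst z + D * snd z + d"
proof -
  obtain x0 y0 where p0: "p = (x0, y0)" by force
  obtain r where r: "r > 0" "cball x0 r \<times> cball y0 r \<subseteq> U"
    using sep_holo_box[OF holo2_on_open[OF f]] p p0 by metis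
  define k where "k = A * D - B * C"
  have U: "(x, y) \<in> U" if "x \<in> ball x0 r" "y \<in> ball y0 r" for x y using r that by auto
  \<comment> \<open>\<open>P\<close> and \<open>Q\<close> come from the adjugate of the differential
    at \<open>p\<close>, which turns every multiple of that differential into a scalar
    matrix.\<close>
  define P where "P z = D * f z - B * g z" for z
  define Q where "Q z = A * g z - C * f z" for z
  have Px: "((\<lambda>t. P (t, y)) has_field_derivative D * pdx f (x, y) - B * pdx g (x, y)) (at x)"
   and Py: "((\<lambda>t. P (x, t)) has_field_derivative 0) (at y)"
   and Qx: "((\<lambda>t. Q (t, y)) has_field_derivative 0) (at x)"
   and Qy: "((\<lambda>t. Q (x, t)) has_field_derivative D * pdx f (x, y) - B * pdx g (x, y)) (at y)"
   if "x \<in> ball x0 r" "y \<in> ball y0 r" for x y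
    unfolding P_def Q_def
    by (rule derivative_eq_intros refl holo2_on_DERIV[OF f U[OF that]] holo2_on_DERIV[OF g U[OF that]]
         | use E[OF U[OF that]] in \<open>simp add: algebra_simps\<close>)+
  have const: "h x = h x'" if "\<And>x. x \<in> ball a r \<Longrightarrow> (h has_field_derivative 0) (at x)" "x \<in> ball a r" "x' \<in> ball a r"
    for h :: "complex \<Rightarrow> complex" and a x x'
  proof -
    have "\<exists>c. \<forall>x\<in>ball a r. h x = c"
      using that(1) by (intro has_field_derivative_zero_constant) (auto intro: has_field_derivative_at_within)
    with that(2,3) show ?thesis by auto
  qed
  have x0: "x0 \<in> ball x0 r" and y0: "y0 \<in> ball y0 r" using r by auto
  have P1: "P (x, y) = P (x, y0)" if "x \<in> ball x0 r" "y \<in> ball y0 r" for x y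
    by (rule const[of y0 "\<lambda>y. P (x, y)"]) (use that Py y0 in auto)
  have Q1: "Q (x, y) = Q (x0, y)" if "x \<in> ball x0 r" "y \<in> ball y0 r" for x y
    by (rule const[of x0 "\<lambda>x. Q (x, y)"]) (use that Qx x0 in auto)
  have mult: "D * pdx f (x, y) - B * pdx g (x, y) = k" if x: "x \<in> ball x0 r" and y: "y \<in> ball y0 r" for x y
  proof -
    have "D * pdx f (x, y) - B * pdx g (x, y) = D * pdx f (x, y0) - B * pdx g (x, y0)"
    proof (rule DERIV_unique[OF Px[OF x y]])
      show "((\<lambda>t. P (t, y)) has_field_derivative D * pdx f (x, y0) - B * pdx g (x, y0)) (at x)"
        by (rule has_field_derivative_transform_within_open[OF Px[OF x y0] open_ball x])
           (rule P1[OF _ y, symmetric])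
    qed
    also have "\<dots> = D * pdx f (x0, y0) - B * pdx g (x0, y0)"
    proof (rule DERIV_unique[OF Qy[OF x y0]])
      show "((\<lambda>t. Q (x, t)) has_field_derivative D * pdx f (x0, y0) - B * pdx g (x0, y0)) (at y0)"
        by (rule has_field_derivative_transform_within_open[OF Qy[OF x0 y0] open_ball y0])
           (rule Q1[OF x, symmetric])
    qed
    also have "\<dots> = k" using F(1-4) unfolding p0 k_def by (simp add: mult.commute)
    finally show ?thesis .
  qed
  have lin: "f z = A * fst z + B * snd z + (A * (P (x0, y0) - k * x0) + B * (Q (x0, y0) - k * y0)) / k \<and>
      g z = C * fst z + D * snd z + (C * (P (x0, y0) - k * x0) + D * (Q (x0, y0) - k * y0)) / k"
    if "z \<in> ball x0 r \<times> ball y0 r" for z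
  proof -
    obtain x y where z: "z = (x, y)" "x \<in> ball x0 r" "y \<in> ball y0 r" using \<open>z \<in> _\<close> by auto
    have "P (x, y0) - k * x = P (x0, y0) - k * x0"
      by (rule const[of x0 "\<lambda>x. P (x, y0) - k * x"])
         (use z x0 in \<open>auto intro!: derivative_eq_intros Px[OF _ y0] mult[OF _ y0]\<close>)
    moreover have "Q (x0, y) - k * y = Q (x0, y0) - k * y0"
      by (rule const[of y0 "\<lambda>y. Q (x0, y) - k * y"])
         (use z y0 in \<open>auto intro!: derivative_eq_intros Qy[OF x0] mult[OF x0]\<close>)
    ultimately have PQ: "P z = k * x + (P (x0, y0) - k * x0)" "Q z = k * y + (Q (x0, y0) - k * y0)"
      using P1[OF z(2,3)] Q1[OF z(2,3)] z(1) by (simp_all add: algebra_simps)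
    have "k * f z = A * P z + B * Q z" "k * g z = C * P z + D * Q z"
      by (simp_all add: P_def Q_def k_def algebra_simps)
    then have "k * f z = k * (A * x + B * y) + (A * (P (x0, y0) - k * x0) + B * (Q (x0, y0) - k * y0))"
      "k * g z = k * (C * x + D * y) + (C * (P (x0, y0) - k * x0) + D * (Q (x0, y0) - k * y0))"
      unfolding PQ by (simp_all add: algebra_simps)
    moreover have "k \<noteq> 0" using F by (simp add: k_def)
    ultimately show ?thesis using z(1) by (simp add: field_simps)
  qed
  have "open (ball x0 r \<times> ball y0 r)" "p \<in> ball x0 r \<times> ball y0 r"
    using x0 y0 p0 by (auto intro: open_Times)
  with lin show ?thesis unfolding eventually_nhds by blast
qed

text \<open>Treats the four linear members uniformly: each has a constant covector
  \<open>(c1, c2)\<close> and is invariant along a vector of \<open>dirs\<close> in its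
  kernel.\<close>

lemma web5_members:
  assumes "w \<in> set (web5 v)"
  obtains (self) "w = v"
  | (lin) c1 c2 a b where "(a, b) \<in> dirs" "c1 * a + c2 * b = 0" "c1 \<noteq> 0 \<or> c2 \<noteq> 0"
      "\<And>z. pdx w z = c1" "\<And>z. pdy w z = c2" "holo2_on w UNIV"
      "\<And>z t. w (fst z + t * a, snd z + t * b) = w z"
  using assms unfolding set_web5
proof (elim insertE, goal_cases)
  case 1 show ?case by (rule 1(2)[of 0 1 1 0]) (auto simp: 1 dirs_def holo2_on_linear)
next
  case 2 show ?case by (rule 2(2)[of 1 0 0 1]) (auto simp: 2 dirs_def holo2_on_linear)
next
  case 3 show ?case by (rule 3(2)[of 1 "-1" 1 1]) (auto simp: 3 dirs_def holo2_on_linear)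
next
  case 4 show ?case by (rule 4(2)[of 1 1 1 "-1"]) (auto simp: 4 dirs_def holo2_on_linear)
qed auto

lemma dirs_members:
  assumes "(a, b) \<in> dirs"
  obtains l where "l \<in> set (web5 v)" "\<And>z t. l (fst z + t * a, snd z + t * b) = l z"
    "\<And>z. pdx l z * a + pdy l z * b = 0" "\<And>z. pdx l z = pdx l 0" "\<And>z. pdy l z = pdy l 0"
    "pdx l 0 \<noteq> 0 \<or> pdy l 0 \<noteq> 0"
proof -
  from assms consider "a = 0" "b = 1" | "a = 1" "b = 0" | "a = 1" "b = -1" | "a = 1" "b = 1"
    unfolding dirs_def by auto
  then show ?thesis
  proof cases
    case 1 then show ?thesis by (intro that[of "\<lambda>(x, y). x"]) (auto simp: set_web5)
  next
    case 2 then show ?thesis by (intro that[of "\<lambda>(x, y). y"]) (auto simp: set_web5)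
  next
    case 3 then show ?thesis by (intro that[of "\<lambda>(x, y). x + y"]) (auto simp: set_web5)
  next
    case 4 then show ?thesis by (intro that[of "\<lambda>(x, y). x - y"]) (auto simp: set_web5)
  qed
qed

lemma affine_pd:
  "pdx (\<lambda>z. A * fst z + B * snd z + c) z = A" "pdy (\<lambda>z. A * fst z + B * snd z + c) z = B"
  by (auto simp: pdx_def pdy_def intro!: DERIV_imp_deriv derivative_eq_intros)

text \<open>\<open>P\<close> fails for at most one of the four directions. Parallelism with
  \<open>(A * a + B * b, C * a + D * b)\<close> is the vanishing of a quadratic form in
  \<open>(a, b)\<close> with coefficients \<open>s\<close>, \<open>m\<close>, \<open>t\<close>, and
  three zeros in distinct directions make it vanish identically.\<close>

lemma three_directions:
  fixes fx fy gx gy A B C D :: complex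
  assumes "\<And>a b a' b'. (a, b) \<in> dirs \<Longrightarrow> (a', b') \<in> dirs \<Longrightarrow> a * b' - b * a' \<noteq> 0 \<Longrightarrow> P a b \<or> P a' b'"
    and "\<And>a b. P a b \<Longrightarrow> \<forall>\<^sub>F z in nhds p. (pdx f z * a + pdy f z * b) * (C * a + D * b) =
                      (pdx g z * a + pdy g z * b) * (A * a + B * b)"
  shows "\<forall>\<^sub>F z in nhds p. pdx f z * C = pdx g z * A \<and> pdy f z * D = pdy g z * B \<and>
           pdx f z * D + pdy f z * C = pdx g z * B + pdy g z * A"
proof -
  have c: "P 0 1 \<or> P 1 0" "P 0 1 \<or> P 1 (-1)" "P 0 1 \<or> P 1 1" "P 1 0 \<or> P 1 (-1)" "P 1 0 \<or> P 1 1" "P 1 (-1) \<or> P 1 1"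
    using assms(1)[of 0 1 1 0] assms(1)[of 0 1 1 "-1"] assms(1)[of 0 1 1 1]
      assms(1)[of 1 0 1 "-1"] assms(1)[of 1 0 1 1] assms(1)[of 1 "-1" 1 1]
    by (auto simp: dirs_def)
  define s where "s z = pdx f z * C - pdx g z * A" for z
  define t where "t z = pdy f z * D - pdy g z * B" for z
  define m where "m z = pdx f z * D + pdy f z * C - (pdx g z * B + pdy g z * A)" for z
  have q: "\<forall>\<^sub>F z in nhds p. s z * a\<^sup>2 + m z * (a * b) + t z * b\<^sup>2 = 0" if "P a b" for a b
    using assms(2)[OF that]
    by eventually_elim (simp add: s_def t_def m_def algebra_simps power2_eq_square)
  have z3: "s = 0 \<and> t = 0 \<and> m = 0"
    if "s + m + t = 0" "s - m + t = 0" "s = 0 \<or> t = 0" for s t m :: complex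
  proof -
    have "2 * m = (s + m + t) - (s - m + t)" by simp
    with that show ?thesis by auto
  qed
  note e = q[of 0 1] q[of 1 0] q[of 1 "-1"] q[of 1 1]
  from c consider "P 0 1" "P 1 0" "P 1 (-1)" | "P 0 1" "P 1 0" "P 1 1" | "P 0 1" "P 1 (-1)" "P 1 1"
    | "P 1 0" "P 1 (-1)" "P 1 1" by blast
  then have "\<forall>\<^sub>F z in nhds p. s z = 0 \<and> t z = 0 \<and> m z = 0"
  proof cases
    case 1
    from e(1)[OF 1(1)] e(2)[OF 1(2)] e(3)[OF 1(3)] show ?thesis
      by eventually_elim simp
  next
    case 2
    from e(1)[OF 2(1)] e(2)[OF 2(2)] e(4)[OF 2(3)] show ?thesis
      by eventually_elim simp
  next
    case 3
    from e(1)[OF 3(1)] e(3)[OF 3(2)] e(4)[OF 3(3)] show ?thesis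
      by eventually_elim (rule z3, simp_all)
  next
    case 4
    from e(2)[OF 4(1)] e(3)[OF 4(2)] e(4)[OF 4(3)] show ?thesis
      by eventually_elim (rule z3, simp_all)
  qed
  then show ?thesis
    by eventually_elim (simp add: s_def t_def m_def)
qed

lemma cross_eq_of_common_annihilator:
  fixes c1 c2 x y x' y' :: complex
  assumes "c1 \<noteq> 0 \<or> c2 \<noteq> 0" "c1 * x + c2 * y = 0" "c1 * x' + c2 * y' = 0"
  shows "x * y' = y * x'"
proof -
  have "c1 * (x * y' - y * x') = 0" "c2 * (x * y' - y * x') = 0"
    using assms(2,3) by algebra+
  with assms(1) show ?thesis by auto
qed

text \<open>Since at most one pencil can go to the leaves of \<open>v\<close>, at least three go to
  pencils, and their constant image directions make \<Phi> affine. Being affine, \<Phi> extends to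
  the whole plane, and the assumptions \<open>ncu\<close> and \<open>ncv\<close> then forbid that a
  pencil corresponds to the fifth foliation of the other web.\<close>

theorem web_equivalent_imp_affine_equiv:
  assumes sfu: "slope_form u w1 w2" and u: "holo2_at u p" "cond_T u p"
    and sfv: "slope_form v w1' w2'" and v: "holo2_at v q" "cond_T v q"
    and ncu: "\<And>k1 k2. k1 \<noteq> 0 \<or> k2 \<noteq> 0 \<Longrightarrow> \<exists>z. k1 * w1 z + k2 * w2 z \<noteq> 0"
    and ncv: "\<And>k1 k2. k1 \<noteq> 0 \<or> k2 \<noteq> 0 \<Longrightarrow> \<exists>z. k1 * w1' z + k2 * w2' z \<noteq> 0"
    and eq: "web_equivalent p (web5 u) q (web5 v)"
  shows "affine_equiv w1 w2 w1' w2'"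
proof -
  obtain \<Phi> where \<Phi>: "local_diffeo \<Phi> p q"
    and m1: "\<And>u'. u' \<in> set (web5 u) \<Longrightarrow> \<exists>w\<in>set (web5 v). same_leaves p u' (w \<circ> \<Phi>)"
    and m2: "\<And>w. w \<in> set (web5 v) \<Longrightarrow> \<exists>u'\<in>set (web5 u). same_leaves p u' (w \<circ> \<Phi>)"
    using web_equivalent_same_leaves[OF eq submersion_at_web5[OF u]] by metis
  obtain f g U where fgU: "holo2_on f U" "holo2_on g U" "p \<in> U" and fgP: "\<And>z. \<Phi> z = (f z, g z)"
    and det: "\<And>z. z \<in> U \<Longrightarrow> pdx f z * pdy g z - pdy f z * pdx g z \<noteq> 0"
    and ev1: "\<And>P. \<forall>\<^sub>F z in nhds p. P (\<Phi> z) \<Longrightarrow> \<forall>\<^sub>F w in nhds q. P w"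
    and ev2: "\<And>P. \<forall>\<^sub>F w in nhds q. P w \<Longrightarrow> \<forall>\<^sub>F z in nhds p. P (\<Phi> z)"
    using local_diffeoE[OF \<Phi>] by metis
  have pq: "\<Phi> p = q" using \<Phi> by (simp add: local_diffeo_def)
  obtain Nu where Nu: "open Nu" "p \<in> Nu" "holo2_on u Nu" "\<And>z. z \<in> Nu \<Longrightarrow> pdy u z \<noteq> 0"
    "\<And>z. z \<in> Nu \<Longrightarrow> \<exists>h. h \<noteq> 0 \<and> pdx u z = h * w1 z \<and> pdy u z = h * w2 z"
    using eventually_slope[OF sfu u] by metis
  obtain Nv where Nv: "open Nv" "q \<in> Nv" "holo2_on v Nv"
    "\<And>z. z \<in> Nv \<Longrightarrow> \<exists>h. h \<noteq> 0 \<and> pdx v z = h * w1' z \<and> pdy v z = h * w2' z"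
    using eventually_slope[OF sfv v] by metis
  have "\<forall>\<^sub>F w in nhds q. w \<in> Nv" using Nv by (simp add: eventually_nhds_in_open)
  from ev2[OF this] obtain L where L: "open L" "p \<in> L" "\<And>z. z \<in> L \<Longrightarrow> \<Phi> z \<in> Nv"
    unfolding eventually_nhds by blast
  define N where "N = L \<inter> U \<inter> Nu"
  have opN: "open N" unfolding N_def using L Nu holo2_on_open[OF fgU(1)] by blast
  have pN: "p \<in> N" using L Nu fgU by (simp add: N_def)
  have evN: "\<forall>\<^sub>F z in nhds p. z \<in> N" using opN pN by (simp add: eventually_nhds_in_open)
  have f: "holo2_on f N" and g: "holo2_on g N" and uN: "holo2_on u N"
    using fgU Nu opN by (auto simp: N_def intro: holo2_on_subset)
  have wN: "holo2_on w Nv" if "w \<in> set (web5 v)" for w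
    using web5_members[OF that] Nv(1,3) by (metis holo2_on_subset subset_UNIV)
  have compN: "holo2_on (w \<circ> \<Phi>) N"
    "\<And>z. z \<in> N \<Longrightarrow> pdx (w \<circ> \<Phi>) z = pdx w (\<Phi> z) * pdx f z + pdy w (\<Phi> z) * pdx g z"
    "\<And>z. z \<in> N \<Longrightarrow> pdy (w \<circ> \<Phi>) z = pdx w (\<Phi> z) * pdy f z + pdy w (\<Phi> z) * pdy g z"
    if w: "w \<in> set (web5 v)" for w
  proof -
    have NV: "(f z, g z) \<in> Nv" if "z \<in> N" for z using L(3)[of z] that by (simp add: fgP N_def)
    have "w \<circ> \<Phi> = (\<lambda>z. w (f z, g z))" by (simp add: fun_eq_iff fgP)
    then show "holo2_on (w \<circ> \<Phi>) N"
      "\<And>z. z \<in> N \<Longrightarrow> pdx (w \<circ> \<Phi>) z = pdx w (\<Phi> z) * pdx f z + pdy w (\<Phi> z) * pdx g z"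
      "\<And>z. z \<in> N \<Longrightarrow> pdy (w \<circ> \<Phi>) z = pdx w (\<Phi> z) * pdy f z + pdy w (\<Phi> z) * pdy g z"
      using holo2_on_compose[OF wN[OF w] f g NV] pd_compose[OF wN[OF w] f g NV] by (auto simp: fgP)
  qed
  define Jx where "Jx z a b = pdx f z * a + pdy f z * b" for z a b
  define Jy where "Jy z a b = pdx g z * a + pdy g z * b" for z a b
  have dmatch: "\<forall>\<^sub>F z in nhds p. pdx w (\<Phi> z) * Jx z a b + pdy w (\<Phi> z) * Jy z a b = 0"
    if w: "w \<in> set (web5 v)" and sl: "same_leaves p l (w \<circ> \<Phi>)"
      and l: "\<And>z t. l (fst z + t * a, snd z + t * b) = l z" for w l a b
    using same_leaves_direction[OF compN(1)[OF w] pN sl l] evN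
    by eventually_elim (simp add: compN(2,3)[OF w] Jx_def Jy_def algebra_simps)
  define A where "A = pdx f p" define B where "B = pdy f p"
  define C where "C = pdx g p" define D where "D = pdy g p"
  have k: "A * D - B * C \<noteq> 0" using det[OF fgU(3)] by (simp add: A_def B_def C_def D_def)
  have M0: "A * a + B * b \<noteq> 0 \<or> C * a + D * b \<noteq> 0" if "a \<noteq> 0 \<or> b \<noteq> 0" for a b
  proof (rule ccontr)
    assume "\<not> ?thesis"
    then have "(A * D - B * C) * a = 0" "(A * D - B * C) * b = 0" by (auto, algebra+)
    with k that show False by auto
  qed
  have Jp: "Jx p a b = A * a + B * b" "Jy p a b = C * a + D * b" for a b
    by (simp_all add: Jx_def Jy_def A_def B_def C_def D_def)
  \<comment> \<open>\<open>linm\<close> and \<open>vm\<close> record where \<Phi> sends the pencil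
    of direction \<open>(a, b)\<close>: to a pencil with direction in \<open>dirs\<close>, or to the
    leaves of \<open>v\<close>.\<close>
  define linm where "linm a b \<longleftrightarrow> (\<exists>c1 c2. (c1 \<noteq> 0 \<or> c2 \<noteq> 0) \<and>
      (\<exists>(a', b')\<in>dirs. c1 * a' + c2 * b' = 0) \<and> (\<forall>\<^sub>F z in nhds p. c1 * Jx z a b + c2 * Jy z a b = 0))" for a b
  define vm where "vm a b \<longleftrightarrow> (\<forall>\<^sub>F z in nhds p. pdx v (\<Phi> z) * Jx z a b + pdy v (\<Phi> z) * Jy z a b = 0)" for a b
  have lv: "linm a b \<or> vm a b" if ab: "(a, b) \<in> dirs" for a b
  proof -
    obtain l where l: "l \<in> set (web5 u)" "\<And>z t. l (fst z + t * a, snd z + t * b) = l z"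
      using dirs_members[OF ab] by metis
    obtain w where w: "w \<in> set (web5 v)" "same_leaves p l (w \<circ> \<Phi>)" using m1[OF l(1)] by blast
    note d = dmatch[OF w l(2)]
    from w(1) show ?thesis
    proof (cases rule: web5_members)
      case self
      with d show ?thesis by (simp add: vm_def)
    next
      case (lin c1 c2 a' b')
      with d have "linm a b" unfolding linm_def by (intro exI[of _ c1] exI[of _ c2]) auto
      then show ?thesis ..
    qed
  qed
  \<comment> \<open>The invertible differential at \<open>p\<close> keeps independent directions
    independent, and only one direction is annihilated by \<open>dv\<close> at
    \<open>q\<close>.\<close>
  have vv: False if "vm a b" "vm a' b'" "a * b' - b * a' \<noteq> 0" for a b a' b'
  proof -
    have "pdx v q * (A * a + B * b) + pdy v q * (C * a + D * b) = 0"
      "pdx v q * (A * a' + B * b') + pdy v q * (C * a' + D * b') = 0"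
      using that(1,2)[unfolded vm_def, THEN eventually_nhds_x_imp_x] by (simp_all add: pq Jp)
    then have "(pdx v q * A + pdy v q * C) * (a * b' - b * a') = 0"
      "(pdx v q * B + pdy v q * D) * (a * b' - b * a') = 0" by algebra+
    with that(3) have "pdx v q * A + pdy v q * C = 0" "pdx v q * B + pdy v q * D = 0" by auto
    then have "pdx v q * (A * D - B * C) = 0" by algebra
    with k cond_T_D(1)[OF v(2)] show False by simp
  qed
  \<comment> \<open>The image directions at \<open>z\<close> and at \<open>p\<close> are annihilated
    by the same constant covector, hence parallel.\<close>
  have ql: "\<forall>\<^sub>F z in nhds p. (pdx f z * a + pdy f z * b) * (C * a + D * b) =
                      (pdx g z * a + pdy g z * b) * (A * a + B * b)" if lm: "linm a b" for a b
  proof -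
    obtain c1 c2 where c: "c1 \<noteq> 0 \<or> c2 \<noteq> 0" "\<forall>\<^sub>F z in nhds p. c1 * Jx z a b + c2 * Jy z a b = 0"
      using lm unfolding linm_def by blast
    from eventually_nhds_x_imp_x[OF c(2)] have cp: "c1 * Jx p a b + c2 * Jy p a b = 0" .
    from c(2) show ?thesis
      unfolding Jx_def[symmetric] Jy_def[symmetric] Jp[symmetric]
      by eventually_elim (rule cross_eq_of_common_annihilator[OF c(1) _ cp])
  qed
  have "\<forall>\<^sub>F z in nhds p. pdx f z * C = pdx g z * A \<and> pdy f z * D = pdy g z * B \<and>
           pdx f z * D + pdy f z * C = pdx g z * B + pdy g z * A"
  proof (rule three_directions[where P = linm])
    show "linm a b \<or> linm a' b'"
      if "(a, b) \<in> dirs" "(a', b') \<in> dirs" "a * b' - b * a' \<noteq> 0" for a b a' b'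
      using lv[OF that(1)] lv[OF that(2)] vv[OF _ _ that(3)] by blast
  qed (rule ql)
  then obtain S where S: "open S" "p \<in> S" "\<And>z. z \<in> S \<Longrightarrow> pdx f z * C = pdx g z * A"
    "\<And>z. z \<in> S \<Longrightarrow> pdy f z * D = pdy g z * B"
    "\<And>z. z \<in> S \<Longrightarrow> pdx f z * D + pdy f z * C = pdx g z * B + pdy g z * A"
    unfolding eventually_nhds by blast
  have opS: "open (S \<inter> N)" using S opN by blast
  have fS: "holo2_on f (S \<inter> N)" "holo2_on g (S \<inter> N)"
    using f g holo2_on_subset[OF _ opS] by auto
  have "\<exists>c d. \<forall>\<^sub>F z in nhds p. f z = A * fst z + B * snd z + c \<and> g z = C * fst z + D * snd z + d"
    by (rule conformal_imp_affine[OF fS _ A_def B_def C_def D_def k]) (use S pN in auto)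
  then obtain c d where "\<forall>\<^sub>F z in nhds p. f z = A * fst z + B * snd z + c \<and> g z = C * fst z + D * snd z + d"
    by blast
  then obtain R where R: "open R" "p \<in> R" "\<And>z. z \<in> R \<Longrightarrow> f z = A * fst z + B * snd z + c"
    "\<And>z. z \<in> R \<Longrightarrow> g z = C * fst z + D * snd z + d"
    unfolding eventually_nhds by blast
  have evR: "\<forall>\<^sub>F z in nhds p. z \<in> R" using R by (simp add: eventually_nhds_in_open)
  have pdR: "pdx f z = A" "pdy f z = B" "pdx g z = C" "pdy g z = D" if "z \<in> R" for z
    using pdx_cong[OF R(1) that R(3)] pdx_cong[OF R(1) that R(4)] by (simp_all add: affine_pd)
  have w: "holo2_on w1 UNIV" "holo2_on w2 UNIV" "holo2_on w1' UNIV" "holo2_on w2' UNIV"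
    using sfu sfv by (simp_all add: slope_form_def)
  \<comment> \<open>If \<open>u\<close> went to a pencil, its leaves would be parallel lines, \<Phi>
    being affine by now, and \<open>w1\<close>, \<open>w2\<close> would be linearly
    dependent.\<close>
  have uself: False if l: "l \<in> set (web5 v)" "same_leaves p u (l \<circ> \<Phi>)"
     and pl: "\<And>z. pdx l z = c1" "\<And>z. pdy l z = c2" "c1 \<noteq> 0 \<or> c2 \<noteq> 0" for l c1 c2
  proof -
    define k1 where "k1 = c1 * A + c2 * C" define k2 where "k2 = c1 * B + c2 * D"
    have "\<forall>\<^sub>F z in nhds p. pdx (l \<circ> \<Phi>) z * pdy u z = pdy (l \<circ> \<Phi>) z * pdx u z"
      by (rule same_leaves_wedge[OF compN(1)[OF l(1)] pN l(2) uN]) (simp add: N_def Nu(4))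
    then have "\<forall>\<^sub>F z in nhds p. k1 * w2 z - k2 * w1 z = 0"
      using evN evR
    proof eventually_elim
      case (elim z)
      then obtain h where h: "h \<noteq> 0" "pdx u z = h * w1 z" "pdy u z = h * w2 z"
        using Nu(5)[of z] by (auto simp: N_def)
      have "h * (k1 * w2 z - k2 * w1 z) = 0"
        using elim h by (simp add: compN(2,3)[OF l(1)] pl pdR k1_def k2_def algebra_simps)
      with h(1) show ?case by simp
    qed
    then have "k1 * w2 z - k2 * w1 z = 0" for z
      by (rule holo2_on_UNIV_eq_0[rotated]) (intro holo2_intros w)
    moreover have "k1 \<noteq> 0 \<or> k2 \<noteq> 0"
    proof (rule ccontr)
      assume "\<not> ?thesis"
      then have "c1 * (A * D - B * C) = 0" "c2 * (A * D - B * C) = 0"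
        unfolding k1_def k2_def by (auto, algebra+)
      with pl(3) k show False by auto
    qed
    ultimately show False using ncu[of "- k2" k1] by (auto simp: algebra_simps)
  qed
  \<comment> \<open>Proportionality of \<open>du\<close> and the pullback of \<open>dv\<close> near
    \<open>p\<close>, divided by the nonzero factors \<open>h\<close> and \<open>h'\<close>, is an
    identity between entire functions.\<close>
  have i: "w1 (x, y) * (B * w1' (A * x + B * y + c, C * x + D * y + d) + D * w2' (A * x + B * y + c, C * x + D * y + d)) =
            w2 (x, y) * (A * w1' (A * x + B * y + c, C * x + D * y + d) + C * w2' (A * x + B * y + c, C * x + D * y + d))" for x y
  proof -
    obtain w where w': "w \<in> set (web5 v)" "same_leaves p u (w \<circ> \<Phi>)"
      using m1[of u] by (auto simp: set_web5)
    have wv: "w = v" using w'(1)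
    proof (cases rule: web5_members)
      case (lin c1 c2 a b)
      then show ?thesis using uself[OF w'] by blast
    qed auto
    note vW = w'[unfolded wv]
    define X where "X z = A * fst z + B * snd z + c" for z :: plane
    define Y where "Y z = C * fst z + D * snd z + d" for z :: plane
    define G where "G z = w1 z * (B * w1' (X z, Y z) + D * w2' (X z, Y z)) -
        w2 z * (A * w1' (X z, Y z) + C * w2' (X z, Y z))" for z
    have "\<forall>\<^sub>F z in nhds p. pdx (v \<circ> \<Phi>) z * pdy u z = pdy (v \<circ> \<Phi>) z * pdx u z"
      by (rule same_leaves_wedge[OF compN(1)[OF vW(1)] pN vW(2) uN]) (simp add: N_def Nu(4))
    then have "\<forall>\<^sub>F z in nhds p. G z = 0"
      using evN evR
    proof eventually_elim
      case (elim z)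
      have XY: "\<Phi> z = (X z, Y z)" using R(3,4)[OF elim(3)] by (simp add: fgP X_def Y_def)
      obtain h where h: "h \<noteq> 0" "pdx u z = h * w1 z" "pdy u z = h * w2 z"
        using Nu(5)[of z] elim by (auto simp: N_def)
      obtain h' where h': "h' \<noteq> 0" "pdx v (\<Phi> z) = h' * w1' (\<Phi> z)" "pdy v (\<Phi> z) = h' * w2' (\<Phi> z)"
        using Nv(4)[OF L(3), of z] elim by (auto simp: N_def)
      have "h * h' * G z = 0"
        using elim(1) unfolding compN(2,3)[OF vW(1) elim(2)] pdR[OF elim(3)] h(2,3) h'(2,3)
        unfolding XY G_def
        by (simp add: algebra_simps)
      with h(1) h'(1) show ?case by simp
    qed
    moreover have "holo2_on G UNIV"
      unfolding G_def[abs_def] X_def Y_def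
      by (intro holo2_intros w holo2_on_compose[OF w(3)] holo2_on_compose[OF w(4)]) auto
    ultimately have "G (x, y) = 0" by (rule holo2_on_UNIV_eq_0[rotated])
    then show ?thesis by (simp add: G_def X_def Y_def)
  qed
  have ii: "\<exists>(a', b')\<in>dirs. (A * a + B * b) * b' = (C * a + D * b) * a'" if ab: "(a, b) \<in> dirs" for a b
  proof -
    have "a \<noteq> 0 \<or> b \<noteq> 0" using ab by (auto simp: dirs_def)
    \<comment> \<open>A pencil sent to the leaves of \<open>v\<close> would yield a constant vector
      annihilated by the field \<open>(w1', w2')\<close> near \<open>q\<close>, hence
      everywhere.\<close>
    have "\<not> vm a b"
    proof
      assume "vm a b"
      then have "\<forall>\<^sub>F z in nhds p. (A * a + B * b) * w1' (\<Phi> z) + (C * a + D * b) * w2' (\<Phi> z) = 0"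
        unfolding vm_def using evN evR
      proof eventually_elim
        case (elim z)
        obtain h' where h': "h' \<noteq> 0" "pdx v (\<Phi> z) = h' * w1' (\<Phi> z)" "pdy v (\<Phi> z) = h' * w2' (\<Phi> z)"
          using Nv(4)[OF L(3), of z] elim by (auto simp: N_def)
        have "h' * ((A * a + B * b) * w1' (\<Phi> z) + (C * a + D * b) * w2' (\<Phi> z)) = 0"
          using elim h'(2,3) by (simp add: Jx_def Jy_def pdR algebra_simps)
        with h'(1) show ?case by simp
      qed
      from ev1[OF this] have "(A * a + B * b) * w1' z + (C * a + D * b) * w2' z = 0" for z
        by (rule holo2_on_UNIV_eq_0[rotated]) (intro holo2_intros w)
      with ncv M0[OF \<open>a \<noteq> 0 \<or> b \<noteq> 0\<close>] show False by blast
    qed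
    then have "linm a b" using lv[OF ab] by blast
    then obtain c1 c2 a' b' where c: "c1 \<noteq> 0 \<or> c2 \<noteq> 0" "(a', b') \<in> dirs" "c1 * a' + c2 * b' = 0"
      "\<forall>\<^sub>F z in nhds p. c1 * Jx z a b + c2 * Jy z a b = 0"
      unfolding linm_def by blast
    have "c1 * (A * a + B * b) + c2 * (C * a + D * b) = 0"
      using eventually_nhds_x_imp_x[OF c(4)] by (simp add: Jp)
    from cross_eq_of_common_annihilator[OF c(1) this c(3)] c(2) show ?thesis by blast
  qed
  have iii: "\<exists>(a, b)\<in>dirs. (A * a + B * b) * b' = (C * a + D * b) * a'" if ab': "(a', b') \<in> dirs" for a' b'
  proof -
    obtain l where l: "l \<in> set (web5 v)" "\<And>z. pdx l z * a' + pdy l z * b' = 0"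
      "\<And>z. pdx l z = pdx l 0" "\<And>z. pdy l z = pdy l 0" "pdx l 0 \<noteq> 0 \<or> pdy l 0 \<noteq> 0"
      using dirs_members[OF ab'] by metis
    obtain u' where u': "u' \<in> set (web5 u)" "same_leaves p u' (l \<circ> \<Phi>)" using m2[OF l(1)] by blast
    from u'(1) show ?thesis
    proof (cases rule: web5_members)
      case self
      then show ?thesis using uself[OF l(1) _ l(3) l(4) l(5)] u'(2) by simp
    next
      case (lin c1 c2 a b)
      from eventually_nhds_x_imp_x[OF dmatch[OF l(1) u'(2) lin(7)]]
      have "pdx l 0 * (A * a + B * b) + pdy l 0 * (C * a + D * b) = 0"
        using l(3,4)[of "\<Phi> p"] by (simp add: Jp)
      from cross_eq_of_common_annihilator[OF l(5) this l(2)] lin(1) show ?thesis by blast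
    qed
  qed
  show ?thesis
    unfolding affine_equiv_def affine_match_def Let_def
    by (rule exI[of _ A], rule exI[of _ B], rule exI[of _ C], rule exI[of _ D], rule exI[of _ c], rule exI[of _ d])
       (use k i ii iii in blast)
qed

subsection \<open>Obstructions to affine equivalence\<close>

lemma affine_equivE:
  assumes "affine_equiv w1 w2 w1' w2'"
  obtains A B C D c d where "A * D - B * C \<noteq> 0"
    "affine_match w1 w2 w1' w2' A B C D c d"
    "\<And>a b. (a, b) \<in> dirs \<Longrightarrow> \<exists>(a', b')\<in>dirs. (A * a + B * b) * b' = (C * a + D * b) * a'"
    "\<And>a' b'. (a', b') \<in> dirs \<Longrightarrow> \<exists>(a, b)\<in>dirs. (A * a + B * b) * b' = (C * a + D * b) * a'"
  using assms unfolding affine_equiv_def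
proof (elim exE conjE, goal_cases)
  case (1 A B C D c d)
  show ?case by (rule 1(1)[of A D B C c d]) (use 1(2-5) in blast)+
qed

text \<open>The inverse affine map serves. Its entries are handled after multiplication by the
  determinant \<open>k\<close>, which keeps the identities polynomial.\<close>

lemma affine_equiv_sym:
  assumes "affine_equiv w1 w2 w1' w2'"
  shows "affine_equiv w1' w2' w1 w2"
proof -
  obtain A B C D c d where k: "A * D - B * C \<noteq> 0" and
    im: "affine_match w1 w2 w1' w2' A B C D c d" and
    ii: "\<And>a b. (a, b) \<in> dirs \<Longrightarrow> \<exists>(a', b')\<in>dirs. (A * a + B * b) * b' = (C * a + D * b) * a'" and
    iii: "\<And>a' b'. (a', b') \<in> dirs \<Longrightarrow> \<exists>(a, b)\<in>dirs. (A * a + B * b) * b' = (C * a + D * b) * a'"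
    by (rule affine_equivE[OF assms]) (rule that)
  note i = im[unfolded affine_match_def Let_def, rule_format]
  define k where "k = A * D - B * C"
  have k0: "k \<noteq> 0" using k by (simp add: k_def)
  define A' B' C' D' where "A' = D / k" and "B' = - B / k" and "C' = - C / k" and "D' = A / k"
  define c' d' where "c' = - (A' * c + B' * d)" and "d' = - (C' * c + D' * d)"
  have kk: "k * A' = D" "k * B' = - B" "k * C' = - C" "k * D' = A"
    using k0 by (simp_all add: A'_def B'_def C'_def D'_def)
  have det: "A' * D' - B' * C' \<noteq> 0"
  proof -
    have "k * k * (A' * D' - B' * C') = (k * A') * (k * D') - (k * B') * (k * C')"
      by (simp add: algebra_simps)
    also have "\<dots> = k" unfolding kk by (simp add: k_def algebra_simps)
    finally show ?thesis using k0 by auto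
  qed
  have inv: "A * (A' * X + B' * Y + c') + B * (C' * X + D' * Y + d') + c = X"
    "C * (A' * X + B' * Y + c') + D * (C' * X + D' * Y + d') + d = Y" for X Y
  proof -
    have "k * (A * (A' * X + B' * Y + c') + B * (C' * X + D' * Y + d') + c) =
        (A * (k * A') + B * (k * C')) * (X - c) + (A * (k * B') + B * (k * D')) * (Y - d) + k * c"
      by (simp add: c'_def d'_def algebra_simps)
    also have "\<dots> = k * X" unfolding kk by (simp add: k_def algebra_simps)
    finally have 1: "k * (A * (A' * X + B' * Y + c') + B * (C' * X + D' * Y + d') + c) = k * X" .
    have "k * (C * (A' * X + B' * Y + c') + D * (C' * X + D' * Y + d') + d) =
        (C * (k * A') + D * (k * C')) * (X - c) + (C * (k * B') + D * (k * D')) * (Y - d) + k * d"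
      by (simp add: c'_def d'_def algebra_simps)
    also have "\<dots> = k * Y" unfolding kk by (simp add: k_def algebra_simps)
    finally have 2: "k * (C * (A' * X + B' * Y + c') + D * (C' * X + D' * Y + d') + d) = k * Y" .
    from 1 2 show "A * (A' * X + B' * Y + c') + B * (C' * X + D' * Y + d') + c = X"
    "C * (A' * X + B' * Y + c') + D * (C' * X + D' * Y + d') + d = Y" using k0 by auto
  qed
  have dir: "(A' * a' + B' * b') * b = (C' * a' + D' * b') * a" if "(A * a + B * b) * b' = (C * a + D * b) * a'" for a b a' b'
  proof -
    have "k * ((A' * a' + B' * b') * b) = ((k * A') * a' + (k * B') * b') * b"
      by (simp add: algebra_simps)
    also have "\<dots> = ((k * C') * a' + (k * D') * b') * a"
      unfolding kk using that by algebra
    also have "\<dots> = k * ((C' * a' + D' * b') * a)"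
      by (simp add: algebra_simps)
    finally show ?thesis using k0 by simp
  qed
  have I: "w1' (X, Y) * (B' * w1 (x, y) + D' * w2 (x, y)) = w2' (X, Y) * (A' * w1 (x, y) + C' * w2 (x, y))"
    if xy: "x = A' * X + B' * Y + c'" "y = C' * X + D' * Y + d'" for X Y x y
  proof -
    have "w1 (x, y) * (B * w1' (X, Y) + D * w2' (X, Y)) = w2 (x, y) * (A * w1' (X, Y) + C * w2' (X, Y))"
      using i[of x y] unfolding xy inv .
    then have "w1' (X, Y) * ((k * B') * w1 (x, y) + (k * D') * w2 (x, y)) =
       w2' (X, Y) * ((k * A') * w1 (x, y) + (k * C') * w2 (x, y))"
      unfolding kk by algebra
    then have "k * (w1' (X, Y) * (B' * w1 (x, y) + D' * w2 (x, y))) =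
       k * (w2' (X, Y) * (A' * w1 (x, y) + C' * w2 (x, y)))"
      by (simp add: algebra_simps)
    then show ?thesis using k0 by simp
  qed
  show ?thesis
    unfolding affine_equiv_def
  proof (intro exI conjI)
    show "affine_match w1' w2' w1 w2 A' B' C' D' c' d'"
      unfolding affine_match_def Let_def using I by blast
    show "\<forall>(a, b)\<in>dirs. \<exists>(a', b')\<in>dirs. (A' * a + B' * b) * b' = (C' * a + D' * b) * a'"
      using iii dir by fast
    show "\<forall>(a', b')\<in>dirs. \<exists>(a, b)\<in>dirs. (A' * a + B' * b) * b' = (C' * a + D' * b) * a'"
      using ii dir by fast
  qed (rule det)
qed

text \<open>The matching identity has the form \<open>w1 * P = w2 * Q\<close>. Differentiated at a
  common zero of \<open>w1\<close> and \<open>w2\<close> it reads \<open>P dw1 = Q dw2\<close>; as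
  \<open>dw1\<close> and \<open>dw2\<close> are independent there, \<open>P\<close> and
  \<open>Q\<close> vanish, and they are an invertible linear transform of \<open>w1'\<close> and
  \<open>w2'\<close> at the image point.\<close>

lemma nondegenerate_zero_transport:
  assumes w: "holo2_on w1 UNIV" "holo2_on w2 UNIV" "holo2_on w1' UNIV" "holo2_on w2' UNIV"
    and k: "A * D - B * C \<noteq> 0" and i: "affine_match w1 w2 w1' w2' A B C D c d"
    and z: "w1 (x, y) = 0" "w2 (x, y) = 0"
    and nd: "pdx w1 (x, y) * pdy w2 (x, y) - pdy w1 (x, y) * pdx w2 (x, y) \<noteq> 0"
  shows "w1' (A * x + B * y + c, C * x + D * y + d) = 0 \<and> w2' (A * x + B * y + c, C * x + D * y + d) = 0"
proof -
  define X where "X z = A * fst z + B * snd z + c" for z :: plane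
  define Y where "Y z = C * fst z + D * snd z + d" for z :: plane
  define P where "P z = B * w1' (X z, Y z) + D * w2' (X z, Y z)" for z
  define Q where "Q z = A * w1' (X z, Y z) + C * w2' (X z, Y z)" for z
  have PQ: "holo2_on P UNIV" "holo2_on Q UNIV"
    unfolding P_def[abs_def] Q_def[abs_def] X_def Y_def
    by (intro holo2_intros w holo2_on_compose[OF w(3)] holo2_on_compose[OF w(4)]; simp)+
  have I: "w1 (x, y) * P (x, y) - w2 (x, y) * Q (x, y) = 0" for x y
    using i by (simp add: affine_match_def Let_def P_def Q_def X_def Y_def)
  have "pdx w1 (x, y) * P (x, y) - pdx w2 (x, y) * Q (x, y) = 0"
  proof (rule DERIV_unique)
    show "((\<lambda>t. w1 (t, y) * P (t, y) - w2 (t, y) * Q (t, y)) has_field_derivative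
        pdx w1 (x, y) * P (x, y) - pdx w2 (x, y) * Q (x, y)) (at x)"
      by (rule derivative_eq_intros refl holo2_on_DERIV(1)[OF w(1)] holo2_on_DERIV(1)[OF w(2)]
           holo2_on_DERIV(1)[OF PQ(1)] holo2_on_DERIV(1)[OF PQ(2)] UNIV_I)+
         (simp add: z)
    show "((\<lambda>t. w1 (t, y) * P (t, y) - w2 (t, y) * Q (t, y)) has_field_derivative 0) (at x)"
      by (simp add: I)
  qed
  moreover have "pdy w1 (x, y) * P (x, y) - pdy w2 (x, y) * Q (x, y) = 0"
  proof (rule DERIV_unique)
    show "((\<lambda>t. w1 (x, t) * P (x, t) - w2 (x, t) * Q (x, t)) has_field_derivative
        pdy w1 (x, y) * P (x, y) - pdy w2 (x, y) * Q (x, y)) (at y)"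
      by (rule derivative_eq_intros refl holo2_on_DERIV(2)[OF w(1)] holo2_on_DERIV(2)[OF w(2)]
           holo2_on_DERIV(2)[OF PQ(1)] holo2_on_DERIV(2)[OF PQ(2)] UNIV_I)+
         (simp add: z)
    show "((\<lambda>t. w1 (x, t) * P (x, t) - w2 (x, t) * Q (x, t)) has_field_derivative 0) (at y)"
      by (simp add: I)
  qed
  ultimately have
    "(pdx w1 (x, y) * pdy w2 (x, y) - pdy w1 (x, y) * pdx w2 (x, y)) * P (x, y) = 0"
    "(pdx w1 (x, y) * pdy w2 (x, y) - pdy w1 (x, y) * pdx w2 (x, y)) * Q (x, y) = 0"
    by algebra+
  with nd have "P (x, y) = 0" "Q (x, y) = 0" by auto
  then have "(A * D - B * C) * w1' (X (x, y), Y (x, y)) = 0" "(A * D - B * C) * w2' (X (x, y), Y (x, y)) = 0"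
    unfolding P_def Q_def by algebra+
  with k show ?thesis by (simp add: X_def Y_def)
qed

lemma sinh_cosh_2_neq_0: "sinh (2::complex) \<noteq> 0" "cosh (2::complex) \<noteq> 0"
proof -
  have n: "norm (exp (2::complex)) \<noteq> norm (exp (- 2 :: complex))" by (simp add: norm_exp_eq_Re)
  then have "exp (2::complex) \<noteq> exp (- 2)" "exp (2::complex) \<noteq> - exp (- 2)"
    by (metis, metis norm_minus_cancel)
  then show "sinh (2::complex) \<noteq> 0" "cosh (2::complex) \<noteq> 0"
    by (auto simp: sinh_field_def cosh_field_def add_eq_0_iff)
qed

text \<open>\<open>g\<close> vanishes on the nonempty open set where \<open>sinh (2 * t)\<close>
  does not, so the identity theorem applies.\<close>

lemma sinh_mult_entire_eq_0:
  fixes g :: "complex \<Rightarrow> complex"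
  assumes g: "g holomorphic_on UNIV" and z: "\<And>t. sinh (2 * t) * g t = 0"
  shows "g t = 0"
proof (rule analytic_continuation_open[of "{t. sinh (2 * t) \<noteq> 0}" UNIV g "\<lambda>_. 0"])
  have "open (- (\<lambda>t::complex. sinh (2 * t)) -` {0})"
    by (intro open_Compl closed_vimage continuous_intros)
  also have "- (\<lambda>t::complex. sinh (2 * t)) -` {0} = {t. sinh (2 * t) \<noteq> 0}" by auto
  finally show "open {t::complex. sinh (2 * t) \<noteq> 0}" .
  have "sinh (2 * (1::complex)) \<noteq> 0" using sinh_cosh_2_neq_0 by simp
  then show "{t::complex. sinh (2 * t) \<noteq> 0} \<noteq> {}" by blast
qed (use g z in auto)

text \<open>The field \<open>(sinh 2y, sinh 2x)\<close> vanishes at \<open>(0, i\<pi>/2)\<close> with linear part proportional to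
  \<open>y dx - x dy\<close>.  A proportional field is thus radially constant along the three lines through that
  point in the directions \<open>(1, 0)\<close>, \<open>(0, 1)\<close> and \<open>(1, 1)\<close>.\<close>

lemma affine_equiv_sinh_imp_degenerate_zero:
  assumes eq: "affine_equiv (\<lambda>z. sinh (2 * snd z)) (\<lambda>z. sinh (2 * fst z)) w1 w2"
    and w: "holo2_on w1 UNIV" "holo2_on w2 UNIV"
  shows "\<exists>z. w1 z = 0 \<and> w2 z = 0 \<and> pdx w1 z = 0 \<and> pdy w2 z = 0 \<and> pdy w1 z + pdx w2 z = 0"
proof -
  obtain A B C D c d where k: "A * D - B * C \<noteq> 0" and
    im: "affine_match (\<lambda>z. sinh (2 * snd z)) (\<lambda>z. sinh (2 * fst z)) w1 w2 A B C D c d"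
    by (rule affine_equivE[OF eq]) (rule that)
  note i = im[unfolded affine_match_def Let_def fst_conv snd_conv, rule_format]
  \<comment> \<open>A half period: \<open>sinh (2 * (y0 + t)) = - sinh (2 * t)\<close>. The three
    lines are \<open>(t, y0)\<close>, \<open>(0, y0 + t)\<close> and \<open>(t, y0 + t)\<close>, and
    \<open>z\<close> is the image of their common point.\<close>
  define y0 :: complex where "y0 = \<i> * of_real pi / 2"
  define z where "z = (B * y0 + c, D * y0 + d)"
  have sh: "sinh (2 * y0) = 0" "sinh (2 * (y0 + t)) = - sinh (2 * t)" for t
  proof -
    have e: "exp (2 * y0) = -1" "exp (- (2 * y0)) = -1"
      by (simp_all add: y0_def exp_minus)
    then show "sinh (2 * y0) = 0" by (simp add: sinh_field_def)
    have e2: "exp (2 * (y0 + t)) = - exp (2 * t)" "exp (- (2 * (y0 + t))) = - exp (- (2 * t))"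
      using e by (simp_all add: exp_add exp_diff distrib_left exp_minus divide_inverse)
    show "sinh (2 * (y0 + t)) = - sinh (2 * t)" unfolding sinh_field_def e2 by (simp add: field_simps)
  qed
  \<comment> \<open>Once the factor \<open>sinh\<close> is removed, the function \<open>g\<close>
    vanishes along the line; its value and its derivative at 0 give the linear and the quadratic
    condition.\<close>
  have line: "a * w1 z + b * w2 z = 0 \<and>
      pdx w1 z * a\<^sup>2 + (pdy w1 z + pdx w2 z) * (a * b) + pdy w2 z * b\<^sup>2 = 0"
    if h: "\<And>t. sinh (2 * t) * (a * w1 (fst z + t * a, snd z + t * b) + b * w2 (fst z + t * a, snd z + t * b)) = 0" for a b
  proof -
    define g where "g t = a * w1 (fst z + t * a, snd z + t * b) + b * w2 (fst z + t * a, snd z + t * b)" for t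
    have X: "((\<lambda>t. fst z + t * a) has_field_derivative a) (at t)" "((\<lambda>t. snd z + t * b) has_field_derivative b) (at t)" for t
      by (auto intro!: derivative_eq_intros)
    have gd: "(g has_field_derivative
        a * (pdx w1 (fst z + t * a, snd z + t * b) * a + pdy w1 (fst z + t * a, snd z + t * b) * b) +
        b * (pdx w2 (fst z + t * a, snd z + t * b) * a + pdy w2 (fst z + t * a, snd z + t * b) * b)) (at t)" for t
      unfolding g_def[abs_def]
      by (intro DERIV_add DERIV_cmult has_field_derivative_along_curve[OF w(1) UNIV_I X]
            has_field_derivative_along_curve[OF w(2) UNIV_I X])
    then have "g holomorphic_on UNIV"
      by (auto simp: holomorphic_on_def field_differentiable_def)
    then have g0: "g t = 0" for t
      by (rule sinh_mult_entire_eq_0) (use h in \<open>simp add: g_def\<close>)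
    have "(g has_field_derivative 0) (at 0)" using g0 by (simp add: g0[abs_def])
    from DERIV_unique[OF gd[of 0] this] g0[of 0] show ?thesis
      by (simp add: g_def algebra_simps power2_eq_square)
  qed
  have "A * w1 z + C * w2 z = 0 \<and>
      pdx w1 z * A\<^sup>2 + (pdy w1 z + pdx w2 z) * (A * C) + pdy w2 z * C\<^sup>2 = 0"
  proof (rule line)
    fix t show "sinh (2 * t) * (A * w1 (fst z + t * A, snd z + t * C) + C * w2 (fst z + t * A, snd z + t * C)) = 0"
      using i[of y0 t] sh(1) by (simp add: z_def algebra_simps)
  qed
  moreover have "B * w1 z + D * w2 z = 0 \<and>
      pdx w1 z * B\<^sup>2 + (pdy w1 z + pdx w2 z) * (B * D) + pdy w2 z * D\<^sup>2 = 0"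
  proof (rule line)
    fix t
    have e: "(A * 0 + B * (y0 + t) + c, C * 0 + D * (y0 + t) + d) = (fst z + t * B, snd z + t * D)"
      by (simp add: z_def algebra_simps)
    have "sinh (2 * (0::complex)) = 0" by simp
    then show "sinh (2 * t) * (B * w1 (fst z + t * B, snd z + t * D) + D * w2 (fst z + t * B, snd z + t * D)) = 0"
      using i[of "y0 + t" 0] unfolding e sh(2) by algebra
  qed
  moreover have "(A + B) * w1 z + (C + D) * w2 z = 0 \<and>
      pdx w1 z * (A + B)\<^sup>2 + (pdy w1 z + pdx w2 z) * ((A + B) * (C + D)) + pdy w2 z * (C + D)\<^sup>2 = 0"
  proof (rule line)
    fix t
    have e: "(A * t + B * (y0 + t) + c, C * t + D * (y0 + t) + d) = (fst z + t * (A + B), snd z + t * (C + D))"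
      by (simp add: z_def algebra_simps)
    show "sinh (2 * t) * ((A + B) * w1 (fst z + t * (A + B), snd z + t * (C + D)) +
        (C + D) * w2 (fst z + t * (A + B), snd z + t * (C + D))) = 0"
      using i[of "y0 + t" t] unfolding e sh(2) by algebra
  qed
  ultimately have l: "A * w1 z + C * w2 z = 0" "B * w1 z + D * w2 z = 0"
    and q: "pdx w1 z * A\<^sup>2 + (pdy w1 z + pdx w2 z) * (A * C) + pdy w2 z * C\<^sup>2 = 0"
    "pdx w1 z * B\<^sup>2 + (pdy w1 z + pdx w2 z) * (B * D) + pdy w2 z * D\<^sup>2 = 0"
    "pdx w1 z * (A + B)\<^sup>2 + (pdy w1 z + pdx w2 z) * ((A + B) * (C + D)) + pdy w2 z * (C + D)\<^sup>2 = 0"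
    by auto
  have "(A * D - B * C) * w1 z = 0" "(A * D - B * C) * w2 z = 0"
    using l by algebra+
  \<comment> \<open>A quadratic form that vanishes on two basis vectors and on their sum is zero.
    \<open>pol\<close> is its polarization on \<open>(A, C)\<close> and \<open>(B, D)\<close>; the
    identities recover the coefficients in the standard basis from these values, multiplied by the
    squared determinant.\<close>
  moreover have "(A * D - B * C)\<^sup>2 * \<alpha> = 0 \<and> (A * D - B * C)\<^sup>2 * \<beta> = 0 \<and> (A * D - B * C)\<^sup>2 * \<gamma> = 0"
    if "\<alpha> * A\<^sup>2 + \<beta> * (A * C) + \<gamma> * C\<^sup>2 = 0" "\<alpha> * B\<^sup>2 + \<beta> * (B * D) + \<gamma> * D\<^sup>2 = 0"
      "\<alpha> * (A + B)\<^sup>2 + \<beta> * ((A + B) * (C + D)) + \<gamma> * (C + D)\<^sup>2 = 0" for \<alpha> \<beta> \<gamma>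
  proof -
    have pol: "2 * \<alpha> * A * B + \<beta> * (A * D + B * C) + 2 * \<gamma> * C * D = 0"
      using that by algebra
    have "(A * D - B * C)\<^sup>2 * \<alpha> = D\<^sup>2 * (\<alpha> * A\<^sup>2 + \<beta> * (A * C) + \<gamma> * C\<^sup>2)
       - C * D * (2 * \<alpha> * A * B + \<beta> * (A * D + B * C) + 2 * \<gamma> * C * D) + C\<^sup>2 * (\<alpha> * B\<^sup>2 + \<beta> * (B * D) + \<gamma> * D\<^sup>2)"
      by algebra
    moreover have "(A * D - B * C)\<^sup>2 * \<gamma> = B\<^sup>2 * (\<alpha> * A\<^sup>2 + \<beta> * (A * C) + \<gamma> * C\<^sup>2)
       - A * B * (2 * \<alpha> * A * B + \<beta> * (A * D + B * C) + 2 * \<gamma> * C * D) + A\<^sup>2 * (\<alpha> * B\<^sup>2 + \<beta> * (B * D) + \<gamma> * D\<^sup>2)"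
      by algebra
    moreover have "(A * D - B * C)\<^sup>2 * \<beta> = - 2 * B * D * (\<alpha> * A\<^sup>2 + \<beta> * (A * C) + \<gamma> * C\<^sup>2)
       + (A * D + B * C) * (2 * \<alpha> * A * B + \<beta> * (A * D + B * C) + 2 * \<gamma> * C * D) - 2 * A * C * (\<alpha> * B\<^sup>2 + \<beta> * (B * D) + \<gamma> * D\<^sup>2)"
      by algebra
    ultimately show ?thesis unfolding that(1,2) pol by simp
  qed
  note this[OF q]
  ultimately show ?thesis using k by (intro exI[of _ z]) auto
qed

subsection \<open>The space of abelian relations\<close>

interpretation tuples: vector_space scale_tuple
  by (rule vector_space_scale_tuple)

lemma fps_expansion_lincomb:
  assumes "f analytic_on {z}" "g analytic_on {z}"
  shows "fps_expansion (\<lambda>t. f t + c * g t) z = fps_expansion f z + fps_const c * fps_expansion g z"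
proof -
  have "(\<lambda>t. c * g t) analytic_on {z}" using assms(2) by (intro analytic_intros)
  then show ?thesis
    using assms
    by (simp add: fps_eq_iff fps_expansion_def higher_deriv_add_at higher_deriv_cmult' add_divide_distrib)
qed

lemma fps_expansion_zero: "fps_expansion (\<lambda>_. 0) z = 0"
  using fps_expansion_lincomb[of "\<lambda>_. 0" z "\<lambda>_. 0" "-1"] by (simp add: analytic_on_const)

lemma fps_expansion_eq_0_imp:
  assumes "f analytic_on {z}" "fps_expansion f z = 0"
  shows "\<forall>\<^sub>F t in nhds z. f t = 0"
proof -
  have "\<forall>\<^sub>F x in nhds 0. f (z + x) = 0"
    using analytic_at_imp_has_fps_expansion[OF assms(1)] assms(2) by (simp add: has_fps_expansion_0_iff)
  then show ?thesis by (simp add: nhds_to_0' eventually_filtermap add.commute)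
qed

lemma abelian_relation_lincomb:
  assumes "abelian_relation p us \<phi>" "abelian_relation p us \<psi>"
  shows "abelian_relation p us (\<lambda>j t. \<phi> j t + c * \<psi> j t)"
    "germ_tuple p us (\<lambda>j t. \<phi> j t + c * \<psi> j t) = germ_tuple p us \<phi> + scale_tuple c (germ_tuple p us \<psi>)"
proof -
  have an: "\<phi> j analytic_on {(us ! j) p}" "\<psi> j analytic_on {(us ! j) p}" if "j < length us" for j
    using assms that by (auto simp: abelian_relation_def)
  show "germ_tuple p us (\<lambda>j t. \<phi> j t + c * \<psi> j t) = germ_tuple p us \<phi> + scale_tuple c (germ_tuple p us \<psi>)"
    using an by (auto simp: fun_eq_iff germ_tuple_def scale_tuple_def fps_expansion_lincomb)
  have ev: "\<forall>\<^sub>F q in nhds p.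
      (\<Sum>j<length us. \<phi> j ((us ! j) q) * pdx (us ! j) q) = 0 \<and> (\<Sum>j<length us. \<phi> j ((us ! j) q) * pdy (us ! j) q) = 0"
     "\<forall>\<^sub>F q in nhds p.
      (\<Sum>j<length us. \<psi> j ((us ! j) q) * pdx (us ! j) q) = 0 \<and> (\<Sum>j<length us. \<psi> j ((us ! j) q) * pdy (us ! j) q) = 0"
    using assms by (auto simp: abelian_relation_def)
  have "\<forall>\<^sub>F q in nhds p.
        (\<Sum>j<length us. (\<phi> j ((us ! j) q) + c * \<psi> j ((us ! j) q)) * pdx (us ! j) q) = 0 \<and>
        (\<Sum>j<length us. (\<phi> j ((us ! j) q) + c * \<psi> j ((us ! j) q)) * pdy (us ! j) q) = 0"
    using ev
    by eventually_elim (simp add: distrib_right sum.distrib mult.assoc flip: sum_distrib_left)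
  moreover have "(\<lambda>t. \<phi> j t + c * \<psi> j t) analytic_on {(us ! j) p}" if "j < length us" for j
    using an[OF that] by (intro analytic_intros)
  ultimately show "abelian_relation p us (\<lambda>j t. \<phi> j t + c * \<psi> j t)"
    by (simp add: abelian_relation_def)
qed

lemma abelian_relation_zero: "abelian_relation p us (\<lambda>_ _. 0)"
  "germ_tuple p us (\<lambda>_ _. 0) = 0"
  by (auto simp: abelian_relation_def germ_tuple_def fps_expansion_zero analytic_on_const fun_eq_iff)

lemma abelian_relation_sum:
  assumes "\<And>i. i < (n::nat) \<Longrightarrow> abelian_relation p us (r i)"
  shows "abelian_relation p us (\<lambda>j t. \<Sum>i<n. k i * r i j t) \<and>
    germ_tuple p us (\<lambda>j t. \<Sum>i<n. k i * r i j t) = (\<Sum>i<n. scale_tuple (k i) (germ_tuple p us (r i)))"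
  using assms
proof (induction n)
  case 0
  then show ?case by (simp add: abelian_relation_zero)
next
  case (Suc n)
  then show ?case
    using abelian_relation_lincomb[of p us "\<lambda>j t. \<Sum>i<n. k i * r i j t" "r n" "k n"] by simp
qed

definition relations :: "plane \<Rightarrow> (plane \<Rightarrow> complex) list \<Rightarrow> (nat \<Rightarrow> complex fps) set" where
  "relations p us = germ_tuple p us ` {\<phi>. abelian_relation p us \<phi>}"

lemma relations_lincomb: "a \<in> relations p us \<Longrightarrow> b \<in> relations p us \<Longrightarrow> a + scale_tuple c b \<in> relations p us"
  unfolding relations_def using abelian_relation_lincomb
  by (smt (verit, ccfv_threshold) imageE image_eqI mem_Collect_eq)

text \<open>Gaussian elimination: if finitely many coefficient functionals have only 0 as common
  kernel, their number bounds the dimension. Each functional costs at most one generator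
  \<open>e\<close>, used to make that coefficient vanish.\<close>

lemma tuple_filtration_bound:
  assumes "\<And>v w c. v \<in> V \<Longrightarrow> w \<in> V \<Longrightarrow> v + scale_tuple c w \<in> V"
    and "\<And>v. v \<in> V \<Longrightarrow> (\<forall>(j, n)\<in>set L. fps_nth (v j) n = 0) \<Longrightarrow> v = 0"
  shows "\<exists>B. finite B \<and> card B \<le> length L \<and> V \<subseteq> tuples.span B"
  using assms
proof (induction L arbitrary: V)
  case Nil
  have "v = 0" if "v \<in> V" for v
    by (rule Nil(2)[OF that]) simp
  then have "V \<subseteq> tuples.span {}" unfolding tuples.span_empty by blast
  then show ?case by (intro exI[of _ "{}"]) simp
next
  case (Cons l L)
  obtain j n where l: "l = (j, n)" by force
  let ?W = "{v \<in> V. fps_nth (v j) n = 0}"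
  have "\<exists>B. finite B \<and> card B \<le> length L \<and> ?W \<subseteq> tuples.span B"
  proof (rule Cons.IH)
    fix v w c assume *: "v \<in> ?W" "w \<in> ?W"
    then have "v + scale_tuple c w \<in> V" by (intro Cons.prems(1)) simp_all
    moreover have "fps_nth ((v + scale_tuple c w) j) n = 0" using * by (simp add: scale_tuple_def)
    ultimately show "v + scale_tuple c w \<in> ?W" by blast
  next
    fix v assume "v \<in> ?W" "\<forall>(j, n)\<in>set L. fps_nth (v j) n = 0"
    then show "v = 0" by (intro Cons.prems(2)) (simp_all add: l)
  qed
  then obtain B where B: "finite B" "card B \<le> length L" "?W \<subseteq> tuples.span B" by blast
  show ?case
  proof (cases "\<exists>e\<in>V. fps_nth (e j) n \<noteq> 0")
    case False
    with B show ?thesis by (intro exI[of _ B]) auto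
  next
    case True
    then obtain e where e: "e \<in> V" "fps_nth (e j) n \<noteq> 0" by blast
    have "v \<in> tuples.span (insert e B)" if v: "v \<in> V" for v
    proof -
      define c where "c = fps_nth (v j) n / fps_nth (e j) n"
      have "v + scale_tuple (- c) e \<in> ?W"
      proof -
        have "v + scale_tuple (- c) e \<in> V" by (rule Cons.prems(1)[OF v e(1)])
        moreover have "fps_nth ((v + scale_tuple (- c) e) j) n = 0"
          using e(2) by (simp add: scale_tuple_def c_def)
        ultimately show ?thesis by blast
      qed
      then have "v + scale_tuple (- c) e \<in> tuples.span (insert e B)"
        using B(3) tuples.span_mono[of B "insert e B"] by blast
      moreover have "scale_tuple c e \<in> tuples.span (insert e B)"
        by (intro tuples.span_scale tuples.span_base) simp
      ultimately have "v + scale_tuple (- c) e + scale_tuple c e \<in> tuples.span (insert e B)"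
        by (rule tuples.span_add)
      then show ?thesis by (simp add: add.assoc flip: tuples.scale_left_distrib)
    qed
    moreover have "card (insert e B) \<le> length (l # L)"
      using B(1,2) card_insert_le_m1[of "Suc (length L)" B e] by simp
    ultimately show ?thesis using B(1) by (intro exI[of _ "insert e B"]) auto
  qed
qed

text \<open>By the exchange argument, \<open>n\<close> independent elements inside a span of at most
  \<open>n\<close> generators form a basis. Independence is assumed for an indexed family, so the
  distinctness of the \<open>v i\<close> has to be derived from it.\<close>

lemma tuples_dim_eq:
  assumes B: "finite B" "card B \<le> n" "V \<subseteq> tuples.span B"
    and v: "\<And>i. i < n \<Longrightarrow> v i \<in> V"
    and ind: "\<And>k. (\<Sum>i<n. scale_tuple (k i) (v i)) = 0 \<Longrightarrow> \<forall>i<n. k i = 0"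
  shows "tuples.dim V = n"
proof -
  have inj: "inj_on v {..<n}"
  proof (rule inj_onI, rule ccontr)
    fix a b assume ab: "a \<in> {..<n}" "b \<in> {..<n}" "v a = v b" "a \<noteq> b"
    let ?k = "\<lambda>i. (if i = a then 1 else 0) - (if i = b then 1 else 0) :: complex"
    have "scale_tuple (?k i) (v i) = (if i = a then v i else 0) - (if i = b then v i else 0)" for i
      by (simp add: tuples.scale_left_diff_distrib tuples.scale_minus_left)
    then have "(\<Sum>i<n. scale_tuple (?k i) (v i)) =
       (\<Sum>i<n. if i = a then v i else 0) - (\<Sum>i<n. if i = b then v i else 0)"
      by (simp only: sum_subtractf)
    also have "\<dots> = v a - v b" using ab(1,2) by (simp only: sum.delta finite_lessThan if_True)
    also have "\<dots> = 0" unfolding ab(3) by (rule diff_self)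
    finally have "?k a = 0" using ind[of ?k] ab(1) by blast
    then show False using ab(4) by simp
  qed
  have indep: "tuples.independent (v ` {..<n})"
  proof (rule tuples.independent_if_scalars_zero)
    fix f x assume "(\<Sum>x\<in>v ` {..<n}. scale_tuple (f x) x) = 0" "x \<in> v ` {..<n}"
    then show "f x = 0"
      using ind[of "\<lambda>i. f (v i)"] by (auto simp: sum.reindex[OF inj])
  qed auto
  have card: "card (v ` {..<n}) = n" using inj by (simp add: card_image)
  have "V \<subseteq> tuples.span (v ` {..<n})"
  proof (rule ccontr)
    assume "\<not> ?thesis"
    then obtain w where w: "w \<in> V" "w \<notin> tuples.span (v ` {..<n})" by blast
    have "tuples.independent (insert w (v ` {..<n}))"
      by (rule tuples.independent_insertI[OF w(2) indep])
    moreover have "insert w (v ` {..<n}) \<subseteq> tuples.span B"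
    proof (rule insert_subsetI)
      show "w \<in> tuples.span B" by (rule subsetD[OF B(3) w(1)])
      show "v ` {..<n} \<subseteq> tuples.span B"
        by (rule image_subsetI) (rule subsetD[OF B(3) v], simp)
    qed
    ultimately have "card (insert w (v ` {..<n})) \<le> card B"
      by (rule conjunct2[OF tuples.independent_span_bound[OF B(1)]])
    moreover have "w \<notin> v ` {..<n}"
      using w(2) tuples.span_base[of w "v ` {..<n}"] by (rule contrapos_nn)
    then have "card (insert w (v ` {..<n})) = Suc n" by (simp add: card)
    ultimately show False using B(2) by linarith
  qed
  then show ?thesis
    using tuples.basis_card_eq_dim[OF _ _ indep] v card by (metis image_subsetI lessThan_iff)
qed

subsection \<open>The rank of a 5-web is at most 6\<close>

text \<open>\<open>\<psi>\<close> is the quotient with its removable singularity filled in. The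
  factorisation also holds at \<open>t0\<close>, because for \<open>k > 0\<close> the coefficient of
  index 0, which is \<open>\<phi> t0\<close>, vanishes.\<close>

lemma analytic_leading_factor:
  assumes an: "\<phi> analytic_on {t0}" and z: "\<And>m. m < k \<Longrightarrow> fps_nth (fps_expansion \<phi> t0) m = 0"
  obtains \<psi> where "isCont \<psi> t0" "\<psi> t0 = fps_nth (fps_expansion \<phi> t0) k" "\<And>t. \<phi> t = (t - t0) ^ k * \<psi> t"
proof -
  let ?F = "fps_expansion \<phi> t0"
  define \<psi> where "\<psi> t = (if t = t0 then fps_nth ?F k else \<phi> t / (t - t0) ^ k)" for t
  have nth0: "fps_nth ?F 0 = \<phi> t0" by (simp add: fps_expansion_def)
  have eq: "\<phi> t = (t - t0) ^ k * \<psi> t" for t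
    using z[of 0] nth0 by (cases "k = 0") (auto simp: \<psi>_def)
  have "isCont \<psi> t0"
  proof (cases "?F = 0")
    case True
    have "\<forall>\<^sub>F t in nhds t0. \<psi> t = 0"
      using fps_expansion_eq_0_imp[OF an True] by eventually_elim (simp add: \<psi>_def True)
    then show ?thesis by (subst isCont_cong) auto
  next
    case False
    have "(\<lambda>x. if x = 0 then fps_nth ?F k else \<phi> (t0 + x) / x ^ k) has_fps_expansion fps_shift k ?F"
      by (rule has_fps_expansion_shift[OF analytic_at_imp_has_fps_expansion[OF an]])
         (use subdegree_geI[OF False z] in auto)
    from has_fps_expansion_imp_continuous[OF this, of UNIV]
    have "isCont (\<lambda>x. if x = 0 then fps_nth ?F k else \<phi> (t0 + x) / x ^ k) (t0 - t0)" by simp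
    then have "isCont (\<lambda>t. if t - t0 = 0 then fps_nth ?F k else \<phi> (t0 + (t - t0)) / (t - t0) ^ k) t0"
      by (rule isCont_o2[rotated]) (intro continuous_intros)
    moreover have "t0 + (t - t0) = t" for t by simp
    ultimately show ?thesis by (simp only: \<psi>_def[abs_def] right_minus_eq)
  qed
  then show ?thesis by (rule that[OF _ _ eq]) (simp add: \<psi>_def)
qed

text \<open>Along the line through \<open>p\<close> the increment of \<open>v\<close> is
  \<open>\<epsilon>\<close> times \<open>dv (a, b)\<close> to first order, so \<open>\<phi>\<close>
  contributes a leading term of order \<open>\<epsilon> ^ k\<close>; the outer differential adds the
  last factor of the power \<open>Suc k\<close>.\<close>

lemma relation_term_limit:
  assumes v: "holo2_on v U" "p \<in> U" and an: "\<phi> analytic_on {v p}"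
    and z: "\<And>m. m < k \<Longrightarrow> fps_nth (fps_expansion \<phi> (v p)) m = 0"
  shows "((\<lambda>\<epsilon>. \<phi> (v (fst p + \<epsilon> * a, snd p + \<epsilon> * b)) *
       (pdx v (fst p + \<epsilon> * a, snd p + \<epsilon> * b) * a + pdy v (fst p + \<epsilon> * a, snd p + \<epsilon> * b) * b) / \<epsilon> ^ k)
     \<longlongrightarrow> fps_nth (fps_expansion \<phi> (v p)) k * (pdx v p * a + pdy v p * b) ^ Suc k) (at 0)"
proof -
  obtain \<psi> where \<psi>: "isCont \<psi> (v p)" "\<psi> (v p) = fps_nth (fps_expansion \<phi> (v p)) k"
    "\<And>t. \<phi> t = (t - v p) ^ k * \<psi> t"
    using analytic_leading_factor[OF an z] by blast
  define q where "q \<epsilon> = (fst p + \<epsilon> * a, snd p + \<epsilon> * b)" for \<epsilon>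
  have q0: "q 0 = p" by (simp add: q_def)
  have qc: "(q \<longlongrightarrow> p) (at 0)"
    unfolding q_def[abs_def] by (rule tendsto_eq_intros refl)+ simp
  have opU: "open U" using v by (rule_tac holo2_on_open)
  have cont: "((\<lambda>\<epsilon>. f (q \<epsilon>)) \<longlongrightarrow> f p) (at 0)" if "holo2_on f U" for f
    using holo2_on_continuous_on[OF that] opU v(2) qc
    by (auto simp: continuous_on_eq_continuous_at intro: isCont_tendsto_compose)
  have d: "((\<lambda>\<epsilon>. v (q \<epsilon>)) has_field_derivative pdx v p * a + pdy v p * b) (at 0)"
  proof -
    have "((\<lambda>\<epsilon>. fst p + \<epsilon> * a) has_field_derivative a) (at 0)"
      "((\<lambda>\<epsilon>. snd p + \<epsilon> * b) has_field_derivative b) (at 0)"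
      by (auto intro!: derivative_eq_intros)
    from has_field_derivative_along_curve[OF v(1) _ this] v(2) show ?thesis
      by (simp add: q_def)
  qed
  have l1: "((\<lambda>\<epsilon>. (v (q \<epsilon>) - v p) / \<epsilon>) \<longlongrightarrow> pdx v p * a + pdy v p * b) (at 0)"
    using d by (simp add: has_field_derivative_iff q0)
  have l2: "((\<lambda>\<epsilon>. \<psi> (v (q \<epsilon>))) \<longlongrightarrow> \<psi> (v p)) (at 0)"
    by (rule isCont_tendsto_compose[OF \<psi>(1) cont[OF v(1)]])
  have "((\<lambda>\<epsilon>. ((v (q \<epsilon>) - v p) / \<epsilon>) ^ k * \<psi> (v (q \<epsilon>)) * (pdx v (q \<epsilon>) * a + pdy v (q \<epsilon>) * b))
    \<longlongrightarrow> (pdx v p * a + pdy v p * b) ^ k * \<psi> (v p) * (pdx v p * a + pdy v p * b)) (at 0)"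
    by (intro tendsto_intros l1 l2 cont holo2_on_pdx holo2_on_pdy v(1))
  then show ?thesis
    unfolding q_def[symmetric] \<psi>(2) \<psi>(3)[of "v (q _)"]
    by (simp add: power_divide mult_ac)
qed

text \<open>The lowest-order part of an abelian relation is a linear relation between powers of the
  linear forms \<open>du\<close> at \<open>p\<close>. This makes the bound on the rank a matter of
  algebra, degree by degree.\<close>

lemma leading_terms_relation:
  assumes rel: "abelian_relation p us \<phi>" and us: "\<And>u. u \<in> set us \<Longrightarrow> holo2_at u p"
    and z: "\<And>m j. m < k \<Longrightarrow> j < length us \<Longrightarrow> fps_nth (germ_tuple p us \<phi> j) m = 0"
  shows "(\<Sum>j<length us. fps_nth (germ_tuple p us \<phi> j) k * (pdx (us ! j) p * a + pdy (us ! j) p * b) ^ Suc k) = 0"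
proof -
  let ?q = "\<lambda>\<epsilon>. (fst p + \<epsilon> * a, snd p + \<epsilon> * b)"
  let ?S = "\<lambda>\<epsilon>. \<Sum>j<length us. \<phi> j ((us ! j) (?q \<epsilon>)) * (pdx (us ! j) (?q \<epsilon>) * a + pdy (us ! j) (?q \<epsilon>) * b) / \<epsilon> ^ k"
  have "(?S \<longlongrightarrow> (\<Sum>j<length us. fps_nth (germ_tuple p us \<phi> j) k * (pdx (us ! j) p * a + pdy (us ! j) p * b) ^ Suc k)) (at 0)"
  proof (rule tendsto_sum)
    fix j assume "j \<in> {..<length us}"
    then have j: "j < length us" by simp
    then obtain U where "p \<in> U" "holo2_on (us ! j) U" using us[of "us ! j"] by (auto simp: holo2_at_def)
    then show "((\<lambda>\<epsilon>. \<phi> j ((us ! j) (?q \<epsilon>)) * (pdx (us ! j) (?q \<epsilon>) * a + pdy (us ! j) (?q \<epsilon>) * b) / \<epsilon> ^ k) \<longlongrightarrow>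
        fps_nth (germ_tuple p us \<phi> j) k * (pdx (us ! j) p * a + pdy (us ! j) p * b) ^ Suc k) (at 0)"
      using relation_term_limit[of "us ! j" U p "\<phi> j" k a b] rel j z[OF _ j]
      by (simp add: abelian_relation_def germ_tuple_def)
  qed
  moreover have "(?S \<longlongrightarrow> 0) (at 0)"
  proof (rule tendsto_eventually)
    have "(?q \<longlongrightarrow> p) (at 0)" by (rule tendsto_eq_intros refl)+ simp
    moreover have "\<forall>\<^sub>F q in nhds p.
        (\<Sum>j<length us. \<phi> j ((us ! j) q) * pdx (us ! j) q) = 0 \<and>
        (\<Sum>j<length us. \<phi> j ((us ! j) q) * pdy (us ! j) q) = 0"
      using rel by (simp add: abelian_relation_def)
    ultimately have ev: "\<forall>\<^sub>F \<epsilon> in at 0.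
        (\<Sum>j<length us. \<phi> j ((us ! j) (?q \<epsilon>)) * pdx (us ! j) (?q \<epsilon>)) = 0 \<and>
        (\<Sum>j<length us. \<phi> j ((us ! j) (?q \<epsilon>)) * pdy (us ! j) (?q \<epsilon>)) = 0"
      by (rule eventually_compose_filterlim[rotated])
    from ev show "\<forall>\<^sub>F \<epsilon> in at 0. ?S \<epsilon> = 0"
    proof eventually_elim
      case (elim \<epsilon>)
      have "?S \<epsilon> = ((\<Sum>j<length us. \<phi> j ((us ! j) (?q \<epsilon>)) * pdx (us ! j) (?q \<epsilon>)) * a +
        (\<Sum>j<length us. \<phi> j ((us ! j) (?q \<epsilon>)) * pdy (us ! j) (?q \<epsilon>)) * b) / \<epsilon> ^ k"
        by (simp add: sum_distrib_right distrib_left mult.assoc flip: sum_divide_distrib sum.distrib)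
      with elim show ?case by simp
    qed
  qed
  ultimately show ?thesis using tendsto_unique[OF at_neq_bot] by blast
qed

text \<open>The coefficient of \<open>b ^ i\<close>, divided by the binomial coefficient. The range
  \<open>0 < i < n\<close> avoids \<open>c0\<close> and \<open>c1\<close>, whose terms enter only at
  \<open>i = 0\<close> and \<open>i = n\<close>.\<close>

lemma power_sum_coefficients:
  fixes c0 c1 c2 c3 c4 \<xi> \<eta> :: complex
  assumes id: "\<And>b. c0 + c1 * b ^ n + c2 * (1 + b) ^ n + c3 * (1 - b) ^ n + c4 * (\<xi> + \<eta> * b) ^ n = 0"
    and i: "0 < i" "i < n"
  shows "c2 + (- 1) ^ i * c3 + c4 * \<xi> ^ (n - i) * \<eta> ^ i = 0"
proof -
  define P where "P = [:c0:] + monom c1 n + smult c2 ([:1, 1:] ^ n) + smult c3 ([:1, - 1:] ^ n) + smult c4 ([:\<xi>, \<eta>:] ^ n)"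
  have "poly P b = 0" for b
    using id[of b] by (simp add: P_def poly_monom algebra_simps)
  then have "P = 0" using poly_all_0_iff_0 by blast
  then have "coeff P i = 0" by simp
  then have "of_nat (n choose i) * (c2 + (- 1) ^ i * c3 + c4 * \<xi> ^ (n - i) * \<eta> ^ i) = 0"
    using i by (simp add: P_def coeff_linear_poly_power algebra_simps coeff_pCons split: nat.splits)
  moreover have "of_nat (n choose i) \<noteq> (0::complex)" using i by simp
  ultimately show ?thesis by (metis mult_eq_0_iff)
qed

lemma sum_lessThan_5: "(\<Sum>j<5. f j) = f 0 + f 1 + f 2 + f 3 + f (4::nat)"
  for f :: "nat \<Rightarrow> 'a::comm_monoid_add"
  by (simp add: eval_nat_numeral)

lemma web5_nth: "web5 u ! 0 = (\<lambda>(x, y). x)" "web5 u ! 1 = (\<lambda>(x, y). y)" "web5 u ! 2 = (\<lambda>(x, y). x + y)"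
  "web5 u ! 3 = (\<lambda>(x, y). x - y)" "web5 u ! 4 = u" "length (web5 u) = 5"
  by (simp_all add: web5_def eval_nat_numeral)

lemma less_5_cases: "(j::nat) < 5 \<longleftrightarrow> j = 0 \<or> j = 1 \<or> j = 2 \<or> j = 3 \<or> j = 4"
  by auto

text \<open>The six prescribed coefficients are distributed by degree: three for
  \<open>n = 0\<close>, two for \<open>n = 1\<close>, one for \<open>n = 2\<close>, as many as there
  are linear relations between the powers \<open>Suc n\<close> of the five forms. From degree 3 on,
  (T) leaves no relation.\<close>

lemma relation_web5_eq_0:
  assumes u: "holo2_at u p" "cond_T u p" and rel: "abelian_relation p (web5 u) \<phi>"
    and v: "v = germ_tuple p (web5 u) \<phi>"
    and z: "\<forall>(j, n)\<in>set [(4, 0), (4, 1), (4, 2), (3, 0), (3, 1), (2, 0)]. fps_nth (v j) n = 0"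
  shows "v = 0"
proof -
  define \<xi> where "\<xi> = pdx u p" define \<eta> where "\<eta> = pdy u p"
  have T: "\<xi> \<noteq> 0" "\<eta> \<noteq> 0" "\<xi>\<^sup>2 - \<eta>\<^sup>2 \<noteq> 0" using cond_T_D[OF u(2)] by (auto simp: \<xi>_def \<eta>_def)
  have hol: "holo2_at w p" if "w \<in> set (web5 u)" for w
    using submersion_at_web5[OF u that] by (simp add: submersion_at_def)
  have "\<forall>j<5. fps_nth (v j) k = 0" for k
  proof (induction k rule: less_induct)
    case (less k)
    define c where "c j = fps_nth (v j) k" for j
    have id: "c 0 + c 1 * b ^ Suc k + c 2 * (1 + b) ^ Suc k + c 3 * (1 - b) ^ Suc k + c 4 * (\<xi> + \<eta> * b) ^ Suc k = 0" for b
      using leading_terms_relation[OF rel hol, of k 1 b] less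
      by (simp add: web5_nth[simplified] sum_lessThan_5 v c_def \<xi>_def \<eta>_def del: power_Suc)
    have E: "c 2 + (- 1) ^ i * c 3 + c 4 * \<xi> ^ (Suc k - i) * \<eta> ^ i = 0" if "0 < i" "i < Suc k" for i
      using power_sum_coefficients[OF id that] .
    have "c 2 = 0 \<and> c 3 = 0 \<and> c 4 = 0"
    proof -
      consider "k = 0" | "k = 1" | "k = 2" | "k \<ge> 3" by linarith
      then show ?thesis
      proof cases
        case 1
        then show ?thesis using z by (simp add: c_def)
      next
        case 2
        then show ?thesis using z E[of 1] by (simp add: c_def)
      next
        case 3
        then have "c 4 = 0" using z by (simp add: c_def)
        moreover have "c 2 - c 3 = 0" "c 2 + c 3 = 0" using E[of 1] E[of 2] 3 calculation by simp_all
        ultimately show ?thesis by (auto simp: add_eq_0_iff)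
      next
        case 4
        then obtain m where m: "k = m + 3" by (metis add.commute le_Suc_ex)
        have e: "c 2 - c 3 + c 4 * \<xi> ^ (m + 3) * \<eta> = 0" "c 2 + c 3 + c 4 * \<xi> ^ (m + 2) * \<eta>\<^sup>2 = 0"
          "c 2 - c 3 + c 4 * \<xi> ^ (m + 1) * \<eta> ^ 3 = 0"
          using E[of 1] E[of 2] E[of 3] by (simp_all add: m numeral_eq_Suc)
        \<comment> \<open>The equations for \<open>i = 1\<close> and \<open>i = 3\<close> contain
          the same combination \<open>c 2 - c 3\<close>; their difference is \<open>c 4\<close>
          times a factor that is nonzero by (T). The index \<open>i = 3\<close> is available only
          for \<open>k \<ge> 3\<close>.\<close>
        have "c 4 * (\<xi> ^ (m + 1) * \<eta> * (\<xi>\<^sup>2 - \<eta>\<^sup>2)) =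
            (c 2 - c 3 + c 4 * \<xi> ^ (m + 3) * \<eta>) - (c 2 - c 3 + c 4 * \<xi> ^ (m + 1) * \<eta> ^ 3)"
          by (simp add: algebra_simps power_add power2_eq_square power3_eq_cube)
        also have "\<dots> = 0" unfolding e(1) e(3) by simp
        finally have "c 4 = 0" using T by simp
        moreover have "c 2 = c 3" "c 2 + c 3 = 0" using e calculation by simp_all
        ultimately show ?thesis by simp
      qed
    qed
    moreover have "c 0 = 0" using id[of 0] calculation by simp
    moreover have "c 1 = 0" using id[of 1] calculation by simp
    ultimately show ?case by (simp add: less_5_cases c_def)
  qed
  then have "v j = 0" if "j < 5" for j using that by (simp add: fps_eq_iff)
  moreover have "v j = 0" if "\<not> j < 5" for j using that by (simp add: v germ_tuple_def web5_nth)
  ultimately show ?thesis by (auto simp: fun_eq_iff)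
qed

section \<open>Exhibiting six independent relations\<close>

lemma linear_eq_0_near:
  assumes "\<forall>\<^sub>F t in nhds z. c + d * t = (0::complex)"
  shows "c = 0" "d = 0"
proof -
  have "deriv (\<lambda>t. c + d * t) z = deriv (\<lambda>_. 0) z"
    by (rule deriv_cong_ev[OF assms refl])
  moreover have "deriv (\<lambda>t. c + d * t) z = d"
    by (rule DERIV_imp_deriv) (auto intro!: derivative_eq_intros)
  ultimately show "d = 0" by simp
  with eventually_nhds_x_imp_x[OF assms] show "c = 0" by simp
qed

lemma abelian_relation_web5I:
  assumes "\<phi>0 analytic_on {fst p}" "\<phi>1 analytic_on {snd p}" "\<phi>2 analytic_on {fst p + snd p}"
    "\<phi>3 analytic_on {fst p - snd p}" "\<phi>4 analytic_on {u p}"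
    and "\<forall>\<^sub>F z in nhds p. \<phi>0 (fst z) + \<phi>2 (fst z + snd z) + \<phi>3 (fst z - snd z) + \<phi>4 (u z) * pdx u z = 0 \<and>
       \<phi>1 (snd z) + \<phi>2 (fst z + snd z) - \<phi>3 (fst z - snd z) + \<phi>4 (u z) * pdy u z = 0"
  shows "abelian_relation p (web5 u) (\<lambda>j. [\<phi>0, \<phi>1, \<phi>2, \<phi>3, \<phi>4] ! j)"
proof -
  have n: "[\<phi>0, \<phi>1, \<phi>2, \<phi>3, \<phi>4] ! 0 = \<phi>0" "[\<phi>0, \<phi>1, \<phi>2, \<phi>3, \<phi>4] ! 1 = \<phi>1" "[\<phi>0, \<phi>1, \<phi>2, \<phi>3, \<phi>4] ! 2 = \<phi>2"
    "[\<phi>0, \<phi>1, \<phi>2, \<phi>3, \<phi>4] ! 3 = \<phi>3" "[\<phi>0, \<phi>1, \<phi>2, \<phi>3, \<phi>4] ! 4 = \<phi>4"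
    by (simp_all add: eval_nat_numeral)
  show ?thesis
    unfolding abelian_relation_def web5_nth sum_lessThan_5 n
  proof
    show "\<forall>j<5. ([\<phi>0, \<phi>1, \<phi>2, \<phi>3, \<phi>4] ! j) analytic_on {(web5 u ! j) p}"
      unfolding less_5_cases using assms(1-5)
      by (auto simp only: n web5_nth case_prod_beta)
    show "\<forall>\<^sub>F q in nhds p.
       \<phi>0 ((\<lambda>(x, y). x) q) * pdx (\<lambda>(x, y). x) q + \<phi>1 ((\<lambda>(x, y). y) q) * pdx (\<lambda>(x, y). y) q +
       \<phi>2 ((\<lambda>(x, y). x + y) q) * pdx (\<lambda>(x, y). x + y) q + \<phi>3 ((\<lambda>(x, y). x - y) q) * pdx (\<lambda>(x, y). x - y) q +
       \<phi>4 (u q) * pdx u q = 0 \<and>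
       \<phi>0 ((\<lambda>(x, y). x) q) * pdy (\<lambda>(x, y). x) q + \<phi>1 ((\<lambda>(x, y). y) q) * pdy (\<lambda>(x, y). y) q +
       \<phi>2 ((\<lambda>(x, y). x + y) q) * pdy (\<lambda>(x, y). x + y) q + \<phi>3 ((\<lambda>(x, y). x - y) q) * pdy (\<lambda>(x, y). x - y) q +
       \<phi>4 (u q) * pdy u q = 0"
      using assms(6) by eventually_elim (simp add: case_prod_beta)
  qed
qed

text \<open>The relations of the 4-web have fifth component zero, so the independence of the three
  others can be tested on that component alone; this is \<open>ind\<close>.\<close>

theorem maximal_rank_web5:
  assumes u: "holo2_at u p" "cond_T u p"
    and a: "abelian_relation p (web5 u) a1" "abelian_relation p (web5 u) a2" "abelian_relation p (web5 u) a3"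
    and ind: "\<And>k1 k2 k3. \<forall>\<^sub>F t in nhds (u p). k1 * a1 4 t + k2 * a2 4 t + k3 * a3 4 t = 0 \<Longrightarrow>
       k1 = 0 \<and> k2 = 0 \<and> k3 = 0"
  shows "maximal_rank p (web5 u)"
proof -
  \<comment> \<open>The first three relations are the differentials of the trivial identities for
    \<open>x + y\<close> and \<open>x - y\<close>, and half the differential of
    \<open>2 x^2 + 2 y^2 = (x + y)^2 + (x - y)^2\<close>.\<close>
  define r where "r i = [\<lambda>j. [\<lambda>_. 1, \<lambda>_. 1, \<lambda>_. - 1, \<lambda>_. 0, \<lambda>_. 0] ! j,
     \<lambda>j. [\<lambda>_. 1, \<lambda>_. - 1, \<lambda>_. 0, \<lambda>_. - 1, \<lambda>_. 0] ! j,
     \<lambda>j. [\<lambda>t. 2 * t, \<lambda>t. 2 * t, \<lambda>t. - t, \<lambda>t. - t, \<lambda>_. 0] ! j, a1, a2, a3] ! i" for i :: nat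
  have r: "r 0 = (\<lambda>j. [\<lambda>_. 1, \<lambda>_. 1, \<lambda>_. - 1, \<lambda>_. 0, \<lambda>_. 0] ! j)"
    "r 1 = (\<lambda>j. [\<lambda>_. 1, \<lambda>_. - 1, \<lambda>_. 0, \<lambda>_. - 1, \<lambda>_. 0] ! j)"
    "r 2 = (\<lambda>j. [\<lambda>t. 2 * t, \<lambda>t. 2 * t, \<lambda>t. - t, \<lambda>t. - t, \<lambda>_. 0] ! j)"
    "r 3 = a1" "r 4 = a2" "r 5 = a3"
    by (simp_all add: r_def eval_nat_numeral)
  have six: "i < 6 \<longleftrightarrow> i = 0 \<or> i = 1 \<or> i = 2 \<or> i = 3 \<or> i = 4 \<or> i = 5" for i :: nat by auto
  have sum6: "(\<Sum>i<6. f i) = f 0 + f 1 + f 2 + f 3 + f 4 + f (5::nat)" for f :: "nat \<Rightarrow> complex"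
    by (simp add: eval_nat_numeral)
  have rel: "abelian_relation p (web5 u) (r i)" if "i < 6" for i
    using that unfolding six
  proof (elim disjE)
    assume i: "i = 0" show ?thesis
      unfolding i r by (rule abelian_relation_web5I) (auto intro!: analytic_intros always_eventually)
  next
    assume i: "i = 1" show ?thesis
      unfolding i r by (rule abelian_relation_web5I) (auto intro!: analytic_intros always_eventually)
  next
    assume i: "i = 2" show ?thesis
      unfolding i r by (rule abelian_relation_web5I) (auto intro!: analytic_intros always_eventually)
  qed (use a r in simp_all)
  let ?V = "relations p (web5 u)"
  have "\<exists>B. finite B \<and> card B \<le> length [(4::nat, 0::nat), (4, 1), (4, 2), (3, 0), (3, 1), (2, 0)] \<and> ?V \<subseteq> tuples.span B"
  proof (rule tuple_filtration_bound[OF relations_lincomb])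
    fix v assume "v \<in> ?V" and z: "\<forall>(j, n)\<in>set [(4, 0), (4, 1), (4, 2), (3, 0), (3, 1), (2, 0)]. fps_nth (v j) n = 0"
    then obtain \<phi> where "abelian_relation p (web5 u) \<phi>" "v = germ_tuple p (web5 u) \<phi>"
      unfolding relations_def by blast
    from relation_web5_eq_0[OF u this z] show "v = 0" .
  qed
  then obtain B where B: "finite B" "card B \<le> 6" "?V \<subseteq> tuples.span B" by auto
  have "tuples.dim ?V = 6"
  proof (rule tuples_dim_eq[OF B])
    show "germ_tuple p (web5 u) (r i) \<in> ?V" if "i < 6" for i
      using rel[OF that] unfolding relations_def by blast
    fix k assume z: "(\<Sum>i<6. scale_tuple (k i) (germ_tuple p (web5 u) (r i))) = 0"
    define \<phi> where "\<phi> j t = (\<Sum>i<6. k i * r i j t)" for j t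
    have \<phi>: "abelian_relation p (web5 u) \<phi>" "germ_tuple p (web5 u) \<phi> = 0"
      using abelian_relation_sum[where n = 6 and k = k, OF rel] z by (simp_all add: \<phi>_def[abs_def])
    have ev: "\<forall>\<^sub>F t in nhds ((web5 u ! j) p). \<phi> j t = 0" if j: "j < 5" for j
    proof (rule fps_expansion_eq_0_imp)
      show "\<phi> j analytic_on {(web5 u ! j) p}" using \<phi>(1) j by (simp add: abelian_relation_def web5_nth)
      show "fps_expansion (\<phi> j) ((web5 u ! j) p) = 0"
        using fun_cong[OF \<phi>(2), of j] j by (simp add: germ_tuple_def web5_nth)
    qed
    have p4: "\<phi> 4 t = k 3 * a1 4 t + k 4 * a2 4 t + k 5 * a3 4 t" for t
      unfolding \<phi>_def sum6 r by (simp add: eval_nat_numeral)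
    \<comment> \<open>After the fifth component has removed the coefficients of \<open>a1\<close>,
      \<open>a2\<close>, \<open>a3\<close>, the components on \<open>x + y\<close> and
      \<open>x - y\<close> are polynomials of degree at most one that display the remaining
      three.\<close>
    have k345: "k 3 = 0" "k 4 = 0" "k 5 = 0"
      using ind[of "k 3" "k 4" "k 5"] ev[of 4] by (auto simp: web5_nth p4)
    have p2: "\<phi> 2 t = - k 0 + (- k 2) * t" "\<phi> 3 t = - k 1 + (- k 2) * t" for t
      unfolding \<phi>_def sum6 r k345 by (simp_all add: eval_nat_numeral)
    have "k 0 = 0" "k 2 = 0" using linear_eq_0_near[OF ev[of 2, unfolded p2]] by auto
    moreover have "k 1 = 0" using linear_eq_0_near[OF ev[of 3, unfolded p2]] by auto
    ultimately show "\<forall>i<6. k i = 0" using k345 by (auto simp: six)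
  qed
  then show ?thesis
    by (simp add: maximal_rank_def web_rank_def relations_def web5_nth)
qed

subsection \<open>The five functions\<close>

lemma is_web_web5:
  assumes u: "holo2_at u p" "cond_T u p"
  shows "is_web p (web5 u)"
  unfolding is_web_def web5_nth
proof (intro conjI ballI)
  fix w assume "w \<in> set (web5 u)"
  then show "holo2_at w p" using submersion_at_web5[OF u] by (simp add: submersion_at_def)
next
  have "pdx u p \<noteq> pdy u p" "pdx u p \<noteq> - pdy u p" "pdx u p \<noteq> 0" "pdy u p \<noteq> 0"
    using cond_T_D[OF u(2)] by auto
  then show "\<forall>j<5. \<forall>k<5. j \<noteq> k \<longrightarrow> wedge (web5 u ! j) (web5 u ! k) p \<noteq> 0"
    unfolding less_5_cases
    by (auto simp add: web5_nth[simplified] wedge_def add_eq_0_iff neg_eq_iff_add_eq_0)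
qed simp

text \<open>Collects what the two rigidity arguments ask of the field: the leaves do not all share
  one direction, as used for equivalences, and they are not all straight, as used against
  algebraizability.\<close>

definition generic_slope :: "(plane \<Rightarrow> complex) \<Rightarrow> (plane \<Rightarrow> complex) \<Rightarrow> (plane \<Rightarrow> complex) \<Rightarrow> bool" where
  "generic_slope u w1 w2 \<longleftrightarrow> slope_form u w1 w2 \<and>
     (\<forall>k1 k2. k1 \<noteq> 0 \<or> k2 \<noteq> 0 \<longrightarrow> (\<exists>z. k1 * w1 z + k2 * w2 z \<noteq> 0)) \<and>
     (\<exists>z. leaf_curvature w1 w2 z \<noteq> 0)"

definition inequivalent :: "(plane \<Rightarrow> complex) \<Rightarrow> (plane \<Rightarrow> complex) \<Rightarrow> bool" where
  "inequivalent u v \<longleftrightarrow> (\<forall>p q. holo2_at u p \<and> cond_T u p \<and> holo2_at v q \<and> cond_T v q \<longrightarrow>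
     \<not> web_equivalent p (web5 u) q (web5 v))"

lemma generic_slopeD:
  assumes "generic_slope u w1 w2"
  shows "slope_form u w1 w2" "\<And>k1 k2. k1 \<noteq> 0 \<or> k2 \<noteq> 0 \<Longrightarrow> \<exists>z. k1 * w1 z + k2 * w2 z \<noteq> 0"
  using assms unfolding generic_slope_def by simp_all

lemma inequivalentI:
  assumes u: "generic_slope u w1 w2" and v: "generic_slope v w1' w2'"
    and n: "\<not> affine_equiv w1 w2 w1' w2'"
  shows "inequivalent u v" "inequivalent v u"
proof -
  have n': "\<not> affine_equiv w1' w2' w1 w2" using n affine_equiv_sym by blast
  show "inequivalent u v"
    unfolding inequivalent_def
  proof (intro allI impI notI, elim conjE)
    fix p q assume "web_equivalent p (web5 u) q (web5 v)"
      "holo2_at u p" "cond_T u p" "holo2_at v q" "cond_T v q"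
    with n web_equivalent_imp_affine_equiv[OF generic_slopeD(1)[OF u] _ _ generic_slopeD(1)[OF v] _ _
      generic_slopeD(2)[OF u] generic_slopeD(2)[OF v]]
    show False by simp
  qed
  show "inequivalent v u"
    unfolding inequivalent_def
  proof (intro allI impI notI, elim conjE)
    fix p q assume "web_equivalent p (web5 v) q (web5 u)"
      "holo2_at v p" "cond_T v p" "holo2_at u q" "cond_T u q"
    with n' web_equivalent_imp_affine_equiv[OF generic_slopeD(1)[OF v] _ _ generic_slopeD(1)[OF u] _ _
      generic_slopeD(2)[OF v] generic_slopeD(2)[OF u]]
    show False by simp
  qed
qed

lemma exceptionalI:
  assumes g: "generic_slope u w1 w2" and u: "holo2_at u p" "cond_T u p" and r: "maximal_rank p (web5 u)"
  shows "exceptional p (web5 u)"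
proof -
  obtain z where "leaf_curvature w1 w2 z \<noteq> 0" using g unfolding generic_slope_def by auto
  from not_algebraizable_web5[OF generic_slopeD(1)[OF g] u this] is_web_web5[OF u] r
  show ?thesis by (simp add: exceptional_def)
qed

lemma generic_slopeI:
  assumes "holo2_on w1 UNIV" "holo2_on w2 UNIV"
    and "\<And>p. holo2_at u p \<Longrightarrow> cond_T u p \<Longrightarrow>
      \<forall>\<^sub>F z in nhds p. \<exists>h. h \<noteq> 0 \<and> pdx u z = h * w1 z \<and> pdy u z = h * w2 z"
    and k: "\<And>k1 k2. (\<And>z. k1 * w1 z + k2 * w2 z = 0) \<Longrightarrow> k1 = 0 \<and> k2 = 0"
    and "leaf_curvature w1 w2 z0 \<noteq> 0"
  shows "generic_slope u w1 w2"
  unfolding generic_slope_def slope_form_def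
proof (intro conjI allI impI)
  fix k1 k2 :: complex assume "k1 \<noteq> 0 \<or> k2 \<noteq> 0"
  show "\<exists>z. k1 * w1 z + k2 * w2 z \<noteq> 0"
  proof (rule ccontr)
    assume "\<nexists>z. k1 * w1 z + k2 * w2 z \<noteq> 0"
    then have "k1 * w1 z + k2 * w2 z = 0" for z by blast
    from k[OF this] \<open>k1 \<noteq> 0 \<or> k2 \<noteq> 0\<close> show False by blast
  qed
next
  fix p assume "holo2_at u p \<and> cond_T u p"
  then show "\<forall>\<^sub>F z in nhds p. \<exists>h. h \<noteq> 0 \<and> pdx u z = h * w1 z \<and> pdy u z = h * w2 z"
    by (elim conjE) (rule assms(3))
next
  show "\<exists>z. leaf_curvature w1 w2 z \<noteq> 0" by (rule exI) (rule assms(5))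
qed (rule assms(1,2))+

lemma quadratic_eq_0_near:
  assumes "\<forall>\<^sub>F t in nhds z. c + d * t + e * t\<^sup>2 = (0::complex)"
  shows "c = 0 \<and> d = 0 \<and> e = 0"
proof -
  \<comment> \<open>The hypothesis holds in a neighbourhood of every nearby point, so it may be
    differentiated at each of them; an identity of degree one remains.\<close>
  have "\<forall>\<^sub>F s in nhds z. \<forall>\<^sub>F t in nhds s. c + d * t + e * t\<^sup>2 = 0"
    using assms by (simp add: eventually_eventually)
  then have "\<forall>\<^sub>F s in nhds z. d + (2 * e) * s = 0"
  proof eventually_elim
    case (elim s)
    have "deriv (\<lambda>t. c + d * t + e * t\<^sup>2) s = deriv (\<lambda>_. 0) s"
      by (rule deriv_cong_ev[OF elim refl])
    moreover have "deriv (\<lambda>t. c + d * t + e * t\<^sup>2) s = d + (2 * e) * s"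
      by (rule DERIV_imp_deriv) (auto intro!: derivative_eq_intros)
    ultimately show ?case by simp
  qed
  from linear_eq_0_near[OF this] have "d = 0" "e = 0" by auto
  with eventually_nhds_x_imp_x[OF assms] show ?thesis by simp
qed

text \<open>Up to constants, \<open>1\<close>, \<open>t\<close> and \<open>1 / t\<close> are the
  fifth components for three of the five functions. Multiplication by \<open>t\<close> leaves a
  quadratic polynomial.\<close>

lemma independent_1_id_inverse:
  fixes k1 k2 k3 a b c t0 :: complex
  assumes "\<forall>\<^sub>F t in nhds t0. k1 * a + k2 * (b * t) + k3 * (c / t) = 0" "t0 \<noteq> 0"
    and "a \<noteq> 0" "b \<noteq> 0" "c \<noteq> 0"
  shows "k1 = 0 \<and> k2 = 0 \<and> k3 = 0"
proof -
  have "\<forall>\<^sub>F t in nhds t0. t \<noteq> 0" using assms(2) t1_space_nhds by blast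
  with assms(1) have "\<forall>\<^sub>F t in nhds t0. k3 * c + (k1 * a) * t + (k2 * b) * t\<^sup>2 = 0"
    by eventually_elim (simp add: field_simps power2_eq_square)
  from quadratic_eq_0_near[OF this] assms(3-5) show ?thesis by simp
qed

subsubsection \<open>The function \<open>tanh x tanh y\<close>\<close>

text \<open>At a pole, \<open>tanh\<close> takes the value 0 of a division by zero. The product is
  then constantly 0 in the other variable, so one partial derivative is 0: condition (T) itself
  excludes the poles.\<close>

lemma cosh_neq_0_of_cond_T:
  assumes "cond_T (\<lambda>(x, y). tanh x * tanh y) p"
  shows "cosh (fst p) \<noteq> 0" "cosh (snd p) \<noteq> 0"
proof -
  note T = cond_T_D(1,2)[OF assms]
  show "cosh (fst p) \<noteq> 0"
  proof
    assume "cosh (fst p) = 0"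
    then have "tanh (fst p) = 0" by (simp add: tanh_def)
    then have "pdy (\<lambda>(x, y). tanh x * tanh y) p = 0" by (simp add: pdy_def)
    with T show False by simp
  qed
  show "cosh (snd p) \<noteq> 0"
  proof
    assume "cosh (snd p) = 0"
    then have "tanh (snd p) = 0" by (simp add: tanh_def)
    then have "pdx (\<lambda>(x, y). tanh x * tanh y) p = 0" by (simp add: pdx_def)
    with T show False by simp
  qed
qed

lemma pd_tanh_tanh:
  fixes z :: plane
  assumes "cosh (fst z) \<noteq> 0" "cosh (snd z) \<noteq> 0"
  shows "pdx (\<lambda>(x, y). tanh x * tanh y) z = sinh (snd z) / ((cosh (fst z))\<^sup>2 * cosh (snd z))"
    "pdy (\<lambda>(x, y). tanh x * tanh y) z = sinh (fst z) / (cosh (fst z) * (cosh (snd z))\<^sup>2)"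
proof -
  have d: "(tanh has_field_derivative 1 / (cosh t)\<^sup>2) (at t)" if "cosh t \<noteq> 0" for t :: complex
  proof -
    have "(tanh has_field_derivative 1 - (tanh t)\<^sup>2) (at t)"
      using that by (auto intro!: derivative_eq_intros)
    moreover have "1 - (tanh t)\<^sup>2 = ((cosh t)\<^sup>2 - (sinh t)\<^sup>2) / (cosh t)\<^sup>2"
      using that by (simp add: tanh_def power_divide diff_divide_distrib)
    ultimately show ?thesis by (simp add: hyperbolic_pythagoras)
  qed
  have "((\<lambda>t. tanh t * tanh (snd z)) has_field_derivative 1 / (cosh (fst z))\<^sup>2 * tanh (snd z)) (at (fst z))"
    by (rule DERIV_cmult_right[OF d[OF assms(1)]])
  then show "pdx (\<lambda>(x, y). tanh x * tanh y) z = sinh (snd z) / ((cosh (fst z))\<^sup>2 * cosh (snd z))"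
    by (simp add: pdx_def DERIV_imp_deriv tanh_def)
  have "((\<lambda>t. tanh (fst z) * tanh t) has_field_derivative tanh (fst z) * (1 / (cosh (snd z))\<^sup>2)) (at (snd z))"
    by (rule DERIV_cmult[OF d[OF assms(2)]])
  then show "pdy (\<lambda>(x, y). tanh x * tanh y) z = sinh (fst z) / (cosh (fst z) * (cosh (snd z))\<^sup>2)"
    by (simp add: pdy_def DERIV_imp_deriv tanh_def)
qed

lemma eventually_neq_0:
  fixes f :: "plane \<Rightarrow> complex"
  assumes "continuous_on UNIV f" "f p \<noteq> 0"
  shows "\<forall>\<^sub>F z in nhds p. f z \<noteq> 0"
proof -
  have "open (f -` (- {0}))" by (rule open_vimage[OF _ assms(1)]) (simp add: open_Compl)
  moreover have "p \<in> f -` (- {0})" using assms(2) by simp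
  ultimately have "\<forall>\<^sub>F z in nhds p. z \<in> f -` (- {0})" by (rule eventually_nhds_in_open)
  then show ?thesis by eventually_elim simp
qed

lemma eventually_cosh_neq_0:
  fixes p :: plane
  assumes "cosh (fst p) \<noteq> 0" "cosh (snd p) \<noteq> 0"
  shows "\<forall>\<^sub>F z in nhds p. cosh (fst z) \<noteq> 0 \<and> cosh (snd z) \<noteq> 0"
  using assms by (intro eventually_conj eventually_neq_0 continuous_intros)

lemma holomorphic_sinh: "(sinh :: complex \<Rightarrow> complex) holomorphic_on S"
  and holomorphic_cosh: "(cosh :: complex \<Rightarrow> complex) holomorphic_on S"
  unfolding sinh_field_def[abs_def] cosh_field_def[abs_def] by (intro holomorphic_intros; simp)+

lemma analytic_sinh: "(sinh :: complex \<Rightarrow> complex) analytic_on S"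
  and analytic_cosh: "(cosh :: complex \<Rightarrow> complex) analytic_on S"
  using analytic_on_subset[of _ UNIV S] holomorphic_sinh[of UNIV] holomorphic_cosh[of UNIV]
  by (auto simp: analytic_on_open)

lemma pd_sinh_2:
  "pdx (\<lambda>z. sinh (2 * snd z)) z = 0" "pdy (\<lambda>z. sinh (2 * snd z)) z = 2 * cosh (2 * snd z)"
  "pdx (\<lambda>z. sinh (2 * fst z)) z = 2 * cosh (2 * fst z)" "pdy (\<lambda>z. sinh (2 * fst z)) z = 0"
  by (auto simp: pdx_def pdy_def intro!: DERIV_imp_deriv derivative_eq_intros)

text \<open>By the double angle formula, \<open>du\<close> is the field
  \<open>(sinh 2y, sinh 2x)\<close> divided by \<open>2 cosh^2 x cosh^2 y\<close>; dropping this
  factor makes it entire.\<close>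

lemma generic_slope_tanh_tanh:
  "generic_slope (\<lambda>(x, y). tanh x * tanh y) (\<lambda>z. sinh (2 * snd z)) (\<lambda>z. sinh (2 * fst z))"
proof (rule generic_slopeI[where ?z0.0 = "(1, 1)"])
  show "holo2_on (\<lambda>z. sinh (2 * snd z)) UNIV" "holo2_on (\<lambda>z. sinh (2 * fst z)) UNIV"
    by (rule holo2_on_compose1[OF holomorphic_sinh[of UNIV]]; (intro holo2_intros)?; simp)+
next
  fix p :: plane assume T: "cond_T (\<lambda>(x, y). tanh x * tanh y) p"
  from eventually_cosh_neq_0[OF cosh_neq_0_of_cond_T[OF T]]
  show "\<forall>\<^sub>F z in nhds p. \<exists>h. h \<noteq> 0 \<and> pdx (\<lambda>(x, y). tanh x * tanh y) z = h * sinh (2 * snd z) \<and>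
      pdy (\<lambda>(x, y). tanh x * tanh y) z = h * sinh (2 * fst z)"
  proof eventually_elim
    case (elim z)
    then show ?case
      unfolding sinh_double
      by (intro exI[of _ "1 / (2 * (cosh (fst z))\<^sup>2 * (cosh (snd z))\<^sup>2)"])
         (simp add: pd_tanh_tanh field_simps power2_eq_square)
  qed
next
  fix k1 k2 :: complex assume z: "\<And>z. k1 * sinh (2 * snd z) + k2 * sinh (2 * fst z) = 0"
  from z[of "(0, 1)"] z[of "(1, 0)"] show "k1 = 0 \<and> k2 = 0"
    using sinh_cosh_2_neq_0 by simp
next
  show "leaf_curvature (\<lambda>z. sinh (2 * snd z)) (\<lambda>z. sinh (2 * fst z)) (1, 1) \<noteq> 0"
    using sinh_cosh_2_neq_0 by (simp add: leaf_curvature_def pd_sinh_2)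
qed

text \<open>With \<open>S\<close>, \<open>C\<close> for \<open>sinh x\<close>, \<open>cosh x\<close>
  and \<open>s\<close>, \<open>c\<close> for \<open>sinh y\<close>, \<open>cosh y\<close>, the two
  equations express the differential of \<open>log (1 - tanh x tanh y) = log cosh (x - y) - log cosh
  x - log cosh y\<close>.\<close>

lemma tanh_subtraction_identities:
  fixes S C s c :: complex
  assumes "C\<^sup>2 = S\<^sup>2 + 1" "c\<^sup>2 = s\<^sup>2 + 1" "C \<noteq> 0" "c \<noteq> 0" "C * c - S * s \<noteq> 0"
  shows "- (S / C) + (S * c - C * s) / (C * c - S * s) + 1 / (1 - S / C * (s / c)) * (s / (C\<^sup>2 * c)) = 0"
    "- (s / c) - (S * c - C * s) / (C * c - S * s) + 1 / (1 - S / C * (s / c)) * (S / (C * c\<^sup>2)) = 0"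
proof -
  have d: "1 - S / C * (s / c) = (C * c - S * s) / (C * c)" using assms(3,4) by (simp add: field_simps)
  have 1: "1 / (1 - S / C * (s / c)) * (s / (C\<^sup>2 * c)) = s / (C * (C * c - S * s))"
    unfolding d using assms(3-5) by (simp add: power2_eq_square)
  have 2: "1 / (1 - S / C * (s / c)) * (S / (C * c\<^sup>2)) = S / (c * (C * c - S * s))"
    unfolding d using assms(3-5) by (simp add: power2_eq_square)
  have "- (S / C) + (S * c - C * s) / (C * c - S * s) = (C * (S * c - C * s) - S * (C * c - S * s)) / (C * (C * c - S * s))"
    using assms(3,5) by (simp add: diff_divide_distrib)
  moreover have "C * (S * c - C * s) - S * (C * c - S * s) = - s"
    using assms(1) by algebra
  ultimately show "- (S / C) + (S * c - C * s) / (C * c - S * s) + 1 / (1 - S / C * (s / c)) * (s / (C\<^sup>2 * c)) = 0"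
    unfolding 1 by simp
  have "- (s / c) - (S * c - C * s) / (C * c - S * s) = (- (s * (C * c - S * s)) - c * (S * c - C * s)) / (c * (C * c - S * s))"
    using assms(4,5) by (simp add: diff_divide_distrib)
  moreover have "- (s * (C * c - S * s)) - c * (S * c - C * s) = - S"
    using assms(2) by algebra
  ultimately show "- (s / c) - (S * c - C * s) / (C * c - S * s) + 1 / (1 - S / C * (s / c)) * (S / (C * c\<^sup>2)) = 0"
    unfolding 2 by simp
qed

lemma maximal_rank_tanh_tanh:
  assumes u: "holo2_at (\<lambda>(x, y). tanh x * tanh y) p" "cond_T (\<lambda>(x, y). tanh x * tanh y) p"
  shows "maximal_rank p (web5 (\<lambda>(x, y). tanh x * tanh y))"
proof -
  let ?u = "\<lambda>(x, y). tanh x * tanh y :: complex"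
  \<comment> \<open>Differentials of decompositions of \<open>log u\<close>,
    \<open>log (1 + u)\<close> and \<open>log (1 - u)\<close>: the first is
    \<open>log tanh x + log tanh y\<close>, the others split into \<open>log cosh\<close> of
    \<open>x\<close>, of \<open>y\<close>, and of \<open>x + y\<close> or
    \<open>x - y\<close>.\<close>
  let ?r1 = "[\<lambda>t. 1 / (sinh t * cosh t), \<lambda>t. 1 / (sinh t * cosh t), \<lambda>_. 0, \<lambda>_. 0, \<lambda>t. - 1 / t] :: (complex \<Rightarrow> complex) list"
  let ?r2 = "[\<lambda>t. sinh t / cosh t, \<lambda>t. sinh t / cosh t, \<lambda>t. - (sinh t / cosh t), \<lambda>_. 0, \<lambda>t. 1 / (1 + t)] :: (complex \<Rightarrow> complex) list"
  let ?r3 = "[\<lambda>t. - (sinh t / cosh t), \<lambda>t. - (sinh t / cosh t), \<lambda>_. 0, \<lambda>t. sinh t / cosh t, \<lambda>t. 1 / (1 - t)] :: (complex \<Rightarrow> complex) list"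
  obtain x0 y0 where p: "p = (x0, y0)" by force
  have c0: "cosh x0 \<noteq> 0" "cosh y0 \<noteq> 0" using cosh_neq_0_of_cond_T[OF u(2)] by (simp_all add: p)
  have s0: "sinh x0 \<noteq> 0" "sinh y0 \<noteq> 0"
    using cond_T_D(1,2)[OF u(2)] c0 by (auto simp: p pd_tanh_tanh)
  have t: "(sinh y0 * cosh y0)\<^sup>2 - (sinh x0 * cosh x0)\<^sup>2 \<noteq> 0"
  proof -
    have "(pdx ?u p)\<^sup>2 - (pdy ?u p)\<^sup>2 =
       ((sinh y0 * cosh y0)\<^sup>2 - (sinh x0 * cosh x0)\<^sup>2) / ((cosh x0)^4 * (cosh y0)^4)"
      using c0 by (simp add: p pd_tanh_tanh field_simps power2_eq_square power4_eq_xxxx)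
    with cond_T_D(3)[OF u(2)] show ?thesis by auto
  qed
  \<comment> \<open>The expression in (T) contains \<open>cosh (x + y)\<close> and
    \<open>cosh (x - y)\<close> as factors; their zeros are the points where \<open>1 + u\<close> or
    \<open>1 - u\<close> vanishes.\<close>
  have "(sinh y0 * cosh y0)\<^sup>2 - (sinh x0 * cosh x0)\<^sup>2 =
     - (sinh (x0 + y0) * sinh (x0 - y0) * cosh (x0 + y0) * cosh (x0 - y0))"
  proof -
    have e: "(cosh x0)\<^sup>2 = (sinh x0)\<^sup>2 + 1" "(cosh y0)\<^sup>2 = (sinh y0)\<^sup>2 + 1"
      by (simp_all add: cosh_square_eq)
    show ?thesis unfolding sinh_add sinh_diff cosh_add cosh_diff using e by algebra
  qed
  with t have cpm: "cosh (x0 + y0) \<noteq> 0" "cosh (x0 - y0) \<noteq> 0" by auto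
  have u0: "?u p = sinh x0 * sinh y0 / (cosh x0 * cosh y0)" by (simp add: p tanh_def)
  have up: "?u p \<noteq> 0" "1 + ?u p \<noteq> 0" "1 - ?u p \<noteq> 0"
    using s0 c0 cpm by (auto simp: u0 cosh_add cosh_diff field_simps)
  have ev: "\<forall>\<^sub>F z in nhds p. cosh (fst z) \<noteq> 0 \<and> cosh (snd z) \<noteq> 0"
    using c0 by (intro eventually_cosh_neq_0) (simp_all add: p)
  have ev2: "\<forall>\<^sub>F z in nhds p. sinh (fst z) \<noteq> 0 \<and> sinh (snd z) \<noteq> 0 \<and> cosh (fst z + snd z) \<noteq> 0 \<and> cosh (fst z - snd z) \<noteq> 0"
    using s0 cpm by (intro eventually_conj eventually_neq_0 continuous_intros) (simp_all add: p)
  have tn: "(\<lambda>t. sinh t / cosh t) analytic_on {t}" if "cosh t \<noteq> 0" for t :: complex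
    using that by (intro analytic_intros analytic_sinh analytic_cosh) auto
  have uz: "?u z = sinh (fst z) / cosh (fst z) * (sinh (snd z) / cosh (snd z))" for z :: plane
    by (simp add: case_prod_beta tanh_def)
  show ?thesis
  proof (rule maximal_rank_web5[OF u])
    show "abelian_relation p (web5 ?u)
       (\<lambda>j. ?r1 ! j)"
    proof (rule abelian_relation_web5I)
      show "\<forall>\<^sub>F z in nhds p.
        1 / (sinh (fst z) * cosh (fst z)) + 0 + 0 + - 1 / ?u z * pdx ?u z = 0 \<and>
        1 / (sinh (snd z) * cosh (snd z)) + 0 - 0 + - 1 / ?u z * pdy ?u z = 0"
        using ev ev2
      proof eventually_elim
        case (elim z)
        then show ?case
          unfolding pd_tanh_tanh[OF conjunct1[OF elim(1)] conjunct2[OF elim(1)]] uz by (simp add: field_simps power2_eq_square)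
      qed
    qed (use c0 s0 up in \<open>auto simp: p intro!: analytic_intros analytic_sinh analytic_cosh\<close>)
    show "abelian_relation p (web5 ?u)
       (\<lambda>j. ?r2 ! j)"
    proof (rule abelian_relation_web5I)
      show "\<forall>\<^sub>F z in nhds p.
        sinh (fst z) / cosh (fst z) + - (sinh (fst z + snd z) / cosh (fst z + snd z)) + 0 + 1 / (1 + ?u z) * pdx ?u z = 0 \<and>
        sinh (snd z) / cosh (snd z) + - (sinh (fst z + snd z) / cosh (fst z + snd z)) - 0 + 1 / (1 + ?u z) * pdy ?u z = 0"
        using ev ev2
      proof eventually_elim
        case (elim z)
        \<comment> \<open>The subtraction identities are applied with \<open>- y\<close> for
          \<open>y\<close>, hence with \<open>- sinh (snd z)\<close>.\<close>
        have "(cosh (snd z))\<^sup>2 = (- sinh (snd z))\<^sup>2 + 1"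
          "cosh (fst z) * cosh (snd z) - sinh (fst z) * - sinh (snd z) \<noteq> 0"
          using elim by (simp_all add: cosh_square_eq cosh_add)
        note tanh_subtraction_identities[OF cosh_square_eq this(1) _ _ this(2)]
        with elim have "- (sinh (fst z) / cosh (fst z)) + sinh (fst z + snd z) / cosh (fst z + snd z) - 1 / (1 + ?u z) * pdx ?u z = 0"
          "sinh (snd z) / cosh (snd z) - sinh (fst z + snd z) / cosh (fst z + snd z) + 1 / (1 + ?u z) * pdy ?u z = 0"
          unfolding pd_tanh_tanh[OF conjunct1[OF elim(1)] conjunct2[OF elim(1)]] uz cosh_add sinh_add
          by simp_all
        then show ?case by (simp add: algebra_simps)
      qed
    qed (use c0 cpm up in \<open>auto simp: p intro!: tn analytic_intros\<close>)
    show "abelian_relation p (web5 ?u)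
       (\<lambda>j. ?r3 ! j)"
    proof (rule abelian_relation_web5I)
      show "\<forall>\<^sub>F z in nhds p.
        - (sinh (fst z) / cosh (fst z)) + 0 + sinh (fst z - snd z) / cosh (fst z - snd z) + 1 / (1 - ?u z) * pdx ?u z = 0 \<and>
        - (sinh (snd z) / cosh (snd z)) + 0 - sinh (fst z - snd z) / cosh (fst z - snd z) + 1 / (1 - ?u z) * pdy ?u z = 0"
        using ev ev2
      proof eventually_elim
        case (elim z)
        have "cosh (fst z) * cosh (snd z) - sinh (fst z) * sinh (snd z) \<noteq> 0"
          using elim by (simp add: cosh_diff)
        from tanh_subtraction_identities[OF cosh_square_eq cosh_square_eq _ _ this] elim
        show ?case
          unfolding pd_tanh_tanh[OF conjunct1[OF elim(1)] conjunct2[OF elim(1)]] uz cosh_diff sinh_diff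
          by (simp only: add_0_right not_False_eq_True)
      qed
    qed (use c0 cpm up in \<open>auto simp: p intro!: tn analytic_intros\<close>)
  next
    fix k1 k2 k3
    assume a: "\<forall>\<^sub>F t in nhds (?u p).
      k1 * (?r1 ! 4) t +
      k2 * (?r2 ! 4) t +
      k3 * (?r3 ! 4) t = 0"
    have "\<forall>\<^sub>F t in nhds (?u p). t \<noteq> 0" "\<forall>\<^sub>F t in nhds (?u p). t \<noteq> - 1" "\<forall>\<^sub>F t in nhds (?u p). t \<noteq> 1"
      using up by (auto intro!: t1_space_nhds simp: add_eq_0_iff)
    \<comment> \<open>A linear relation between \<open>1 / t\<close>, \<open>1 / (1 + t)\<close> and
      \<open>1 / (1 - t)\<close>, multiplied by the common denominator.\<close>
    with a have "\<forall>\<^sub>F t in nhds (?u p). - k1 + (k2 + k3) * t + (k1 - k2 + k3) * t\<^sup>2 = 0"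
    proof eventually_elim
      case (elim t)
      then have n: "t \<noteq> 0" "1 + t \<noteq> 0" "1 - t \<noteq> 0" by (auto simp: add_eq_0_iff)
      have "k1 * (- 1 / t) + k2 * (1 / (1 + t)) + k3 * (1 / (1 - t)) = 0"
        using elim(1) by (simp add: eval_nat_numeral)
      then have "t * (1 + t) * (1 - t) * (k1 * (- 1 / t) + k2 * (1 / (1 + t)) + k3 * (1 / (1 - t))) = 0" by simp
      moreover have "t * (1 + t) * (1 - t) * (k1 * (- 1 / t)) = - k1 * ((1 + t) * (1 - t))"
        "t * (1 + t) * (1 - t) * (k2 * (1 / (1 + t))) = k2 * (t * (1 - t))"
        "t * (1 + t) * (1 - t) * (k3 * (1 / (1 - t))) = k3 * (t * (1 + t))"
        using n by simp_all
      ultimately have "- k1 * ((1 + t) * (1 - t)) + k2 * (t * (1 - t)) + k3 * (t * (1 + t)) = 0"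
        by (simp only: distrib_left)
      then show ?case by algebra
    qed
    from quadratic_eq_0_near[OF this] have "k1 = 0" "k2 + k3 = 0" "k1 - k2 + k3 = 0" by auto
    then show "k1 = 0 \<and> k2 = 0 \<and> k3 = 0" by (auto simp: add_eq_0_iff)
  qed
qed

subsubsection \<open>The function \<open>sin x sin y\<close>\<close>

lemma pd_trig:
  fixes z :: plane
  shows "pdx (\<lambda>(x, y). sin x * sin y) z = cos (fst z) * sin (snd z)"
    "pdy (\<lambda>(x, y). sin x * sin y) z = sin (fst z) * cos (snd z)"
    "pdx (\<lambda>z. cos (fst z) * sin (snd z)) z = - (sin (fst z) * sin (snd z))"
    "pdy (\<lambda>z. cos (fst z) * sin (snd z)) z = cos (fst z) * cos (snd z)"
    "pdx (\<lambda>z. sin (fst z) * cos (snd z)) z = cos (fst z) * cos (snd z)"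
    "pdy (\<lambda>z. sin (fst z) * cos (snd z)) z = - (sin (fst z) * sin (snd z))"
  by (auto simp: pdx_def pdy_def intro!: DERIV_imp_deriv derivative_eq_intros)

lemma holo2_on_trig:
  "holo2_on (\<lambda>z. cos (fst z) * sin (snd z)) UNIV" "holo2_on (\<lambda>z. sin (fst z) * cos (snd z)) UNIV"
  by (intro holo2_on_mult holo2_on_compose1[OF holomorphic_on_sin[of UNIV]]
        holo2_on_compose1[OF holomorphic_on_cos[of UNIV]] holo2_on_fst holo2_on_snd; simp)+

lemma generic_slope_sin_sin:
  "generic_slope (\<lambda>(x, y). sin x * sin y) (\<lambda>z. cos (fst z) * sin (snd z)) (\<lambda>z. sin (fst z) * cos (snd z))"
proof (rule generic_slopeI[OF holo2_on_trig, where ?z0.0 = "(of_real (pi / 4), of_real (pi / 4))"])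
  fix p :: plane
  show "\<forall>\<^sub>F z in nhds p. \<exists>h. h \<noteq> 0 \<and> pdx (\<lambda>(x, y). sin x * sin y) z = h * (cos (fst z) * sin (snd z)) \<and>
      pdy (\<lambda>(x, y). sin x * sin y) z = h * (sin (fst z) * cos (snd z))"
    by (intro always_eventually allI exI[of _ 1]) (simp add: pd_trig)
next
  fix k1 k2 :: complex assume z: "\<And>z. k1 * (cos (fst z) * sin (snd z)) + k2 * (sin (fst z) * cos (snd z)) = 0"
  from z[of "(0, of_real (pi / 2))"] z[of "(of_real (pi / 2), 0)"] show "k1 = 0 \<and> k2 = 0"
    by (simp del: of_real_divide add: sin_of_real cos_of_real)
next
  \<comment> \<open>At this point sine and cosine coincide, so the curvature becomes a monomial in
    their common value.\<close>
  let ?s = "complex_of_real (sqrt 2 / 2)"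
  have sc: "sin (complex_of_real (pi / 4)) = ?s" "cos (complex_of_real (pi / 4)) = ?s"
    unfolding sin_of_real cos_of_real sin_45 cos_45 by (rule refl)+
  have s: "?s \<noteq> 0" by simp
  have "leaf_curvature (\<lambda>z. cos (fst z) * sin (snd z)) (\<lambda>z. sin (fst z) * cos (snd z))
      (of_real (pi / 4), of_real (pi / 4)) = 4 * ?s ^ 6"
    unfolding leaf_curvature_def pd_trig fst_conv snd_conv sc by algebra
  with s show "leaf_curvature (\<lambda>z. cos (fst z) * sin (snd z)) (\<lambda>z. sin (fst z) * cos (snd z))
      (of_real (pi / 4), of_real (pi / 4)) \<noteq> 0" by simp
qed

lemma maximal_rank_sin_sin:
  assumes u: "holo2_at (\<lambda>(x, y). sin x * sin y) p" "cond_T (\<lambda>(x, y). sin x * sin y) p"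
  shows "maximal_rank p (web5 (\<lambda>(x, y). sin x * sin y))"
proof -
  let ?u = "\<lambda>(x, y). sin x * sin y :: complex"
  \<comment> \<open>Differentials of \<open>- 2 u = cos (x + y) - cos (x - y)\<close>, of the
    Fourier expansion of \<open>4 u^2 = (1 - cos 2x) (1 - cos 2y)\<close>, and of
    \<open>log u = log sin x + log sin y\<close>.\<close>
  let ?r1 = "[\<lambda>_. 0, \<lambda>_. 0, \<lambda>t. sin t, \<lambda>t. - sin t, \<lambda>_. - 2] :: (complex \<Rightarrow> complex) list"
  let ?r2 = "[\<lambda>t. 2 * sin (2 * t), \<lambda>t. 2 * sin (2 * t), \<lambda>t. - sin (2 * t), \<lambda>t. - sin (2 * t), \<lambda>t. (- 8) * t] :: (complex \<Rightarrow> complex) list"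
  let ?r3 = "[\<lambda>t. cos t / sin t, \<lambda>t. cos t / sin t, \<lambda>_. 0, \<lambda>_. 0, \<lambda>t. - 1 / t] :: (complex \<Rightarrow> complex) list"
  have s0: "sin (fst p) \<noteq> 0" "sin (snd p) \<noteq> 0"
    using cond_T_D(1,2)[OF u(2)] by (auto simp: pd_trig)
  then have up: "?u p \<noteq> 0" by (simp add: case_prod_beta)
  have ev: "\<forall>\<^sub>F z in nhds p. sin (fst z) * sin (snd z) \<noteq> 0"
    using s0 by (intro eventually_neq_0 continuous_intros) auto
  show ?thesis
  proof (rule maximal_rank_web5[OF u])
    show "abelian_relation p (web5 ?u) (\<lambda>j. ?r1 ! j)"
      by (rule abelian_relation_web5I)
         (auto simp: pd_trig sin_add sin_diff intro!: analytic_intros always_eventually)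
    show "abelian_relation p (web5 ?u)
       (\<lambda>j. ?r2 ! j)"
    proof (rule abelian_relation_web5I)
      have e: "2 * sin (2 * x) - sin (2 * (x + y)) - sin (2 * (x - y)) = 8 * (sin x * sin y) * (cos x * sin y)"
        "2 * sin (2 * y) - sin (2 * (x + y)) + sin (2 * (x - y)) = 8 * (sin x * sin y) * (sin x * cos y)" for x y :: complex
      proof -
        have "sin (2 * (x + y)) + sin (2 * (x - y)) = 2 * (sin (2 * x) * cos (2 * y))"
          "sin (2 * (x + y)) - sin (2 * (x - y)) = 2 * (cos (2 * x) * sin (2 * y))"
          by (simp_all add: distrib_left right_diff_distrib sin_add sin_diff)
        moreover have "2 * sin (2 * x) - 2 * (sin (2 * x) * cos (2 * y)) = 8 * (sin x * sin y) * (cos x * sin y)"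
          "2 * sin (2 * y) - 2 * (cos (2 * x) * sin (2 * y)) = 8 * (sin x * sin y) * (sin x * cos y)"
          unfolding sin_double cos_double_sin by (simp_all add: algebra_simps power2_eq_square)
        ultimately show "2 * sin (2 * x) - sin (2 * (x + y)) - sin (2 * (x - y)) = 8 * (sin x * sin y) * (cos x * sin y)"
          "2 * sin (2 * y) - sin (2 * (x + y)) + sin (2 * (x - y)) = 8 * (sin x * sin y) * (sin x * cos y)"
          by (metis diff_diff_add, metis diff_diff_eq2 diff_add_eq)
      qed
      show "\<forall>\<^sub>F z in nhds p.
         2 * sin (2 * fst z) + - sin (2 * (fst z + snd z)) + - sin (2 * (fst z - snd z)) + - 8 * ?u z * pdx ?u z = 0 \<and>
         2 * sin (2 * snd z) + - sin (2 * (fst z + snd z)) - - sin (2 * (fst z - snd z)) + - 8 * ?u z * pdy ?u z = 0"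
      proof (intro always_eventually allI)
        fix z :: plane
        show "2 * sin (2 * fst z) + - sin (2 * (fst z + snd z)) + - sin (2 * (fst z - snd z)) + - 8 * ?u z * pdx ?u z = 0 \<and>
         2 * sin (2 * snd z) + - sin (2 * (fst z + snd z)) - - sin (2 * (fst z - snd z)) + - 8 * ?u z * pdy ?u z = 0"
          unfolding pd_trig using e(1)[of "fst z" "snd z"] e(2)[of "snd z" "fst z"] by (simp add: case_prod_beta)
      qed
    qed (auto intro!: analytic_intros)
    show "abelian_relation p (web5 ?u) (\<lambda>j. ?r3 ! j)"
    proof (rule abelian_relation_web5I)
      show "\<forall>\<^sub>F z in nhds p. cos (fst z) / sin (fst z) + 0 + 0 + - 1 / ?u z * pdx ?u z = 0 \<and>
         cos (snd z) / sin (snd z) + 0 - 0 + - 1 / ?u z * pdy ?u z = 0"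
        using ev by eventually_elim (auto simp: pd_trig case_prod_beta)
    qed (use s0 up in \<open>auto intro!: analytic_intros\<close>)
  next
    fix k1 k2 k3
    assume a: "\<forall>\<^sub>F t in nhds (?u p).
      k1 * (?r1 ! 4) t +
      k2 * (?r2 ! 4) t +
      k3 * (?r3 ! 4) t = 0"
    show "k1 = 0 \<and> k2 = 0 \<and> k3 = 0"
      by (rule independent_1_id_inverse[OF _ up, of k1 "- 2" k2 "- 8" k3 "- 1"])
         (use a in \<open>simp_all add: eval_nat_numeral\<close>)
  qed
qed

subsubsection \<open>The function \<open>exp x + exp y\<close>\<close>

lemma pd_exp:
  fixes z :: plane
  shows "pdx (\<lambda>(x, y). exp x + exp y) z = exp (fst z)" "pdy (\<lambda>(x, y). exp x + exp y) z = exp (snd z)"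
    "pdx (\<lambda>z. exp (fst z)) z = exp (fst z)" "pdy (\<lambda>z. exp (fst z)) z = 0"
    "pdx (\<lambda>z. exp (snd z)) z = 0" "pdy (\<lambda>z. exp (snd z)) z = exp (snd z)"
  by (auto simp: pdx_def pdy_def intro!: DERIV_imp_deriv derivative_eq_intros)

lemma holo2_on_exp: "holo2_on (\<lambda>z. exp (fst z)) UNIV" "holo2_on (\<lambda>z. exp (snd z)) UNIV"
  by (rule holo2_on_compose1[OF holomorphic_on_exp[of UNIV]];
      simp add: holo2_on_fst holo2_on_snd)+

lemma generic_slope_exp_exp:
  "generic_slope (\<lambda>(x, y). exp x + exp y) (\<lambda>z. exp (fst z)) (\<lambda>z. exp (snd z))"
proof (rule generic_slopeI[OF holo2_on_exp, where ?z0.0 = "(0, 0)"])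
  fix p :: plane
  show "\<forall>\<^sub>F z in nhds p. \<exists>h. h \<noteq> 0 \<and> pdx (\<lambda>(x, y). exp x + exp y) z = h * exp (fst z) \<and>
      pdy (\<lambda>(x, y). exp x + exp y) z = h * exp (snd z)"
    by (intro always_eventually allI exI[of _ 1]) (simp add: pd_exp)
next
  fix k1 k2 :: complex assume z: "\<And>z. k1 * exp (fst z) + k2 * exp (snd z) = 0"
  \<comment> \<open>The second point changes the sign of \<open>exp x\<close> and keeps
    \<open>exp y\<close>.\<close>
  have "k1 + k2 = 0" "- k1 + k2 = 0"
    using z[of "(0, 0)"] z[of "(\<i> * of_real pi, 0)"] by simp_all
  then show "k1 = 0 \<and> k2 = 0" by (auto simp: add_eq_0_iff)
qed (simp add: leaf_curvature_def pd_exp)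

lemma maximal_rank_exp_exp:
  assumes u: "holo2_at (\<lambda>(x, y). exp x + exp y) p" "cond_T (\<lambda>(x, y). exp x + exp y) p"
  shows "maximal_rank p (web5 (\<lambda>(x, y). exp x + exp y))"
proof -
  let ?u = "\<lambda>(x, y). exp x + exp y :: complex"
  \<comment> \<open>Differentials of \<open>u\<close>, of half of
    \<open>u^2 = e^(2x) + e^(2y) + 2 e^(x + y)\<close>, and of
    \<open>log u = (x + y) / 2 + log (2 cosh ((x - y) / 2))\<close>. The fourth component of the
    last is \<open>tanh (t / 2) / 2\<close>, written in terms of \<open>exp t\<close>.\<close>
  let ?r1 = "[\<lambda>t. exp t, \<lambda>t. exp t, \<lambda>_. 0, \<lambda>_. 0, \<lambda>_. - 1] :: (complex \<Rightarrow> complex) list"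
  let ?r2 = "[\<lambda>t. exp (2 * t), \<lambda>t. exp (2 * t), \<lambda>t. exp t, \<lambda>_. 0, \<lambda>t. (- 1) * t] :: (complex \<Rightarrow> complex) list"
  let ?r3 = "[\<lambda>_. 0, \<lambda>_. 0, \<lambda>_. 1 / 2, \<lambda>t. (exp t - 1) / (2 * (exp t + 1)), \<lambda>t. - 1 / t] :: (complex \<Rightarrow> complex) list"
  \<comment> \<open>\<open>u\<close> divides the expression in (T), which therefore keeps it away
    from 0.\<close>
  have "(exp (fst p))\<^sup>2 - (exp (snd p))\<^sup>2 = (exp (fst p) - exp (snd p)) * ?u p"
    by (simp add: case_prod_beta power2_eq_square algebra_simps)
  then have up: "?u p \<noteq> 0" using cond_T_D(3)[OF u(2)] by (auto simp: pd_exp)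
  have c: "exp (x - y) + 1 = (exp x + exp y) / exp y" "exp (x - y) - 1 = (exp x - exp y) / exp y" for x y :: complex
    by (simp_all add: exp_diff field_simps)
  have ev: "\<forall>\<^sub>F z in nhds p. exp (fst z) + exp (snd z) \<noteq> 0"
    using up by (intro eventually_neq_0 continuous_intros) (auto simp: case_prod_beta)
  have pm1: "exp (fst p - snd p) + 1 \<noteq> 0"
    unfolding c using up by (simp add: case_prod_beta)
  have "2 * exp (fst p - snd p) + 2 = 2 * (exp (fst p - snd p) + 1)"
    by (simp add: distrib_left)
  with pm1 have pm: "2 * exp (fst p - snd p) + 2 \<noteq> 0"
    by (metis mult_eq_0_iff zero_neq_numeral)
  show ?thesis
  proof (rule maximal_rank_web5[OF u])
    show "abelian_relation p (web5 ?u) (\<lambda>j. ?r1 ! j)"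
      by (rule abelian_relation_web5I) (auto simp: pd_exp intro!: analytic_intros always_eventually)
    show "abelian_relation p (web5 ?u) (\<lambda>j. ?r2 ! j)"
      by (rule abelian_relation_web5I; (auto simp: pd_exp exp_add exp_double intro!: analytic_intros always_eventually; algebra))
    show "abelian_relation p (web5 ?u)
       (\<lambda>j. ?r3 ! j)"
    proof (rule abelian_relation_web5I)
      show "\<forall>\<^sub>F z in nhds p.
         0 + 1 / 2 + (exp (fst z - snd z) - 1) / (2 * (exp (fst z - snd z) + 1)) + - 1 / ?u z * pdx ?u z = 0 \<and>
         0 + 1 / 2 - (exp (fst z - snd z) - 1) / (2 * (exp (fst z - snd z) + 1)) + - 1 / ?u z * pdy ?u z = 0"
        using ev
      proof eventually_elim
        case (elim z)
        have "(exp (fst z - snd z) - 1) / (2 * (exp (fst z - snd z) + 1)) =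
            (exp (fst z) - exp (snd z)) / (2 * (exp (fst z) + exp (snd z)))"
          using elim unfolding c by simp
        moreover have "1 / 2 + (a - b) / (2 * (a + b)) = a / (a + b)" "1 / 2 - (a - b) / (2 * (a + b)) = b / (a + b)"
          if "a + b \<noteq> 0" for a b :: complex
        proof -
          define w where "w = a + b"
          have "1 / 2 + (2 * a - w) / (2 * w) = a / w" "1 / 2 - (w - 2 * b) / (2 * w) = b / w"
            using that by (simp_all add: w_def[symmetric] field_simps)
          moreover have "2 * a - w = a - b" "w - 2 * b = a - b" by (simp_all add: w_def)
          ultimately show "1 / 2 + (a - b) / (2 * (a + b)) = a / (a + b)" "1 / 2 - (a - b) / (2 * (a + b)) = b / (a + b)"
            by (simp_all only: w_def)
        qed
        ultimately show ?case
          using elim by (simp only: pd_exp case_prod_beta) simp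
      qed
    qed (use pm up in \<open>auto intro!: analytic_intros\<close>)
  next
    fix k1 k2 k3
    assume a: "\<forall>\<^sub>F t in nhds (?u p).
      k1 * (?r1 ! 4) t +
      k2 * (?r2 ! 4) t +
      k3 * (?r3 ! 4) t = 0"
    show "k1 = 0 \<and> k2 = 0 \<and> k3 = 0"
      by (rule independent_1_id_inverse[OF _ up, of k1 "- 1" k2 "- 1" k3 "- 1"])
         (use a in \<open>simp_all add: eval_nat_numeral\<close>)
  qed
qed

subsubsection \<open>The quadratic functions\<close>

lemma pd_quadratic:
  fixes z :: plane
  shows "pdx (\<lambda>(x, y). x\<^sup>2 - y\<^sup>2) z = 2 * fst z" "pdy (\<lambda>(x, y). x\<^sup>2 - y\<^sup>2) z = - 2 * snd z"
    "pdx (\<lambda>(x, y). x\<^sup>2 + y\<^sup>2) z = 2 * fst z" "pdy (\<lambda>(x, y). x\<^sup>2 + y\<^sup>2) z = 2 * snd z"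
    "pdx fst z = 1" "pdy fst z = 0" "pdx snd z = 0" "pdy snd z = 1"
    "pdx (\<lambda>z. - snd z) z = 0" "pdy (\<lambda>z. - snd z) z = - 1"
  by (auto simp: pdx_def pdy_def intro!: DERIV_imp_deriv derivative_eq_intros)

lemma generic_slope_quadratic:
  "generic_slope (\<lambda>(x, y). x\<^sup>2 - y\<^sup>2) fst (\<lambda>z. - snd z)"
  "generic_slope (\<lambda>(x, y). x\<^sup>2 + y\<^sup>2) fst snd"
proof -
  show "generic_slope (\<lambda>(x, y). x\<^sup>2 - y\<^sup>2) fst (\<lambda>z. - snd z)"
  proof (rule generic_slopeI[where ?z0.0 = "(1, 0)"])
    fix p :: plane
    show "\<forall>\<^sub>F z in nhds p. \<exists>h. h \<noteq> 0 \<and> pdx (\<lambda>(x, y). x\<^sup>2 - y\<^sup>2) z = h * fst z \<and>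
        pdy (\<lambda>(x, y). x\<^sup>2 - y\<^sup>2) z = h * - snd z"
      by (intro always_eventually allI exI[of _ 2]) (simp add: pd_quadratic)
  next
    fix k1 k2 :: complex assume z: "\<And>z. k1 * fst z + k2 * - snd z = 0"
    from z[of "(1, 0)"] z[of "(0, 1)"] show "k1 = 0 \<and> k2 = 0" by simp
  qed (auto simp: leaf_curvature_def pd_quadratic intro: holo2_intros)
  show "generic_slope (\<lambda>(x, y). x\<^sup>2 + y\<^sup>2) fst snd"
  proof (rule generic_slopeI[where ?z0.0 = "(1, 0)"])
    fix p :: plane
    show "\<forall>\<^sub>F z in nhds p. \<exists>h. h \<noteq> 0 \<and> pdx (\<lambda>(x, y). x\<^sup>2 + y\<^sup>2) z = h * fst z \<and>
        pdy (\<lambda>(x, y). x\<^sup>2 + y\<^sup>2) z = h * snd z"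
      by (intro always_eventually allI exI[of _ 2]) (simp add: pd_quadratic)
  next
    fix k1 k2 :: complex assume z: "\<And>z. k1 * fst z + k2 * snd z = 0"
    from z[of "(1, 0)"] z[of "(0, 1)"] show "k1 = 0 \<and> k2 = 0" by simp
  qed (auto simp: leaf_curvature_def pd_quadratic intro: holo2_intros)
qed

lemma maximal_rank_difference_of_squares:
  assumes u: "holo2_at (\<lambda>(x, y). x\<^sup>2 - y\<^sup>2) p" "cond_T (\<lambda>(x, y). x\<^sup>2 - y\<^sup>2) p"
  shows "maximal_rank p (web5 (\<lambda>(x, y). x\<^sup>2 - y\<^sup>2))"
proof -
  let ?u = "\<lambda>(x, y). x\<^sup>2 - y\<^sup>2 :: complex"
  \<comment> \<open>Differentials of \<open>u\<close>, of
    \<open>8 x^4 + 8 y^4 = (x + y)^4 + (x - y)^4 + 6 u^2\<close> divided by 4, and of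
    \<open>log u = log (x + y) + log (x - y)\<close>.\<close>
  let ?r1 = "[\<lambda>t. 2 * t, \<lambda>t. - 2 * t, \<lambda>_. 0, \<lambda>_. 0, \<lambda>_. - 1] :: (complex \<Rightarrow> complex) list"
  let ?r2 = "[\<lambda>t. 8 * t ^ 3, \<lambda>t. 8 * t ^ 3, \<lambda>t. - (t ^ 3), \<lambda>t. - (t ^ 3), \<lambda>t. (- 3) * t] :: (complex \<Rightarrow> complex) list"
  let ?r3 = "[\<lambda>_. 0, \<lambda>_. 0, \<lambda>t. 1 / t, \<lambda>t. 1 / t, \<lambda>t. - 1 / t] :: (complex \<Rightarrow> complex) list"
  have uz: "?u z = (fst z + snd z) * (fst z - snd z)" for z
    by (simp add: case_prod_beta power2_eq_square algebra_simps)
  have "(2 * fst p)\<^sup>2 - (- 2 * snd p)\<^sup>2 = 4 * ((fst p + snd p) * (fst p - snd p))"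
    by (simp add: power2_eq_square algebra_simps)
  then have pm: "fst p + snd p \<noteq> 0" "fst p - snd p \<noteq> 0"
    using cond_T_D(3)[OF u(2)] unfolding pd_quadratic by auto
  then have up: "?u p \<noteq> 0" unfolding uz by simp
  have ev: "\<forall>\<^sub>F z in nhds p. (fst z + snd z) * (fst z - snd z) \<noteq> 0"
    using pm by (intro eventually_neq_0 continuous_intros) auto
  show ?thesis
  proof (rule maximal_rank_web5[OF u])
    show "abelian_relation p (web5 ?u) (\<lambda>j. ?r1 ! j)"
      by (rule abelian_relation_web5I) (auto simp: pd_quadratic intro!: analytic_intros always_eventually)
    show "abelian_relation p (web5 ?u)
       (\<lambda>j. ?r2 ! j)"
      by (rule abelian_relation_web5I; (auto simp: pd_quadratic intro!: analytic_intros always_eventually; algebra))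
    show "abelian_relation p (web5 ?u) (\<lambda>j. ?r3 ! j)"
    proof (rule abelian_relation_web5I)
      show "\<forall>\<^sub>F z in nhds p.
         0 + 1 / (fst z + snd z) + 1 / (fst z - snd z) + - 1 / ?u z * pdx ?u z = 0 \<and>
         0 + 1 / (fst z + snd z) - 1 / (fst z - snd z) + - 1 / ?u z * pdy ?u z = 0"
        using ev
      proof eventually_elim
        case (elim z)
        then have "fst z + snd z \<noteq> 0" "fst z - snd z \<noteq> 0" by auto
        then show ?case
          unfolding pd_quadratic uz by (simp add: divide_simps)
      qed
    qed (use pm up in \<open>auto intro!: analytic_intros\<close>)
  next
    fix k1 k2 k3
    assume a: "\<forall>\<^sub>F t in nhds (?u p).
      k1 * (?r1 ! 4) t +
      k2 * (?r2 ! 4) t +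
      k3 * (?r3 ! 4) t = 0"
    show "k1 = 0 \<and> k2 = 0 \<and> k3 = 0"
      by (rule independent_1_id_inverse[OF _ up, of k1 "- 1" k2 "- 3" k3 "- 1"])
         (use a in \<open>simp_all add: eval_nat_numeral\<close>)
  qed
qed

lemma maximal_rank_sum_of_squares:
  assumes u: "holo2_at (\<lambda>(x, y). x\<^sup>2 + y\<^sup>2) p" "cond_T (\<lambda>(x, y). x\<^sup>2 + y\<^sup>2) p"
  shows "maximal_rank p (web5 (\<lambda>(x, y). x\<^sup>2 + y\<^sup>2))"
proof (rule maximal_rank_web5[OF u])
  let ?u = "\<lambda>(x, y). x\<^sup>2 + y\<^sup>2 :: complex"
  \<comment> \<open>Differentials of \<open>u\<close>, of
    \<open>6 u^2 = 4 x^4 + 4 y^4 + (x + y)^4 + (x - y)^4\<close> divided by 4, and of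
    \<open>10 u^3 = 8 x^6 + 8 y^6 + (x + y)^6 + (x - y)^6\<close> divided by 6. The fifth components
    are \<open>1\<close>, \<open>t\<close>, \<open>t^2\<close> up to constants.\<close>
  let ?r1 = "[\<lambda>t. 2 * t, \<lambda>t. 2 * t, \<lambda>_. 0, \<lambda>_. 0, \<lambda>_. - 1] :: (complex \<Rightarrow> complex) list"
  let ?r2 = "[\<lambda>t. 4 * t ^ 3, \<lambda>t. 4 * t ^ 3, \<lambda>t. t ^ 3, \<lambda>t. t ^ 3, \<lambda>t. - 3 * t] :: (complex \<Rightarrow> complex) list"
  let ?r3 = "[\<lambda>t. 8 * t ^ 5, \<lambda>t. 8 * t ^ 5, \<lambda>t. t ^ 5, \<lambda>t. t ^ 5, \<lambda>t. - 5 * t\<^sup>2] :: (complex \<Rightarrow> complex) list"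
  show "abelian_relation p (web5 ?u) (\<lambda>j. ?r1 ! j)"
    by (rule abelian_relation_web5I) (auto simp: pd_quadratic intro!: analytic_intros always_eventually)
  show "abelian_relation p (web5 ?u)
     (\<lambda>j. ?r2 ! j)"
    by (rule abelian_relation_web5I; (auto simp: pd_quadratic intro!: analytic_intros always_eventually; algebra))
  show "abelian_relation p (web5 ?u)
     (\<lambda>j. ?r3 ! j)"
    by (rule abelian_relation_web5I; (auto simp: pd_quadratic intro!: analytic_intros always_eventually; algebra))
  fix k1 k2 k3
  assume a: "\<forall>\<^sub>F t in nhds (?u p).
    k1 * (?r1 ! 4) t +
    k2 * (?r2 ! 4) t +
    k3 * (?r3 ! 4) t = 0"
  have "(?r1 ! 4) t = - 1"
    "(?r2 ! 4) t = - 3 * t"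
    "(?r3 ! 4) t = - 5 * t\<^sup>2" for t :: complex
    by (simp_all add: eval_nat_numeral)
  note n = this
  have "\<forall>\<^sub>F t in nhds (?u p). - k1 + (- 3 * k2) * t + (- 5 * k3) * t\<^sup>2 = 0"
    using a[unfolded n] by eventually_elim (simp add: algebra_simps)
  from quadratic_eq_0_near[OF this] show "k1 = 0 \<and> k2 = 0 \<and> k3 = 0" by simp
qed

subsection \<open>The webs are pairwise inequivalent\<close>

text \<open>Hypothesis \<open>n\<close> denies a zero whose linear part is a multiple of
  \<open>y dx - x dy\<close>, the trace that the zero of the hyperbolic field at
  \<open>(0, \<i> * pi / 2)\<close> would leave.\<close>

lemma inequivalent_tanh_tanh:
  assumes v: "generic_slope v w1 w2"
    and n: "\<And>z. w1 z = 0 \<Longrightarrow> w2 z = 0 \<Longrightarrow> pdx w1 z = 0 \<Longrightarrow> pdy w2 z = 0 \<Longrightarrow> pdy w1 z + pdx w2 z = 0 \<Longrightarrow> False"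
  shows "inequivalent (\<lambda>(x, y). tanh x * tanh y) v" "inequivalent v (\<lambda>(x, y). tanh x * tanh y)"
proof -
  have w: "holo2_on w1 UNIV" "holo2_on w2 UNIV"
    using generic_slopeD(1)[OF v] by (simp_all add: slope_form_def)
  have na: "\<not> affine_equiv (\<lambda>z. sinh (2 * snd z)) (\<lambda>z. sinh (2 * fst z)) w1 w2"
  proof
    assume "affine_equiv (\<lambda>z. sinh (2 * snd z)) (\<lambda>z. sinh (2 * fst z)) w1 w2"
    from affine_equiv_sinh_imp_degenerate_zero[OF this w] n show False by blast
  qed
  show "inequivalent (\<lambda>(x, y). tanh x * tanh y) v" "inequivalent v (\<lambda>(x, y). tanh x * tanh y)"
    by (rule inequivalentI[OF generic_slope_tanh_tanh v na])+
qed

text \<open>Meant for \<open>v = exp x + exp y\<close>: the nondegenerate zero of the other field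
  would be carried to a zero of the exponential field, which has none.\<close>

lemma inequivalent_of_nonvanishing:
  assumes u: "generic_slope u w1 w2" and v: "generic_slope v w1' w2'"
    and z: "w1 (0, 0) = 0" "w2 (0, 0) = 0"
    and nd: "pdx w1 (0, 0) * pdy w2 (0, 0) - pdy w1 (0, 0) * pdx w2 (0, 0) \<noteq> 0"
    and nz: "\<And>z. w1' z \<noteq> 0"
  shows "inequivalent u v" "inequivalent v u"
proof -
  have w: "holo2_on w1 UNIV" "holo2_on w2 UNIV" "holo2_on w1' UNIV" "holo2_on w2' UNIV"
    using generic_slopeD(1)[OF u] generic_slopeD(1)[OF v] by (simp_all add: slope_form_def)
  have na: "\<not> affine_equiv w1 w2 w1' w2'"
  proof
    assume "affine_equiv w1 w2 w1' w2'"
    then show False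
    proof (rule affine_equivE)
      fix A B C D c d
      assume "A * D - B * C \<noteq> 0"
        "affine_match w1 w2 w1' w2' A B C D c d"
      from nondegenerate_zero_transport[OF w this z nd] nz show False by blast
    qed
  qed
  show "inequivalent u v" "inequivalent v u" by (rule inequivalentI[OF u v na])+
qed

text \<open>An affine bijection cannot carry two nondegenerate zeros to the only zero of a quadratic
  field.\<close>

lemma inequivalent_of_two_zeros:
  assumes u: "generic_slope u w1 w2" and v: "generic_slope v w1' w2'"
    and z: "w1 (0, 0) = 0" "w2 (0, 0) = 0" "w1 (s, 0) = 0" "w2 (s, 0) = 0" "s \<noteq> 0"
    and nd: "pdx w1 (0, 0) * pdy w2 (0, 0) - pdy w1 (0, 0) * pdx w2 (0, 0) \<noteq> 0"
      "pdx w1 (s, 0) * pdy w2 (s, 0) - pdy w1 (s, 0) * pdx w2 (s, 0) \<noteq> 0"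
    and one: "\<And>x y. w1' (x, y) = 0 \<Longrightarrow> w2' (x, y) = 0 \<Longrightarrow> x = 0 \<and> y = 0"
  shows "inequivalent u v" "inequivalent v u"
proof -
  have w: "holo2_on w1 UNIV" "holo2_on w2 UNIV" "holo2_on w1' UNIV" "holo2_on w2' UNIV"
    using generic_slopeD(1)[OF u] generic_slopeD(1)[OF v] by (simp_all add: slope_form_def)
  have na: "\<not> affine_equiv w1 w2 w1' w2'"
  proof
    assume "affine_equiv w1 w2 w1' w2'"
    then show False
    proof (rule affine_equivE)
      fix A B C D c d
      assume k: "A * D - B * C \<noteq> 0" and i:
        "affine_match w1 w2 w1' w2' A B C D c d"
      have "A * 0 + B * 0 + c = 0 \<and> C * 0 + D * 0 + d = 0"
        using nondegenerate_zero_transport[OF w k i z(1,2) nd(1)] one by blast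
      moreover have "A * s + B * 0 + c = 0 \<and> C * s + D * 0 + d = 0"
        using nondegenerate_zero_transport[OF w k i z(3,4) nd(2)] one by blast
      ultimately show False using k z(5) by simp
    qed
  qed
  show "inequivalent u v" "inequivalent v u" by (rule inequivalentI[OF u v na])+
qed

text \<open>Each field has its only zero at the origin, so an affine match is linear. It sends
  \<open>(1, 1)\<close>, a null direction of \<open>x^2 - y^2\<close> that lies in
  \<open>dirs\<close>, to a null direction of \<open>x^2 + y^2\<close>, which would have to lie in
  \<open>dirs\<close> again; but the null directions of \<open>x^2 + y^2\<close> are
  \<open>(1, \<i>)\<close> and \<open>(1, - \<i>)\<close>.\<close>

lemma inequivalent_quadratic:
  "inequivalent (\<lambda>(x, y). x\<^sup>2 - y\<^sup>2) (\<lambda>(x, y). x\<^sup>2 + y\<^sup>2)"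
  "inequivalent (\<lambda>(x, y). x\<^sup>2 + y\<^sup>2) (\<lambda>(x, y). x\<^sup>2 - y\<^sup>2)"
proof -
  have na: "\<not> affine_equiv fst (\<lambda>z. - snd z) fst snd"
  proof
    assume "affine_equiv fst (\<lambda>z. - snd z) fst snd"
    then show False
    proof (rule affine_equivE)
      fix A B C D c d :: complex
      assume k: "A * D - B * C \<noteq> 0"
        and i: "affine_match fst (\<lambda>z. - snd z) fst snd A B C D c d"
        and dd: "\<And>a b. (a, b) \<in> dirs \<Longrightarrow> \<exists>(a', b')\<in>dirs. (A * a + B * b) * b' = (C * a + D * b) * a'"
      have "holo2_on fst UNIV" "holo2_on (\<lambda>z. - snd z) UNIV" "holo2_on fst UNIV" "holo2_on snd UNIV"
        by (intro holo2_intros)+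
      from nondegenerate_zero_transport[OF this k i, of 0 0]
      have cd: "c = 0" "d = 0" by (simp_all add: pd_quadratic)
      define X where "X = A + B" define Y where "Y = C + D"
      have q: "X\<^sup>2 + Y\<^sup>2 = 0"
        using i[unfolded affine_match_def Let_def, rule_format, of 1 1]
        by (simp add: cd X_def Y_def power2_eq_square algebra_simps)
      have "(1, 1) \<in> dirs" by (simp add: dirs_def)
      from dd[OF this] have "\<exists>(a', b')\<in>dirs. X * b' = Y * a'" by (simp add: X_def Y_def)
      then obtain a' b' where ab: "(a', b') \<in> dirs" "X * b' = Y * a'" by blast
      have "X = 0 \<and> Y = 0"
        using ab q unfolding dirs_def by (auto simp: power2_eq_square)
      then have "B = - A" "D = - C" by (auto simp: X_def Y_def add_eq_0_iff)
      with k show False by simp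
    qed
  qed
  show "inequivalent (\<lambda>(x, y). x\<^sup>2 - y\<^sup>2) (\<lambda>(x, y). x\<^sup>2 + y\<^sup>2)"
    "inequivalent (\<lambda>(x, y). x\<^sup>2 + y\<^sup>2) (\<lambda>(x, y). x\<^sup>2 - y\<^sup>2)"
    by (rule inequivalentI[OF generic_slope_quadratic na])+
qed

theorem mainTheorem2:
  fixes us :: "(complex \<times> complex \<Rightarrow> complex) list"
  assumes us: "us =
    [\<lambda>(x, y). tanh x * tanh y,
     \<lambda>(x, y). sin x * sin y,
     \<lambda>(x, y). exp x + exp y,
     \<lambda>(x, y). x\<^sup>2 - y\<^sup>2,
     \<lambda>(x, y). x\<^sup>2 + y\<^sup>2]"
  shows "(\<forall>u\<in>set us. \<forall>p. holo2_at u p \<and> cond_T u p \<longrightarrow> exceptional p (web5 u)) \<and>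
    (\<forall>i<length us. \<forall>j<length us. i \<noteq> j \<longrightarrow>
      (\<forall>p q. holo2_at (us ! i) p \<and> cond_T (us ! i) p \<and> holo2_at (us ! j) q \<and> cond_T (us ! j) q \<longrightarrow>
        \<not> web_equivalent p (web5 (us ! i)) q (web5 (us ! j))))"
proof
  let ?A = "\<lambda>(x, y). tanh x * tanh y :: complex"
  let ?B = "\<lambda>(x, y). sin x * sin y :: complex"
  let ?C = "\<lambda>(x, y). exp x + exp y :: complex"
  let ?D = "\<lambda>(x, y). x\<^sup>2 - y\<^sup>2 :: complex"
  let ?E = "\<lambda>(x, y). x\<^sup>2 + y\<^sup>2 :: complex"
  have "exceptional p (web5 u)" if "u \<in> {?A, ?B, ?C, ?D, ?E}" "holo2_at u p" "cond_T u p" for u p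
    using that(1)
  proof (elim insertE emptyE)
    assume u: "u = ?A" show ?thesis
      using that(2,3) unfolding u by (intro exceptionalI[OF generic_slope_tanh_tanh] maximal_rank_tanh_tanh)
  next
    assume u: "u = ?B" show ?thesis
      using that(2,3) unfolding u by (intro exceptionalI[OF generic_slope_sin_sin] maximal_rank_sin_sin)
  next
    assume u: "u = ?C" show ?thesis
      using that(2,3) unfolding u by (intro exceptionalI[OF generic_slope_exp_exp] maximal_rank_exp_exp)
  next
    assume u: "u = ?D" show ?thesis
      using that(2,3) unfolding u
      by (intro exceptionalI[OF generic_slope_quadratic(1)] maximal_rank_difference_of_squares)
  next
    assume u: "u = ?E" show ?thesis
      using that(2,3) unfolding u
      by (intro exceptionalI[OF generic_slope_quadratic(2)] maximal_rank_sum_of_squares)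
  qed
  then show "\<forall>u\<in>set us. \<forall>p. holo2_at u p \<and> cond_T u p \<longrightarrow> exceptional p (web5 u)"
    unfolding us by simp
  \<comment> \<open>Up to constant factors, the four products are the components of the sine field
    and the derivatives that enter \<open>inequivalent_tanh_tanh\<close>. Their squares add up to 1,
    so the sine field has no zero of the degenerate kind.\<close>
  have trig: "cos x * sin y = 0 \<Longrightarrow> sin x * cos y = 0 \<Longrightarrow> sin x * sin y = 0 \<Longrightarrow> cos x * cos y = 0 \<Longrightarrow> False"
    for x y :: complex
  proof -
    assume z: "cos x * sin y = 0" "sin x * cos y = 0" "sin x * sin y = 0" "cos x * cos y = 0"
    have "1 = ((sin x)\<^sup>2 + (cos x)\<^sup>2) * ((sin y)\<^sup>2 + (cos y)\<^sup>2)" by simp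
    also have "\<dots> = (cos x * sin y)\<^sup>2 + (sin x * cos y)\<^sup>2 + (sin x * sin y)\<^sup>2 + (cos x * cos y)\<^sup>2"
      by algebra
    also have "\<dots> = 0" unfolding z by simp
    finally show False by simp
  qed
  have AB: "inequivalent ?A ?B" "inequivalent ?B ?A"
    by (rule inequivalent_tanh_tanh[OF generic_slope_sin_sin]; unfold pd_trig; rule trig; simp)+
  have AC: "inequivalent ?A ?C" "inequivalent ?C ?A"
    by (rule inequivalent_tanh_tanh[OF generic_slope_exp_exp]; simp)+
  have AD: "inequivalent ?A ?D" "inequivalent ?D ?A"
    by (rule inequivalent_tanh_tanh[OF generic_slope_quadratic(1)]; simp add: pd_quadratic)+
  have AE: "inequivalent ?A ?E" "inequivalent ?E ?A"
    by (rule inequivalent_tanh_tanh[OF generic_slope_quadratic(2)]; simp add: pd_quadratic)+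
  have BC: "inequivalent ?B ?C" "inequivalent ?C ?B"
    by (rule inequivalent_of_nonvanishing[OF generic_slope_sin_sin generic_slope_exp_exp]; simp add: pd_trig)+
  have DC: "inequivalent ?D ?C" "inequivalent ?C ?D"
    by (rule inequivalent_of_nonvanishing[OF generic_slope_quadratic(1) generic_slope_exp_exp]; simp add: pd_quadratic)+
  have EC: "inequivalent ?E ?C" "inequivalent ?C ?E"
    by (rule inequivalent_of_nonvanishing[OF generic_slope_quadratic(2) generic_slope_exp_exp]; simp add: pd_quadratic)+
  have BD: "inequivalent ?B ?D" "inequivalent ?D ?B"
    by (rule inequivalent_of_two_zeros[OF generic_slope_sin_sin generic_slope_quadratic(1), where s = "of_real pi"];
        simp add: pd_trig sin_of_real cos_of_real)+
  have BE: "inequivalent ?B ?E" "inequivalent ?E ?B"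
    by (rule inequivalent_of_two_zeros[OF generic_slope_sin_sin generic_slope_quadratic(2), where s = "of_real pi"];
        simp add: pd_trig sin_of_real cos_of_real)+
  have nth: "us ! 0 = ?A" "us ! 1 = ?B" "us ! 2 = ?C" "us ! 3 = ?D" "us ! 4 = ?E" "length us = 5"
    by (simp_all add: us eval_nat_numeral)
  have "inequivalent (us ! i) (us ! j)" if "i < 5" "j < 5" "i \<noteq> j" for i j
    using that AB AC AD AE BC DC EC BD BE inequivalent_quadratic unfolding less_5_cases
    by (elim disjE) (simp_all only: nth)
  then show "\<forall>i<length us. \<forall>j<length us. i \<noteq> j \<longrightarrow>
      (\<forall>p q. holo2_at (us ! i) p \<and> cond_T (us ! i) p \<and> holo2_at (us ! j) q \<and> cond_T (us ! j) q \<longrightarrow>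
        \<not> web_equivalent p (web5 (us ! i)) q (web5 (us ! j)))"
    unfolding nth(6) inequivalent_def by blast
qed

end
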